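(* Let $A$ be a PID with fraction field $K$ of characteristic $0$, let $g\ge1$, $n=2g+2$, and let $f(x,y)=f_0x^n+f_1x^{n-1}y+\cdots+f_ny^n\in A[x,y]$ be a binary form of degree $n$ with nonzero discriminant and with $f_0\ne0$. Let $X_K$ be the smooth hyperelliptic curve $z^2=f(x,y)$ over $K$ in the weighted projective space $\mathbb{P}_K(1,1,g+1)$, with double cover $\pi:X_K\to\mathbb{P}^1_K$. Let $D_K$ be an effective ($K$-rational) divisor on $X_K$ of degree $2g-1$ not intersecting the locus $z=0$, and write $D_{\overline K}=\sum_{i=1}^k(\alpha_i:1:\beta_i)+\sum_{i=k+1}^{2g-1}(1:0:\beta_i)$ with $\alpha_i,\beta_i\in\overline K$. Let $w=\prod_{i=1}^{2g-1}\beta_i\in K^\times$. Let $U(x,y)\in A[x,y]$ be a primitive form of degree $2g-1$ vanishing precisely at the points of $\pi(D_{\overline K})$ with multiplicity, and let $u$ denote the leading coefficient of $U(X,1)$, so that $U(X,1)=u\prod_{i=1}^k(X-\alpha_i)$. Let $L_f=K[X]/(f(X,1))$ and let $\alpha=U(X,1)\bmod f(X,1)\in L_f$. Then: 1. The pair $(\alpha,\ u^{-(g+1)}f_0^{n-1}w^{-1})$ lies in the set of pairs $(\alpha,z)\in L_f^\times\times K^\times$ with $z^2\mathbf{N}_{L_f/K}(\alpha)=f_0^{n+1}$, and so corresponds (under the bijection recalled in the context) to an orbit in $\mathrm{SL}_n(K)\backslash V_f(K)$. 2. This orbit intersects $V_f(A)$ (i.e. has an integral representative).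
   Context: A form over $A$ is primitive if its coefficients generate the unit ideal. For a ring $R$, $V(R)$ is the set of pairs $(P,Q)$ of symmetric $n\times n$ matrices over $R$, with $\mathrm{SL}_n(R)$-action $g\cdot(P,Q)=(g^{-t}Pg^{-1},g^{-t}Qg^{-1})$; the invariant binary form is $f_{P,Q}(x,y)=(-1)^{n(n-1)/2}\det(Px-Qy)$, and $V_f(R)$ is the set of $(P,Q)\in V(R)$ with $f_{P,Q}=f$. Bijection: when $f_0\neq 0$, $L_f=K[X]/(f(X,1))$ is an étale $K$-algebra with basis $1,X,\dots,X^{n-1}$. Let $\tau:L_f\to K$ be the $K$-linear form giving the coefficient of $X^{n-1}$ in this basis. Given $(\alpha,z)\in L_f^\times\times K^\times$ with $z^2\mathbf{N}_{L_f/K}(\alpha)=f_0^{n+1}$, choose any $K$-basis $b_1,\dots,b_n$ of $L_f$ with $b_1\wedge\cdots\wedge b_n=z\cdot(1\wedge X\wedge\cdots\wedge X^{n-1})$ and let $P$, $Q$ be the Gram matrices in this basis of the symmetric bilinear forms $(a,b)\mapsto f_0^{-1}\tau(\alpha ab)$ and $(a,b)\mapsto f_0^{-1}\tau(X\alpha ab)$ respectively. Then $(P,Q)\in V_f(K)$ and its $\mathrm{SL}_n(K)$-orbit is independent of the basis; this gives a bijection between $\mathrm{SL}_n(K)\backslash V_f(K)$ and the set of such pairs $(\alpha,z)$ modulo the equivalence relation $(\alpha,z)\sim(\beta^2\alpha,\mathbf{N}_{L_f/K}(\beta)^{-1}z)$ for $\beta\in L_f^\times$. *)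

theory Defs
  imports
    "HOL-Algebra.Algebraic_Closure_Type"
    "HOL-Algebra.Ring_Divisibility"
    "HOL-Computational_Algebra.Computational_Algebra"
    "Jordan_Normal_Form.Determinant"
    "Jordan_Normal_Form.Gauss_Jordan_Elimination"
    "Subresultants.Resultant_Prelim"
begin

section \<open>Binary forms\<close>

text \<open>
  A binary form \<open>c\<^sub>0 x\<^sup>n + c\<^sub>1 x\<^sup>n\<^sup>-\<^sup>1 y + \<dots> + c\<^sub>n y\<^sup>n\<close> of degree \<open>n\<close> is given by \<open>n\<close> and its
  coefficients \<open>c 0, \<dots>, c n\<close>; the values \<open>c i\<close> for \<open>i > n\<close> are never used.
  In \<open>R[x,y] = R[y][x]\<close> the outer variable is \<open>x\<close> and the inner one is \<open>y\<close>.
\<close>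

definition binform :: "nat \<Rightarrow> (nat \<Rightarrow> 'r :: comm_ring_1) \<Rightarrow> 'r poly poly" where
  "binform n c = (\<Sum>i\<le>n. Polynomial.monom (Polynomial.monom (c i) i) (n - i))"

definition form_eval :: "nat \<Rightarrow> (nat \<Rightarrow> 'r :: comm_ring_1) \<Rightarrow> 'r \<Rightarrow> 'r \<Rightarrow> 'r" where
  "form_eval n c x y = (\<Sum>i\<le>n. c i * x ^ (n - i) * y ^ i)"

text \<open>The dehomogenisations \<open>c(X,1)\<close> and \<open>c(1,Y)\<close>.\<close>

definition dehom_x :: "nat \<Rightarrow> (nat \<Rightarrow> 'r :: comm_ring_1) \<Rightarrow> 'r poly" where
  "dehom_x n c = (\<Sum>i\<le>n. Polynomial.monom (c i) (n - i))"

definition dehom_y :: "nat \<Rightarrow> (nat \<Rightarrow> 'r :: comm_ring_1) \<Rightarrow> 'r poly" where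
  "dehom_y n c = (\<Sum>i\<le>n. Polynomial.monom (c i) i)"

text \<open>
  For \<open>c 0 \<noteq> 0\<close> the polynomial \<open>c(X,1)\<close> has degree \<open>n\<close>, and the discriminant of the form is the
  usual discriminant of that polynomial. In characteristic 0 (where the derivative has degree
  exactly \<open>n - 1\<close>) this is given by the classical resultant formula. It is only used for
  \<open>c 0 \<noteq> 0\<close> and in characteristic 0.
\<close>

definition form_disc :: "nat \<Rightarrow> (nat \<Rightarrow> 'k :: field) \<Rightarrow> 'k" where
  "form_disc n c =
     (-1) ^ (n * (n - 1) div 2) * resultant (dehom_x n c) (pderiv (dehom_x n c)) / c 0"

definition primitive_form :: "nat \<Rightarrow> (nat \<Rightarrow> 'r :: comm_ring_1) \<Rightarrow> bool" where
  "primitive_form n c \<longleftrightarrow>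
     Idl\<^bsub>(ring_of_type_algebra :: 'r ring)\<^esub> (c ` {..n}) = carrier (ring_of_type_algebra :: 'r ring)"

text \<open>
  Order of vanishing of a nonzero form at the point \<open>(a : b)\<close> of the projective line, computed in
  the chart \<open>y \<noteq> 0\<close> if \<open>b \<noteq> 0\<close>, and in the chart \<open>x \<noteq> 0\<close> at the remaining point \<open>(1 : 0)\<close>.
\<close>

definition vanishing_order :: "nat \<Rightarrow> (nat \<Rightarrow> 'k :: field) \<Rightarrow> 'k \<Rightarrow> 'k \<Rightarrow> nat" where
  "vanishing_order n c a b =
     (if b \<noteq> 0 then Polynomial.order (a / b) (dehom_x n c) else Polynomial.order 0 (dehom_y n c))"

section \<open>Pairs of symmetric matrices\<close>

definition sym_pairs :: "nat \<Rightarrow> ('r :: comm_ring_1 mat \<times> 'r mat) set" where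
  "sym_pairs n = {(P, Q). P \<in> carrier_mat n n \<and> Q \<in> carrier_mat n n \<and>
     transpose_mat P = P \<and> transpose_mat Q = Q}"

text \<open>\<open>(-1)\<^sup>n\<^sup>(\<^sup>n\<^sup>-\<^sup>1\<^sup>)\<^sup>/\<^sup>2 det (P x - Q y)\<close>, with \<open>[:0, 1:]\<close> the variable \<open>x\<close> and \<open>[:[:0, 1:]:]\<close> the variable \<open>y\<close>.\<close>

definition invariant_form :: "nat \<Rightarrow> 'r :: comm_ring_1 mat \<Rightarrow> 'r mat \<Rightarrow> 'r poly poly" where
  "invariant_form n P Q = (-1) ^ (n * (n - 1) div 2) *
     det ([:0, 1:] \<cdot>\<^sub>m map_mat (\<lambda>r. [:[:r:]:]) P - [:[:0, 1:]:] \<cdot>\<^sub>m map_mat (\<lambda>r. [:[:r:]:]) Q)"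

definition V_form :: "nat \<Rightarrow> (nat \<Rightarrow> 'r :: comm_ring_1) \<Rightarrow> ('r mat \<times> 'r mat) set" where
  "V_form n c = {(P, Q) \<in> sym_pairs n. invariant_form n P Q = binform n c}"

definition SL_mat :: "nat \<Rightarrow> 'k :: field mat set" where
  "SL_mat n = {h \<in> carrier_mat n n. det h = 1}"

definition SL_act :: "'k :: field mat \<Rightarrow> 'k mat \<times> 'k mat \<Rightarrow> 'k mat \<times> 'k mat" where
  "SL_act h = (\<lambda>(P, Q). let h' = the (mat_inverse h) in
     (transpose_mat h' * P * h', transpose_mat h' * Q * h'))"

definition SL_orbit :: "nat \<Rightarrow> 'k :: field mat \<times> 'k mat \<Rightarrow> ('k mat \<times> 'k mat) set" where
  "SL_orbit n v = (\<lambda>h. SL_act h v) ` SL_mat n"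

definition SL_orbits :: "nat \<Rightarrow> (nat \<Rightarrow> 'k :: field) \<Rightarrow> ('k mat \<times> 'k mat) set set" where
  "SL_orbits n c = SL_orbit n ` V_form n c"

section \<open>The algebra \<open>L\<^sub>f\<close> and the orbit attached to a pair\<close>

text \<open>
  For \<open>c 0 \<noteq> 0\<close> (so that \<open>c(X,1)\<close> has degree \<open>n\<close>), \<open>L\<^sub>f = K[X] / (c(X,1))\<close> is realised on the
  remainders modulo \<open>c(X,1)\<close>. The coordinates of an element in the basis \<open>1, X, \<dots>, X\<^sup>n\<^sup>-\<^sup>1\<close> are
  then the coefficients of the remainder.
\<close>

definition Lf :: "nat \<Rightarrow> (nat \<Rightarrow> 'k :: field) \<Rightarrow> 'k poly ring" where
  "Lf n c = \<lparr>carrier = {p. p mod dehom_x n c = p},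
             monoid.mult = (\<lambda>p q. (p * q) mod dehom_x n c), one = 1 mod dehom_x n c,
             zero = 0, add = (+)\<rparr>"

definition Lf_class :: "nat \<Rightarrow> (nat \<Rightarrow> 'k :: field) \<Rightarrow> 'k poly \<Rightarrow> 'k poly" where
  "Lf_class n c p = p mod dehom_x n c"

definition Lf_tau :: "nat \<Rightarrow> 'k :: field poly \<Rightarrow> 'k" where
  "Lf_tau n p = Polynomial.coeff p (n - 1)"

text \<open>The norm: determinant of multiplication by \<open>a\<close> in the basis \<open>1, X, \<dots>, X\<^sup>n\<^sup>-\<^sup>1\<close>.\<close>

definition Lf_norm :: "nat \<Rightarrow> (nat \<Rightarrow> 'k :: field) \<Rightarrow> 'k poly \<Rightarrow> 'k" where
  "Lf_norm n c a = det (mat n n (\<lambda>(i, j).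
     Polynomial.coeff (a \<otimes>\<^bsub>Lf n c\<^esub> Lf_class n c (Polynomial.monom 1 j)) i))"

definition norm_pairs :: "nat \<Rightarrow> (nat \<Rightarrow> 'k :: field) \<Rightarrow> ('k poly \<times> 'k) set" where
  "norm_pairs n c = {(\<alpha>, z). \<alpha> \<in> Units (Lf n c) \<and> z \<noteq> 0 \<and> z ^ 2 * Lf_norm n c \<alpha> = c 0 ^ (n + 1)}"

text \<open>
  The bases \<open>b\<^sub>1, \<dots>, b\<^sub>n\<close> (indexed from 0) with
  \<open>b\<^sub>1 \<and> \<dots> \<and> b\<^sub>n = z \<cdot> (1 \<and> X \<and> \<dots> \<and> X\<^sup>n\<^sup>-\<^sup>1)\<close>: by definition of the top exterior power,
  the scalar is the determinant of the matrix of coordinates. As \<open>z \<noteq> 0\<close> in every use, the determinant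
  condition already forces \<open>b\<close> to be a basis.
\<close>

definition adapted_bases :: "nat \<Rightarrow> (nat \<Rightarrow> 'k :: field) \<Rightarrow> 'k \<Rightarrow> (nat \<Rightarrow> 'k poly) set" where
  "adapted_bases n c z = {b. (\<forall>i<n. b i \<in> carrier (Lf n c)) \<and>
     det (mat n n (\<lambda>(i, j). Polynomial.coeff (b j) i)) = z}"

definition gram_pair ::
  "nat \<Rightarrow> (nat \<Rightarrow> 'k :: field) \<Rightarrow> 'k poly \<Rightarrow> (nat \<Rightarrow> 'k poly) \<Rightarrow> 'k mat \<times> 'k mat" where
  "gram_pair n c \<alpha> b =
     (mat n n (\<lambda>(i, j). inverse (c 0) *
        Lf_tau n (\<alpha> \<otimes>\<^bsub>Lf n c\<^esub> b i \<otimes>\<^bsub>Lf n c\<^esub> b j)),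
      mat n n (\<lambda>(i, j). inverse (c 0) *
        Lf_tau n (Lf_class n c [:0, 1:] \<otimes>\<^bsub>Lf n c\<^esub> \<alpha> \<otimes>\<^bsub>Lf n c\<^esub> b i \<otimes>\<^bsub>Lf n c\<^esub> b j)))"

text \<open>
  The orbit of the Gram pair in any adapted basis. Independence of the basis is not built in: the
  definition takes the union over all adapted bases, so independence (together with existence of a
  basis) amounts to the statement that this set is an element of \<^const>\<open>SL_orbits\<close>.
\<close>

definition orbit_of_pair ::
  "nat \<Rightarrow> (nat \<Rightarrow> 'k :: field) \<Rightarrow> 'k poly \<times> 'k \<Rightarrow> ('k mat \<times> 'k mat) set" where
  "orbit_of_pair n c = (\<lambda>(\<alpha>, z). \<Union>b \<in> adapted_bases n c z. SL_orbit n (gram_pair n c \<alpha> b))"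

section \<open>Hyperelliptic curves and rational divisors\<close>

text \<open>Points of \<open>\<P>(1,1,m)\<close> and of \<open>\<P>\<^sup>1\<close>, as classes of homogeneous coordinates.\<close>

definition wpt :: "nat \<Rightarrow> 'l :: field \<Rightarrow> 'l \<Rightarrow> 'l \<Rightarrow> ('l \<times> 'l \<times> 'l) set" where
  "wpt m x y z = {(t * x, t * y, t ^ m * z) | t. t \<noteq> 0}"

definition ppt :: "'l :: field \<Rightarrow> 'l \<Rightarrow> ('l \<times> 'l) set" where
  "ppt x y = {(t * x, t * y) | t. t \<noteq> 0}"

text \<open>The points of \<open>z\<^sup>2 = c(x,y)\<close> in \<open>\<P>(1,1,g+1)\<close>, for a form \<open>c\<close> of degree \<open>2g+2\<close>.\<close>

definition hyp_curve :: "nat \<Rightarrow> (nat \<Rightarrow> 'l :: field) \<Rightarrow> ('l \<times> 'l \<times> 'l) set set" where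
  "hyp_curve g c = {wpt (g + 1) x y z | x y z.
     (x, y, z) \<noteq> (0, 0, 0) \<and> z ^ 2 = form_eval (2 * g + 2) c x y}"

text \<open>The double cover \<open>(x : y : z) \<mapsto> (x : y)\<close>.\<close>

definition hyp_proj :: "('l \<times> 'l \<times> 'l) set \<Rightarrow> ('l \<times> 'l) set" where
  "hyp_proj p = (\<lambda>(x, y, z). (x, y)) ` p"

definition galois_aut :: "('k :: field alg_closure \<Rightarrow> 'k alg_closure) set" where
  "galois_aut = {\<sigma>. bij \<sigma> \<and> (\<forall>x y. \<sigma> (x + y) = \<sigma> x + \<sigma> y) \<and>
     (\<forall>x y. \<sigma> (x * y) = \<sigma> x * \<sigma> y) \<and> (\<forall>a. \<sigma> (to_ac a) = to_ac a)}"

definition galois_pt ::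
  "('l \<Rightarrow> 'l) \<Rightarrow> ('l \<times> 'l \<times> 'l) set \<Rightarrow> ('l \<times> 'l \<times> 'l) set" where
  "galois_pt \<sigma> p = (\<lambda>(x, y, z). (\<sigma> x, \<sigma> y, \<sigma> z)) ` p"

text \<open>
  Effective divisors of degree \<open>d\<close> on the curve over \<open>K\<close>, given by their base change to the
  algebraic closure: multisets of \<open>d\<close> geometric points that are stable under the Galois group.
  As \<open>K\<close> will be perfect (of characteristic 0), these are exactly the effective divisors on \<open>X\<^sub>K\<close>.
\<close>

definition effective_divisors ::
  "nat \<Rightarrow> (nat \<Rightarrow> 'k :: field) \<Rightarrow> nat \<Rightarrow>
     ('k alg_closure \<times> 'k alg_closure \<times> 'k alg_closure) set multiset set" where
  "effective_divisors g c d = {D. set_mset D \<subseteq> hyp_curve g (\<lambda>i. to_ac (c i)) \<and> size D = d \<and>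
     (\<forall>\<sigma> \<in> galois_aut. image_mset (galois_pt \<sigma>) D = D)}"

end

theory Submission
  imports Defs
begin

hide_const (open) UnivPoly.coeff UnivPoly.monom Polynomials.lead_coeff Polynomials.degree

text \<open>
  After a change of coordinate \<open>y \<mapsto> y + c x\<close> no point of the divisor lies at infinity. Split off the
  even part of the multiplicities: up to a unit, \<open>U = U\<^sub>1 S\<^sup>2\<close> with \<open>U\<^sub>1\<close> squarefree, and the
  \<open>z\<close>-coordinates of the points over the zeros of \<open>U\<^sub>1\<close> are interpolated by some \<open>V\<close> with
  \<open>V\<^sup>2 \<equiv> f (mod U\<^sub>1)\<close>, which is defined over \<open>K\<close> by Galois descent. Multiplying the basis by the
  inverse of \<open>S\<close> reduces the claim to \<open>U\<^sub>1\<close>.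

  The residue theorem on the projective line turns the forms \<open>(p, q) \<mapsto> \<tau>(U\<^sub>1\<^sup>-\<^sup>1 p q)\<close> on \<open>L\<^sub>f\<close>
  into the residue forms \<open>(p, q) \<mapsto> - \<rho>(f\<^sup>-\<^sup>1 p q)\<close> on \<open>K[X]/(U\<^sub>1)\<close>. For the latter, a
  lattice \<open>\<Phi>\<close> is built in \<open>K[X]/(U\<^sub>1)\<close> such that the forms \<open>\<rho>(\<phi> \<psi>)\<close> and \<open>\<rho>(X \<phi> \<psi>)\<close> are
  integral on \<open>\<Phi>\<close>, and such that \<open>V \<Phi>\<close> lifts to integral polynomials of small degree; the
  primitivity of \<open>U\<^sub>1\<close> forces its determinant to have the right value up to a unit. The lifts of
  \<open>V \<Phi>\<close>, small multiples of \<open>U\<^sub>1\<close> and a unimodular set of further vectors form a basis of \<open>L\<^sub>f\<close> on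
  which both forms are integral and whose determinant has the required size up to an element of \<open>A\<close>.
\<close>

section \<open>Multiplication matrices and Gram matrices modulo a polynomial\<close>

text \<open>Residue forms \<open>rho\<close> see only finite zeros, and f and U want different
  charts: f keeps the given one, in which f_0 nonzero leaves no zero at infinity and in which L_f is
  defined, while U is read after the substitution. Hence the substitution accompanies the whole
  argument. The obstacle is that V has coefficients in K only. With \<Omega>_M the elements that
  pair integrally with the integral polynomials of degree < M, the lattice is B + V \<Omega>_(M+1),
  where B is defined by duality against a module containing V \<Omega>_M; this matches the
  denominators of V against their own dual. Degrees: deg U_1 = 2h - 1 is odd, as 2g - 1 is odd and
  S^2 takes away an even degree. With deg f = 2s the lifts have degree at most m = h + s - 2, for 2m
  + 1 = deg U_1 + deg f - 2 is the degree of the forms p for which p / (U_1 f) is a differential on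
  the line; the summand 1 makes room for the factor X of the second form. Determinants are compared
  through norms, hence only in squared form; A is integrally closed, so the quotient itself lies in
  A and can be absorbed in one basis vector.\<close>

definition coef_mat :: "nat \<Rightarrow> (nat \<Rightarrow> 'k :: comm_ring_1 poly) \<Rightarrow> 'k mat" where
  "coef_mat n b = mat n n (\<lambda>(i, j). coeff (b j) i)"

definition mul_mat :: "'k :: field poly \<Rightarrow> 'k poly \<Rightarrow> 'k mat" where
  "mul_mat f a = coef_mat (degree f) (\<lambda>j. (a * monom 1 j) mod f)"

definition nrm :: "'k :: field poly \<Rightarrow> 'k poly \<Rightarrow> 'k" where
  "nrm f a = det (mul_mat f a)"

text \<open>The coefficient of \<open>1/X\<close> in the expansion of \<open>h/f\<close> at infinity.\<close>

definition rho :: "'k :: field poly \<Rightarrow> 'k poly \<Rightarrow> 'k" where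
  "rho f h = coeff (h mod f) (degree f - 1) / lead_coeff f"

definition gram :: "'k :: field poly \<Rightarrow> 'k poly \<Rightarrow> (nat \<Rightarrow> 'k poly) \<Rightarrow> 'k mat" where
  "gram f w b = mat (degree f) (degree f) (\<lambda>(i, j). rho f (w * b i * b j))"

lemma coef_mat_carrier [simp]: "coef_mat n b \<in> carrier_mat n n"
  by (simp add: coef_mat_def)

lemma mul_mat_carrier [simp]: "mul_mat f a \<in> carrier_mat (degree f) (degree f)"
  by (simp add: mul_mat_def)

lemma gram_carrier [simp]: "gram f w b \<in> carrier_mat (degree f) (degree f)"
  by (simp add: gram_def)

lemma coef_mat_dim [simp]: "dim_row (coef_mat n b) = n" "dim_col (coef_mat n b) = n"
  by (simp_all add: coef_mat_def)

lemma gram_dim [simp]: "dim_row (gram f w b) = degree f" "dim_col (gram f w b) = degree f"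
  by (simp_all add: gram_def)

lemma poly_eq_sum_monom:
  assumes "\<And>i. i \<ge> n \<Longrightarrow> coeff p i = 0"
  shows "p = (\<Sum>i<n. monom (coeff p i) i)"
  using assms by (intro poly_eqI) (auto simp: coeff_sum not_less)

lemma coeff_mod_eq_0:
  fixes f :: "'k :: field poly"
  assumes "degree f > 0" "i \<ge> degree f"
  shows "coeff (p mod f) i = 0"
  using assms degree_mod_less'[of f p]
  by (metis coeff_0 coeff_eq_0 degree_0 less_irrefl order_less_le_trans)

lemma poly_mod_sum: "(\<Sum>i\<in>A. p i) mod (f :: 'k :: field poly) = (\<Sum>i\<in>A. p i mod f)"
  by (induction A rule: infinite_finite_induct) (auto simp: poly_mod_add_left)

lemma rho_add: "rho f (p + q) = rho f p + rho f q"
  by (simp add: rho_def poly_mod_add_left add_divide_distrib)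

lemma rho_0 [simp]: "rho f 0 = 0"
  by (simp add: rho_def)

lemma rho_smult: "rho f (smult c p) = c * rho f p"
  by (simp add: rho_def mod_smult_left)

lemma rho_diff: "rho f (p - q) = rho f p - rho f q"
  using rho_add[of f "p - q" q] by simp

lemma rho_sum: "rho f (\<Sum>i\<in>A. p i) = (\<Sum>i\<in>A. rho f (p i))"
  by (induction A rule: infinite_finite_induct) (auto simp: rho_add)

lemma rho_cong: "p mod f = q mod f \<Longrightarrow> rho f p = rho f q"
  by (simp add: rho_def)

lemma rho_mod [simp]: "rho f (p mod f) = rho f p"
  by (simp add: rho_def)

lemma rho_small: "coeff p (degree f - 1) = 0 \<Longrightarrow> degree p < degree f \<Longrightarrow> rho f p = 0"
  by (simp add: rho_def mod_poly_less)

lemma rho_less: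
  assumes "degree p < degree f"
  shows "rho f p = coeff p (degree f - 1) / lead_coeff f"
  using assms by (simp add: rho_def mod_poly_less)

lemma mult_mod_poly_expand:
  fixes f :: "'k :: field poly"
  assumes "\<And>i. i \<ge> n \<Longrightarrow> coeff q i = 0"
  shows "(a * q) mod f = (\<Sum>k<n. smult (coeff q k) ((a * monom 1 k) mod f))"
proof -
  have "a * q = a * (\<Sum>k<n. monom (coeff q k) k)"
    using poly_eq_sum_monom[OF assms] by simp
  also have "\<dots> = (\<Sum>k<n. smult (coeff q k) (a * monom 1 k))"
    unfolding sum_distrib_left
    by (intro sum.cong refl) (metis mult.right_neutral mult_smult_right smult_monom)
  finally show ?thesis
    by (simp add: poly_mod_sum mod_smult_left)
qed

lemma rho_expand:
  fixes f :: "'k :: field poly"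
  assumes "\<And>i. i \<ge> n \<Longrightarrow> coeff q i = 0"
  shows "rho f (a * q) = (\<Sum>k<n. coeff q k * rho f (a * monom 1 k))"
proof -
  have "rho f (a * q) = rho f ((a * q) mod f)" by simp
  also have "\<dots> = (\<Sum>k<n. coeff q k * rho f (a * monom 1 k))"
    by (subst mult_mod_poly_expand[OF assms]) (simp_all add: rho_sum rho_smult)
  finally show ?thesis .
qed

lemma coef_mat_mult_mod:
  fixes f :: "'k :: field poly"
  assumes b: "\<And>i j. j < degree f \<Longrightarrow> i \<ge> degree f \<Longrightarrow> coeff (b j) i = 0"
  shows "coef_mat (degree f) (\<lambda>j. (a * b j) mod f) = mul_mat f a * coef_mat (degree f) b"
proof (rule eq_matI)
  fix i j assume "i < dim_row (mul_mat f a * coef_mat (degree f) b)"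
    "j < dim_col (mul_mat f a * coef_mat (degree f) b)"
  hence i: "i < degree f" and j: "j < degree f"
    by (auto simp: mul_mat_def)
  have "coeff ((a * b j) mod f) i =
      (\<Sum>k<degree f. coeff (b j) k * coeff ((a * monom 1 k) mod f) i)"
    using j by (subst mult_mod_poly_expand[where n = "degree f"]) (simp_all add: b coeff_sum)
  thus "coef_mat (degree f) (\<lambda>j. (a * b j) mod f) $$ (i, j) =
      (mul_mat f a * coef_mat (degree f) b) $$ (i, j)"
    using i j by (simp add: mul_mat_def coef_mat_def scalar_prod_def lessThan_atLeast0 mult.commute)
qed (auto simp: mul_mat_def)

lemma mul_mat_mod [simp]: "mul_mat f (a mod f) = mul_mat f a"
  by (simp add: mul_mat_def mod_mult_left_eq)

lemma nrm_mod [simp]: "nrm f (a mod f) = nrm f a"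
  by (simp add: nrm_def)

section \<open>Multiplicativity of the norm and determinants of residue forms\<close>

lemma mul_mat_mult:
  assumes "degree f > 0"
  shows "mul_mat f (a * b) = mul_mat f a * mul_mat f b"
proof -
  have "mul_mat f (a * b) = coef_mat (degree f) (\<lambda>j. (a * ((b * monom 1 j) mod f)) mod f)"
    by (simp add: mul_mat_def mod_mult_right_eq mult.assoc)
  also have "\<dots> = mul_mat f a * mul_mat f b"
    unfolding mul_mat_def[of f b] using assms by (intro coef_mat_mult_mod) (simp add: coeff_mod_eq_0)
  finally show ?thesis .
qed

lemma nrm_mult: "degree f > 0 \<Longrightarrow> nrm f (a * b) = nrm f a * nrm f b"
  by (simp add: nrm_def mul_mat_mult det_mult[of _ "degree f"])

lemma nrm_const:
  assumes "degree f > 0"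
  shows "nrm f [:c:] = c ^ degree f"
proof -
  have "mul_mat f [:c:] = c \<cdot>\<^sub>m 1\<^sub>m (degree f)"
    by (intro eq_matI) (auto simp: mul_mat_def coef_mat_def mod_smult_left mod_poly_less degree_monom_eq)
  thus ?thesis by (simp add: nrm_def)
qed

lemma nrm_1 [simp]: "degree f > 0 \<Longrightarrow> nrm f 1 = 1"
  using nrm_const[of f 1] by (simp add: one_pCons)

lemma nrm_prod: "degree f > 0 \<Longrightarrow> nrm f (\<Prod>i\<in>A. p i) = (\<Prod>i\<in>A. nrm f (p i))"
  by (induction A rule: infinite_finite_induct) (auto simp: nrm_mult)

lemma nrm_prod_mset: "degree f > 0 \<Longrightarrow> nrm f (\<Prod>i\<in>#A. p i) = (\<Prod>i\<in>#A. nrm f (p i))"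
  by (induction A) (auto simp: nrm_mult)

text \<open>Zeros above the antidiagonal: expansion along the first row leaves only its last entry,
  and the remaining minor is Hankel again, for the shifted sequence. The sign is that of reversing q
  columns.\<close>

lemma det_hankel:
  fixes h :: "nat \<Rightarrow> 'k :: comm_ring_1"
  assumes "\<And>s. Suc s < q \<Longrightarrow> h s = 0"
  shows "det (mat q q (\<lambda>(i, j). h (i + j))) = (-1) ^ (q * (q - 1) div 2) * h (q - 1) ^ q"
  using assms
proof (induction q arbitrary: h)
  case 0
  show ?case by simp
next
  case (Suc q)
  let ?A = "mat (Suc q) (Suc q) (\<lambda>(i, j). h (i + j))"
  have "det ?A = (\<Sum>j<Suc q. ?A $$ (0, j) * cofactor ?A 0 j)"
    by (rule laplace_expansion_row) auto
  also have "\<dots> = (\<Sum>j<Suc q. if j = q then h q * cofactor ?A 0 q else 0)"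
    using Suc.prems by (intro sum.cong) auto
  also have "\<dots> = h q * cofactor ?A 0 q"
    by simp
  also have "cofactor ?A 0 q = (-1) ^ q * det (mat q q (\<lambda>(i, j). h (Suc (i + j))))"
    unfolding cofactor_def mat_delete_def
    by (auto intro!: arg_cong[where f = det] arg_cong2[where f = times] eq_matI)
  also have "det (mat q q (\<lambda>(i, j). h (Suc (i + j)))) =
      (-1) ^ (q * (q - 1) div 2) * h (Suc (q - 1)) ^ q"
    using Suc.prems by (intro Suc.IH[of "\<lambda>s. h (Suc s)"]) auto
  also have "h (Suc (q - 1)) ^ q = h q ^ q"
    by (cases q) auto
  also have "h q * ((-1) ^ q * ((-1) ^ (q * (q - 1) div 2) * h q ^ q)) =
      (-1) ^ (q + q * (q - 1) div 2) * h q ^ Suc q"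
    by (simp add: power_add)
  also have "q + q * (q - 1) div 2 = Suc q * (Suc q - 1) div 2"
  proof -
    have "q + q * (q - 1) div 2 = (2 * q + q * (q - 1)) div 2" by simp
    also have "2 * q + q * (q - 1) = Suc q * q" by (cases q) (auto simp: algebra_simps)
    finally show ?thesis by simp
  qed
  finally show ?case by simp
qed

lemma rho_monom_less:
  assumes "degree f > 0" "s < degree f"
  shows "rho f (monom 1 s) = (if s = degree f - 1 then inverse (lead_coeff f) else 0)"
  using assms by (simp add: rho_less degree_monom_eq field_simps)

text \<open>In monomial coordinates the form is the Hankel matrix of \<open>rho\<close> times
  multiplication by w, with the coordinates of b on both sides. This serves twice: for the
  determinant, and for the congruence of the Gram matrices of two bases.\<close>

lemma gram_eq:
  fixes f :: "'k :: field poly"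
  assumes f: "degree f > 0"
    and b: "\<And>i j. j < degree f \<Longrightarrow> i \<ge> degree f \<Longrightarrow> coeff (b j) i = 0"
  shows "gram f w b = transpose_mat (coef_mat (degree f) b) *
    (mat (degree f) (degree f) (\<lambda>(i, j). rho f (monom 1 (i + j))) *
      (mul_mat f w * coef_mat (degree f) b))"
proof -
  let ?n = "degree f"
  let ?H = "mat ?n ?n (\<lambda>(i, j). rho f (monom 1 (i + j)))"
  have M: "mul_mat f w * coef_mat ?n b = coef_mat ?n (\<lambda>j. (w * b j) mod f)"
    by (rule coef_mat_mult_mod[symmetric]) (rule b)
  have HM: "?H * coef_mat ?n (\<lambda>j. (w * b j) mod f) = mat ?n ?n (\<lambda>(i, j). rho f (monom 1 i * (w * b j)))"
  proof (intro eq_matI)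
    fix i j assume "i < dim_row (mat ?n ?n (\<lambda>(i, j). rho f (monom 1 i * (w * b j))))"
      "j < dim_col (mat ?n ?n (\<lambda>(i, j). rho f (monom 1 i * (w * b j))))"
    hence ij: "i < ?n" "j < ?n" by auto
    have "rho f (monom 1 i * (w * b j)) = rho f (monom 1 i * ((w * b j) mod f))"
      by (intro rho_cong) (simp add: mod_mult_right_eq)
    also have "\<dots> = (\<Sum>k<?n. coeff ((w * b j) mod f) k * rho f (monom 1 i * monom 1 k))"
      by (rule rho_expand) (simp add: coeff_mod_eq_0 f)
    finally show "(?H * coef_mat ?n (\<lambda>j. (w * b j) mod f)) $$ (i, j) =
        mat ?n ?n (\<lambda>(i, j). rho f (monom 1 i * (w * b j))) $$ (i, j)"
      using ij by (simp add: coef_mat_def scalar_prod_def lessThan_atLeast0 mult_monom mult.commute add.commute)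
  qed auto
  show ?thesis
    unfolding M HM
  proof (intro eq_matI)
    fix i j assume "i < dim_row (transpose_mat (coef_mat ?n b) * mat ?n ?n (\<lambda>(i, j). rho f (monom 1 i * (w * b j))))"
      "j < dim_col (transpose_mat (coef_mat ?n b) * mat ?n ?n (\<lambda>(i, j). rho f (monom 1 i * (w * b j))))"
    hence ij: "i < ?n" "j < ?n" by auto
    have "rho f (w * b i * b j) = rho f ((w * b j) * b i)"
      by (simp add: ac_simps)
    also have "\<dots> = (\<Sum>k<?n. coeff (b i) k * rho f ((w * b j) * monom 1 k))"
      by (rule rho_expand) (simp add: b ij)
    finally show "gram f w b $$ (i, j) = (transpose_mat (coef_mat ?n b) *
        mat ?n ?n (\<lambda>(i, j). rho f (monom 1 i * (w * b j)))) $$ (i, j)"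
      using ij by (simp add: gram_def coef_mat_def scalar_prod_def lessThan_atLeast0 mult.commute)
  qed auto
qed

text \<open>The factor beside the norm is the Hankel determinant of the monomials; its sign is the
  one that \<open>invariant_form\<close> cancels.\<close>

lemma det_gram:
  fixes f :: "'k :: field poly"
  assumes f: "degree f > 0"
    and b: "\<And>i j. j < degree f \<Longrightarrow> i \<ge> degree f \<Longrightarrow> coeff (b j) i = 0"
  shows "det (gram f w b) = det (coef_mat (degree f) b) ^ 2 *
    ((-1) ^ (degree f * (degree f - 1) div 2) * inverse (lead_coeff f) ^ degree f * nrm f w)"
proof -
  let ?n = "degree f"
  have "det (mat ?n ?n (\<lambda>(i, j). rho f (monom 1 (i + j)))) =
      (-1) ^ (?n * (?n - 1) div 2) * rho f (monom 1 (?n - 1)) ^ ?n"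
    by (rule det_hankel) (auto simp: rho_monom_less)
  also have "rho f (monom 1 (?n - 1)) = inverse (lead_coeff f)"
    using f by (simp add: rho_monom_less)
  finally have H: "det (mat ?n ?n (\<lambda>(i, j). rho f (monom 1 (i + j)))) =
      (-1) ^ (?n * (?n - 1) div 2) * inverse (lead_coeff f) ^ ?n" .
  let ?H = "mat ?n ?n (\<lambda>(i, j). rho f (monom 1 (i + j)))"
  let ?C = "coef_mat ?n b"
  have "det (gram f w b) = det (transpose_mat ?C) * det (?H * (mul_mat f w * ?C))"
    by (subst gram_eq[OF f b], assumption, assumption, rule det_mult) (auto intro!: mult_carrier_mat[where n = ?n])
  also have "det (?H * (mul_mat f w * ?C)) = det ?H * det (mul_mat f w * ?C)"
    by (rule det_mult) (auto intro!: mult_carrier_mat[where n = ?n])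
  also have "det (mul_mat f w * ?C) = nrm f w * det ?C"
    unfolding nrm_def by (rule det_mult) auto
  finally show ?thesis
    by (simp add: H det_transpose[of _ ?n] power2_eq_square mult_ac)
qed

section \<open>Norms of linear polynomials; the norm as a product over roots\<close>

lemma det_unitriangular:
  fixes A :: "'k :: idom mat"
  assumes "A \<in> carrier_mat n n" "\<And>i j. i < n \<Longrightarrow> j < i \<Longrightarrow> A $$ (i, j) = 0"
    and "\<And>i. i < n \<Longrightarrow> A $$ (i, i) = 1"
  shows "det A = 1"
proof -
  have "det A = prod_list (diag_mat A)"
    using assms by (intro det_upper_triangular[OF _ assms(1)]) (auto simp: upper_triangular_def)
  also have "diag_mat A = map (\<lambda>i. 1) [0..<n]"
    using assms by (auto simp: diag_mat_def)
  finally show ?thesis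
    by (simp add: prod_list_replicate map_replicate_const)
qed

text \<open>
  Adding \<open>a\<^sup>i\<close> times row \<open>i\<close> to row \<open>0\<close>, for all \<open>i > 0\<close>, turns row \<open>0\<close> into the values at \<open>a\<close>,
  which vanish except in the last column.
\<close>

lemma nrm_linear:
  fixes f :: "'k :: field poly"
  assumes f: "degree f > 0"
  shows "nrm f [:- a, 1:] = (-1) ^ degree f * poly f a / lead_coeff f"
proof -
  define m where "m = degree f - 1"
  have n: "degree f = Suc m"
    using f by (simp add: m_def)
  let ?n = "Suc m"
  define g where "g = (\<lambda>j. ([:- a, 1:] * monom 1 j) mod f)"
  have gj: "g j = [:- a, 1:] * monom 1 j" if "j < m" for j
    unfolding g_def using that
    by (intro mod_poly_less) (simp add: n degree_mult_eq degree_monom_eq del: mult_pCons_left)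
  define P where "P = [:- a, 1:] * monom 1 m"
  have P: "degree P = Suc m" "lead_coeff P = 1" "poly P a = 0"
  proof -
    show *: "degree P = Suc m"
      by (simp add: P_def degree_mult_eq degree_monom_eq del: mult_pCons_left)
    show "lead_coeff P = 1"
      unfolding P_def lead_coeff_mult by (simp add: degree_monom_eq)
    show "poly P a = 0" by (simp add: P_def)
  qed
  \<comment> \<open>Only the last column has to be reduced modulo f, and one subtraction suffices.
    As P vanishes at a, the reduced polynomial takes the value - f(a) / lead(f) there.\<close>
  have "degree (P - smult (inverse (lead_coeff f)) f) < Suc m"
  proof (rule degree_lessI)
    show "\<forall>k\<ge>Suc m. coeff (P - smult (inverse (lead_coeff f)) f) k = 0"
    proof safe
      fix k assume k: "k \<ge> Suc m"
      show "coeff (P - smult (inverse (lead_coeff f)) f) k = 0"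
      proof (cases "k = Suc m")
        case True
        have "coeff f (Suc m) \<noteq> 0" using f n by (metis degree_0 leading_coeff_0_iff less_irrefl)
        thus ?thesis using True P n by simp
      next
        case False
        thus ?thesis using k P n by (simp add: coeff_eq_0)
      qed
    qed
  qed auto
  moreover have "P mod f = (P - smult (inverse (lead_coeff f)) f) mod f"
    by (simp add: poly_mod_diff_left mod_smult_left)
  ultimately have "g m = P - smult (inverse (lead_coeff f)) f"
    unfolding g_def P_def[symmetric] using n by (simp add: mod_poly_less)
  hence gm: "poly (g m) a = - (poly f a / lead_coeff f)"
    by (simp add: P divide_inverse)
  have gdeg: "degree (g j) \<le> m" for j
    unfolding g_def using degree_mod_less'[of f "[:- a, 1:] * monom 1 j"] f n
    by (metis degree_0 le0 less_Suc_eq_le less_numeral_extra(3))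
  define E where "E = mat ?n ?n (\<lambda>(i, j). if i = 0 then a ^ j else if i = j then 1 else 0)"
  have E: "E \<in> carrier_mat ?n ?n" by (simp add: E_def)
  have "det E = 1"
    by (rule det_unitriangular[OF E]) (auto simp: E_def)
  define B where "B = E * mul_mat f [:- a, 1:]"
  have mm: "mul_mat f [:- a, 1:] = coef_mat ?n g"
    by (simp add: mul_mat_def g_def n)
  have B: "B \<in> carrier_mat ?n ?n"
    unfolding B_def mm by (intro mult_carrier_mat[OF E]) auto
  have B0: "B $$ (0, j) = poly (g j) a" if "j < ?n" for j
  proof -
    have "B $$ (0, j) = (\<Sum>i<?n. a ^ i * coeff (g j) i)"
      using that unfolding B_def mm by (simp add: E_def coef_mat_def scalar_prod_def lessThan_atLeast0)
    also have "\<dots> = poly (g j) a"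
      using gdeg[of j]
      unfolding poly_altdef
      by (intro sum.mono_neutral_cong_right) (auto simp: coeff_eq_0 mult.commute)
    finally show ?thesis .
  qed
  have Bi: "B $$ (i, j) = coeff (g j) i" if "i < ?n" "i > 0" "j < ?n" for i j
  proof -
    have "B $$ (i, j) = (\<Sum>k<?n. (if i = k then 1 else 0) * coeff (g j) k)"
      using that unfolding B_def mm by (simp add: E_def coef_mat_def scalar_prod_def lessThan_atLeast0)
    also have "\<dots> = (\<Sum>k<?n. if i = k then coeff (g j) k else 0)"
      by (intro sum.cong) auto
    also have "\<dots> = coeff (g j) i" using that by simp
    finally show ?thesis .
  qed
  have "nrm f [:- a, 1:] = det B"
    unfolding B_def nrm_def mm using \<open>det E = 1\<close> by (subst det_mult[OF E]) auto
  also have "\<dots> = (\<Sum>j<?n. B $$ (0, j) * cofactor B 0 j)"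
    by (rule laplace_expansion_row[OF B]) auto
  also have "\<dots> = (\<Sum>j<?n. if j = m then - (poly f a / lead_coeff f) * cofactor B 0 m else 0)"
    by (intro sum.cong refl) (auto simp: B0 gj gm poly_monom)
  also have "\<dots> = - (poly f a / lead_coeff f) * cofactor B 0 m"
    by simp
  also have "cofactor B 0 m = (-1) ^ m * det (mat_delete B 0 m)"
    by (simp add: cofactor_def)
  also have "det (mat_delete B 0 m) = 1"
  proof (rule det_unitriangular[where n = m])
    show "mat_delete B 0 m \<in> carrier_mat m m"
      using B by (auto simp: mat_delete_def)
    show "mat_delete B 0 m $$ (i, j) = 0" if "i < m" "j < i" for i j
      using that B by (simp add: mat_delete_def Bi gj coeff_pCons split: nat.split)
    show "mat_delete B 0 m $$ (i, i) = 1" if "i < m" for i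
      using that B by (simp add: mat_delete_def Bi gj coeff_pCons split: nat.split)
  qed
  finally show ?thesis by (simp add: n)
qed

text \<open>For y nonzero the factor -y is pulled out and \<open>nrm_linear\<close> applies at x /
  y; the two signs cancel. With f = c(X,1) the sum is the binary form c(x,y), which is how the
  invariant form of a Gram pair is recognised.\<close>

lemma nrm_linear_form:
  fixes f :: "'k :: field poly"
  assumes f: "degree f > 0"
  shows "nrm f [:x, - y:] =
    (\<Sum>i\<le>degree f. coeff f i * x ^ i * y ^ (degree f - i)) / lead_coeff f"
proof (cases "y = 0")
  case True
  have "(\<Sum>i\<le>degree f. coeff f i * x ^ i * y ^ (degree f - i)) =
      (\<Sum>i\<le>degree f. if i = degree f then lead_coeff f * x ^ degree f else 0)"
    using True by (intro sum.cong) auto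
  also have "\<dots> = lead_coeff f * x ^ degree f" by simp
  finally show ?thesis using True f nrm_const[OF f, of x] by auto
next
  case False
  have "[:x, - y:] = [:- y:] * [:- (x / y), 1:]"
    using False by simp
  hence "nrm f [:x, - y:] = nrm f [:- y:] * nrm f [:- (x / y), 1:]"
    using nrm_mult[OF f] by metis
  also have "\<dots> = (- y) ^ degree f * ((-1) ^ degree f * poly f (x / y) / lead_coeff f)"
    by (simp only: nrm_const[OF f] nrm_linear[OF f])
  also have "\<dots> = y ^ degree f * poly f (x / y) / lead_coeff f"
  proof -
    have "(- y) ^ degree f * (-1) ^ degree f = y ^ degree f"
      by (simp flip: power_mult_distrib)
    thus ?thesis by (simp flip: mult.assoc)
  qed
  also have "y ^ degree f * poly f (x / y) = (\<Sum>i\<le>degree f. coeff f i * x ^ i * y ^ (degree f - i))"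
    unfolding poly_altdef sum_distrib_left
  proof (intro sum.cong refl)
    fix i assume "i \<in> {..degree f}"
    hence "y ^ degree f = y ^ (degree f - i) * y ^ i"
      by (simp flip: power_add)
    thus "y ^ degree f * (coeff f i * (x / y) ^ i) = coeff f i * x ^ i * y ^ (degree f - i)"
      using False by (simp add: power_divide)
  qed
  finally show ?thesis .
qed

text \<open>Both sides are multiplicative in p, so it suffices to treat constants and linear
  factors, where \<open>nrm_linear\<close> gives the value.\<close>

lemma nrm_eq_prod_roots:
  fixes f p :: "'k :: alg_closed_field poly"
  assumes f: "f = smult c (\<Prod>x\<in>#A. [:- x, 1:])" and c: "c \<noteq> 0" and A: "A \<noteq> {#}"
  shows "nrm f p = (\<Prod>x\<in>#A. poly p x)"
proof -
  have deg: "degree f = size A"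
  proof -
    have "degree (\<Prod>x\<in>#A. [:- x, 1:]) = size A"
      by (induction A) (auto simp: degree_mult_eq prod_mset_zero_iff image_iff simp del: mult_pCons_left)
    thus ?thesis using c by (simp add: f)
  qed
  have "lead_coeff (\<Prod>x\<in>#A. [:- x, 1:]) = 1"
    by (induction A) (auto simp: lead_coeff_mult simp del: mult_pCons_left)
  hence lc: "lead_coeff f = c"
    by (simp add: f)
  have f0: "degree f > 0"
    using A by (simp add: deg nonempty_has_size)
  have lin: "nrm f [:- b, 1:] = (\<Prod>x\<in>#A. poly [:- b, 1:] x)" for b
  proof -
    have "nrm f [:- b, 1:] = (-1) ^ size A * poly f b / c"
      using nrm_linear[OF f0, of b] by (simp only: lc) (simp add: deg)
    also have "\<dots> = (-1) ^ size A * (\<Prod>x\<in>#A. b - x)"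
      using c by (simp add: f poly_prod_mset image_mset.compositionality o_def)
    also have "\<dots> = (\<Prod>x\<in>#A. x - b)"
      by (induction A) (auto simp: algebra_simps)
    finally show ?thesis by simp
  qed
  show ?thesis
  proof (cases "p = 0")
    case True
    have "nrm f 0 = 0"
      using nrm_const[OF f0, of 0] f0 by simp
    moreover have "(\<Prod>x\<in>#A. poly p x) = 0"
      using A True by (cases A) auto
    ultimately show ?thesis using True by simp
  next
    case False
    then obtain B where B: "p = smult (lead_coeff p) (\<Prod>x\<in>#B. [:- x, 1:])"
      using alg_closed_imp_factorization by blast
    have "nrm f p = nrm f ([:lead_coeff p:] * (\<Prod>x\<in>#B. [:- x, 1:]))"
      using B by simp
    also have "\<dots> = lead_coeff p ^ size A * (\<Prod>b\<in>#B. \<Prod>x\<in>#A. poly [:- b, 1:] x)"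
      by (simp only: nrm_mult[OF f0] nrm_const[OF f0] nrm_prod_mset[OF f0] lin deg)
    also have "\<dots> = (\<Prod>x\<in>#A. lead_coeff p * (\<Prod>b\<in>#B. poly [:- b, 1:] x))"
    proof -
      have "k ^ size A * (\<Prod>x\<in>#A. g x) = (\<Prod>x\<in>#A. k * g x)" for k :: 'k and g
        by (induction A) (simp_all add: mult_ac)
      moreover have "(\<Prod>b\<in>#B. \<Prod>x\<in>#A. g b x) = (\<Prod>x\<in>#A. \<Prod>b\<in>#B. g b x)" for g :: "'k \<Rightarrow> 'k \<Rightarrow> 'k"
        by (induction A) (simp_all add: prod_mset.distrib)
      ultimately show ?thesis by simp
    qed
    also have "\<dots> = (\<Prod>x\<in>#A. poly p x)"
    proof -
      have "poly p x = lead_coeff p * (\<Prod>b\<in>#B. poly [:- b, 1:] x)" for x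
        using arg_cong[OF B, of "\<lambda>q. poly q x"]
        by (simp only: poly_smult poly_prod_mset image_mset.compositionality o_def)
      thus ?thesis by presburger
    qed
    finally show ?thesis .
  qed
qed

section \<open>Lattices over a principal ideal domain\<close>

text \<open>A is taken as a subset of its fraction field: modules over A inside \<open>K[X]\<close>
  are then plain sets of polynomials, denominators included, and integrality is membership in
  A.\<close>

locale pid_subring =
  fixes A :: "'k :: field_char_0 set"
  assumes zero_in [simp]: "0 \<in> A" and one_in [simp]: "1 \<in> A"
    and add_in: "x \<in> A \<Longrightarrow> y \<in> A \<Longrightarrow> x + y \<in> A"
    and mult_in: "x \<in> A \<Longrightarrow> y \<in> A \<Longrightarrow> x * y \<in> A"
    and uminus_in: "x \<in> A \<Longrightarrow> - x \<in> A"
    and fraction: "\<exists>a\<in>A. \<exists>b\<in>A. b \<noteq> 0 \<and> x = a / b"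
    and principal: "I \<subseteq> A \<Longrightarrow> 0 \<in> I \<Longrightarrow> (\<And>x y. x \<in> I \<Longrightarrow> y \<in> I \<Longrightarrow> x + y \<in> I) \<Longrightarrow>
      (\<And>a x. a \<in> A \<Longrightarrow> x \<in> I \<Longrightarrow> a * x \<in> I) \<Longrightarrow> \<exists>g\<in>I. \<forall>x\<in>I. \<exists>a\<in>A. x = a * g"
begin

lemma diff_in: "x \<in> A \<Longrightarrow> y \<in> A \<Longrightarrow> x - y \<in> A"
  using add_in[of x "- y"] uminus_in by simp

lemma sum_in: "(\<And>i. i \<in> I \<Longrightarrow> g i \<in> A) \<Longrightarrow> sum g I \<in> A"
  by (induction I rule: infinite_finite_induct) (auto intro: add_in)

lemma prod_in: "(\<And>i. i \<in> I \<Longrightarrow> g i \<in> A) \<Longrightarrow> prod g I \<in> A"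
  by (induction I rule: infinite_finite_induct) (auto intro: mult_in)

lemma power_in: "x \<in> A \<Longrightarrow> x ^ n \<in> A"
  by (induction n) (auto intro: mult_in)

text \<open>Write x = p' / q' with a p' + b q' = 1, where g generates the ideal of p and q and p =
  p' g, q = q' g. Then x = a (x^2 q') + b p', which involves x only through x^2.\<close>

lemma integrally_closed_sqrt:
  assumes "x ^ 2 \<in> A"
  shows "x \<in> A"
proof -
  obtain p q where pq: "p \<in> A" "q \<in> A" "q \<noteq> 0" "x = p / q"
    using fraction by blast
  define I where "I = {a * p + b * q | a b. a \<in> A \<and> b \<in> A}"
  have "\<exists>g\<in>I. \<forall>y\<in>I. \<exists>a\<in>A. y = a * g"
  proof (rule principal)
    show "I \<subseteq> A" using pq by (auto simp: I_def intro!: add_in mult_in)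
    show "0 \<in> I" by (auto simp: I_def intro!: exI[of _ 0])
    fix y z assume "y \<in> I" "z \<in> I"
    then obtain a b a' b' where "y = a * p + b * q" "z = a' * p + b' * q" "a \<in> A" "b \<in> A" "a' \<in> A" "b' \<in> A"
      by (auto simp: I_def)
    moreover from this have "y + z = (a + a') * p + (b + b') * q" by (simp add: algebra_simps)
    ultimately show "y + z \<in> I" unfolding I_def using add_in by blast
  next
    fix c y assume "c \<in> A" "y \<in> I"
    then obtain a b where "y = a * p + b * q" "a \<in> A" "b \<in> A" by (auto simp: I_def)
    moreover from this have "c * y = (c * a) * p + (c * b) * q" by (simp add: algebra_simps)
    ultimately show "c * y \<in> I" unfolding I_def using mult_in \<open>c \<in> A\<close> by blast
  qed
  then obtain g where g: "g \<in> I" and gdiv: "\<And>y. y \<in> I \<Longrightarrow> \<exists>a\<in>A. y = a * g" by blast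
  have "p \<in> I"
    unfolding I_def by (intro CollectI exI[of _ 1] exI[of _ 0]) auto
  then obtain p' where p': "p' \<in> A" "p = p' * g" using gdiv by blast
  have "q \<in> I"
    unfolding I_def by (intro CollectI exI[of _ 0] exI[of _ 1]) auto
  then obtain q' where q': "q' \<in> A" "q = q' * g" using gdiv by blast
  note pq' = p'(1) q'(1) p'(2) q'(2)
  obtain a b where ab: "a \<in> A" "b \<in> A" "g = a * p + b * q"
    using g by (auto simp: I_def)
  have "g \<noteq> 0" using pq pq' by auto
  have "(a * p' + b * q') * g = 1 * g"
    using ab(3) pq' by (simp add: algebra_simps)
  hence one: "a * p' + b * q' = 1" using \<open>g \<noteq> 0\<close> by (metis mult_right_cancel)
  have x: "x * q' = p'" using pq pq' \<open>g \<noteq> 0\<close> by (auto simp: field_simps)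
  have "x = x * (a * p' + b * q')" using one by simp
  also have "\<dots> = a * (x ^ 2 * q') + b * p'"
    using x by (auto simp: algebra_simps power2_eq_square simp flip: x)
  finally have "x = a * (x ^ 2 * q') + b * p'" .
  thus "x \<in> A"
    using assms ab pq' by (metis add_in mult_in)
qed

section \<open>Integral and primitive polynomials, Gauss's lemma, denominators\<close>

definition intp :: "'k poly \<Rightarrow> bool" where "intp p \<longleftrightarrow> (\<forall>i. coeff p i \<in> A)"

text \<open>Kept as an explicit Bezout relation because \<open>gauss\<close> uses it to recombine p
  from the multiples of p by the coefficients of U.\<close>

definition primp :: "'k poly \<Rightarrow> bool" where
  "primp p \<longleftrightarrow> intp p \<and> (\<exists>c. (\<forall>i. c i \<in> A) \<and> (\<Sum>i\<le>degree p. c i * coeff p i) = 1)"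

lemma intp_0 [simp]: "intp 0" by (simp add: intp_def)
lemma intp_add: "intp p \<Longrightarrow> intp q \<Longrightarrow> intp (p + q)" by (simp add: intp_def add_in)
lemma intp_diff: "intp p \<Longrightarrow> intp q \<Longrightarrow> intp (p - q)" by (simp add: intp_def diff_in)
lemma intp_uminus: "intp p \<Longrightarrow> intp (- p)" by (simp add: intp_def uminus_in)
lemma intp_smult: "c \<in> A \<Longrightarrow> intp p \<Longrightarrow> intp (smult c p)" by (simp add: intp_def mult_in)
lemma intp_monom: "c \<in> A \<Longrightarrow> intp (monom c n)" by (simp add: intp_def)
lemma intp_sum: "(\<And>i. i \<in> I \<Longrightarrow> intp (g i)) \<Longrightarrow> intp (sum g I)"
  by (induction I rule: infinite_finite_induct) (auto intro: intp_add)
lemma intp_mult: "intp p \<Longrightarrow> intp q \<Longrightarrow> intp (p * q)"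
  by (auto simp: intp_def coeff_mult intro!: sum_in mult_in)
lemma intp_1 [simp]: "intp 1" by (simp add: intp_def)
lemma intp_pCons: "a \<in> A \<Longrightarrow> intp p \<Longrightarrow> intp (pCons a p)"
  by (simp add: intp_def coeff_pCons split: nat.split)
lemma intp_power: "intp p \<Longrightarrow> intp (p ^ n)"
  by (induction n) (auto intro: intp_mult)
lemma intp_prod: "(\<And>i. i \<in> I \<Longrightarrow> intp (g i)) \<Longrightarrow> intp (prod g I)"
  by (induction I rule: infinite_finite_induct) (auto intro: intp_mult)

text \<open>
  The lemma of Gauss by the argument of McCoy: if \<open>U p\<close> is integral, then each \<open>coeff U j \<cdot> p\<close> is
  integral (descending induction on \<open>j\<close>, inside an induction on the degree of \<open>p\<close>).
\<close>

lemma gauss: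
  assumes U: "primp U" and Up: "intp (U * p)"
  shows "intp p"
proof -
  have "\<forall>p. (\<forall>i\<ge>N. coeff p i = 0) \<longrightarrow> intp (U * p) \<longrightarrow> intp p" for N
  proof (induction N)
    case 0
    show ?case by (auto simp: intp_def)
  next
    case (Suc N)
    show ?case
    proof (intro allI impI)
      fix p assume p: "\<forall>i\<ge>Suc N. coeff p i = 0" and Up: "intp (U * p)"
      have U': "intp U" using U by (simp add: primp_def)
      have step: "intp (smult (coeff U j) p)" for j
      proof (induction "degree U - j" arbitrary: j rule: less_induct)
        case less
        \<comment> \<open>T is U cut off above degree j. The removed terms contribute integral
          polynomials by the inner induction, so T p is integral, and its coefficient at j + N is
          the product of the coefficients at j and at N.\<close>
        define T where "T = U - (\<Sum>i=j+1..degree U. monom (coeff U i) i)"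
        have T: "coeff T i = (if i \<le> j then coeff U i else 0)" for i
          by (auto simp: T_def coeff_sum coeff_eq_0)
        have "T * p = U * p - (\<Sum>i=j+1..degree U. monom 1 i * smult (coeff U i) p)"
          unfolding T_def left_diff_distrib sum_distrib_right
          by (intro arg_cong2[where f = "(-)"] sum.cong refl)
             (metis mult_smult_left mult_smult_right mult.right_neutral smult_monom)
        moreover have "intp (\<Sum>i=j+1..degree U. monom 1 i * smult (coeff U i) p)"
          by (intro intp_sum intp_mult intp_monom less) auto
        ultimately have "intp (T * p)" using Up intp_diff by metis
        moreover have "coeff (T * p) (j + N) = coeff U j * coeff p N"
        proof -
          have "coeff (T * p) (j + N) = (\<Sum>i\<le>j + N. coeff T i * coeff p (j + N - i))"
            by (simp add: coeff_mult)
          also have "\<dots> = (\<Sum>i\<le>j + N. if i = j then coeff U j * coeff p N else 0)"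
          proof (intro sum.cong refl)
            fix i assume "i \<in> {..j + N}"
            show "coeff T i * coeff p (j + N - i) = (if i = j then coeff U j * coeff p N else 0)"
              using p by (cases i j rule: linorder_cases) (auto simp: T)
          qed
          finally show ?thesis by simp
        qed
        ultimately have top: "coeff U j * coeff p N \<in> A" by (metis intp_def)
        \<comment> \<open>Without its term of degree N the multiple of p has a smaller degree bound,
          and U times it is still integral, so the outer induction applies.\<close>
        define q where "q = smult (coeff U j) p - monom (coeff U j * coeff p N) N"
        have "\<forall>i\<ge>N. coeff q i = 0"
          using p by (auto simp: q_def Suc_le_eq)
        moreover have "U * q = smult (coeff U j) (U * p) - monom (coeff U j * coeff p N) N * U"
          by (simp add: q_def algebra_simps)
        hence "intp (U * q)"
          using Up U' top by (simp add: intp_diff intp_smult intp_mult intp_monom primp_def intp_def[of U])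
        ultimately have "intp q" using Suc by blast
        moreover have "smult (coeff U j) p = q + monom (coeff U j * coeff p N) N"
          by (simp add: q_def)
        ultimately show ?case using top by (metis intp_add intp_monom)
      qed
      obtain c where c: "\<And>i. c i \<in> A" "(\<Sum>i\<le>degree U. c i * coeff U i) = 1"
        using U by (auto simp: primp_def)
      have "p = smult (\<Sum>i\<le>degree U. c i * coeff U i) p" using c by simp
      also have "\<dots> = (\<Sum>i\<le>degree U. smult (c i) (smult (coeff U i) p))"
        by (simp add: smult_sum)
      finally show "intp p" using c step by (metis (no_types, lifting) intp_smult intp_sum)
    qed
  qed
  from this[of "Suc (degree p)"] show ?thesis
    using Up by (auto simp: coeff_eq_0)
qed

lemma common_denominator:
  assumes "finite I"
  shows "\<exists>N\<in>A. N \<noteq> 0 \<and> (\<forall>i\<in>I. N * g i \<in> A)"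
  using assms
proof (induction I)
  case empty
  thus ?case by (auto intro!: bexI[of _ 1])
next
  case (insert i I)
  then obtain N where N: "N \<in> A" "N \<noteq> 0" "\<forall>i\<in>I. N * g i \<in> A" by blast
  obtain a b where ab: "a \<in> A" "b \<in> A" "b \<noteq> 0" "g i = a / b" using fraction by blast
  show ?case
  proof (intro bexI[of _ "N * b"] conjI ballI)
    fix j assume "j \<in> insert i I"
    thus "N * b * g j \<in> A"
    proof
      assume "j = i"
      hence "N * b * g j = N * a" using ab(3,4) by simp
      thus ?thesis using N(1) ab(1) by (metis mult_in)
    next
      assume "j \<in> I"
      hence "b * (N * g j) \<in> A" using N ab mult_in by blast
      thus ?thesis by (simp add: ac_simps)
    qed
  qed (use N ab mult_in in auto)
qed

lemma common_denominator_polys: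
  assumes "finite I"
  shows "\<exists>N\<in>A. N \<noteq> 0 \<and> (\<forall>i\<in>I. intp (smult N (g i)))"
proof -
  have "\<exists>N\<in>A. N \<noteq> 0 \<and> (\<forall>x\<in>(SIGMA i:I. {..degree (g i)}). N * (case x of (i, j) \<Rightarrow> coeff (g i) j) \<in> A)"
    using assms by (intro common_denominator) auto
  then obtain N where N: "N \<in> A" "N \<noteq> 0" "\<And>i j. i \<in> I \<Longrightarrow> j \<le> degree (g i) \<Longrightarrow> N * coeff (g i) j \<in> A"
    by fastforce
  have "intp (smult N (g i))" if "i \<in> I" for i
    unfolding intp_def
  proof
    show "coeff (smult N (g i)) j \<in> A" for j
      using N(3)[OF that, of j] by (cases "j \<le> degree (g i)") (auto simp: coeff_eq_0)
  qed
  thus ?thesis using N by blast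
qed

section \<open>Full lattices, their triangular bases and their residue duals\<close>

definition amod :: "'k poly set \<Rightarrow> bool" where
  "amod S \<longleftrightarrow> 0 \<in> S \<and> (\<forall>p\<in>S. \<forall>q\<in>S. p + q \<in> S) \<and> (\<forall>a\<in>A. \<forall>p\<in>S. smult a p \<in> S)"

lemma amod_sum: "amod S \<Longrightarrow> (\<And>i. i \<in> I \<Longrightarrow> g i \<in> S) \<Longrightarrow> sum g I \<in> S"
  by (induction I rule: infinite_finite_induct) (auto simp: amod_def)

lemma amod_smult: "amod S \<Longrightarrow> a \<in> A \<Longrightarrow> p \<in> S \<Longrightarrow> smult a p \<in> S"
  by (auto simp: amod_def)

lemma amod_diff: "amod S \<Longrightarrow> p \<in> S \<Longrightarrow> q \<in> S \<Longrightarrow> p - q \<in> S"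
  using uminus_in[OF one_in] unfolding amod_def
  by (metis diff_conv_add_uminus smult_1_left smult_minus_left)

text \<open>The two bounds stand in for finite generation: over a principal ideal domain they
  already yield a basis, and they are easy to verify for modules cut out by integrality
  conditions.\<close>

definition lattice :: "nat \<Rightarrow> 'k poly set \<Rightarrow> bool" where
  "lattice d S \<longleftrightarrow> amod S \<and> (\<forall>p\<in>S. \<forall>i\<ge>d. coeff p i = 0) \<and>
     (\<exists>N\<in>A. N \<noteq> 0 \<and> (\<forall>p\<in>S. intp (smult N p))) \<and>
     (\<exists>M\<in>A. M \<noteq> 0 \<and> (\<forall>i<d. monom M i \<in> S))"

definition triangular :: "nat \<Rightarrow> (nat \<Rightarrow> 'k poly) \<Rightarrow> bool" where
  "triangular d b \<longleftrightarrow> (\<forall>i<d. coeff (b i) i \<noteq> 0 \<and> (\<forall>j>i. coeff (b i) j = 0))"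

lemma triangular_expand:
  fixes p :: "'k poly"
  assumes b: "triangular d b" and p: "\<And>i. i \<ge> d \<Longrightarrow> coeff p i = 0"
  shows "\<exists>e. p = (\<Sum>i<d. smult (e i) (b i))"
proof -
  have "\<forall>p :: 'k poly. (\<forall>i\<ge>k. coeff p i = 0) \<longrightarrow> (\<exists>e. p = (\<Sum>i<k. smult (e i) (b i)))" if "k \<le> d" for k
    using that
  proof (induction k)
    case 0
    show ?case by (auto simp: poly_eq_iff)
  next
    case (Suc k)
    show ?case
    proof (intro allI impI)
      fix p :: "'k poly" assume p: "\<forall>i\<ge>Suc k. coeff p i = 0"
      define c where "c = coeff p k / coeff (b k) k"
      have "\<forall>i\<ge>k. coeff (p - smult c (b k)) i = 0"
      proof (intro allI impI)
        fix i assume "i \<ge> k"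
        thus "coeff (p - smult c (b k)) i = 0"
          using p b Suc.prems by (cases "i = k") (auto simp: c_def triangular_def)
      qed
      then obtain e where e: "p - smult c (b k) = (\<Sum>i<k. smult (e i) (b i))"
        using Suc by (metis Suc_leD)
      have "(\<Sum>i<Suc k. smult ((e(k := c)) i) (b i)) = p"
        using e by (simp add: algebra_simps)
      thus "\<exists>e. p = (\<Sum>i<Suc k. smult (e i) (b i))" by metis
    qed
  qed
  thus ?thesis using p by blast
qed

lemma triangular_det: "triangular d b \<Longrightarrow> det (coef_mat d b) \<noteq> 0"
proof -
  assume b: "triangular d b"
  have "det (coef_mat d b) = prod_list (diag_mat (coef_mat d b))"
    using b by (intro det_upper_triangular[where n = d]) (auto simp: upper_triangular_def triangular_def coef_mat_def)
  thus ?thesis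
    using b by (auto simp: diag_mat_def prod_list_zero_iff triangular_def coef_mat_def)
qed

text \<open>Hermite normal form. The coefficients at i of the elements of degree at most i form,
  after scaling by N, an ideal of A, which is nonzero because of the multiple of the monomial. An
  element realising its generator is taken as b_i, and any element is expanded from the top degree
  downwards.\<close>

lemma lattice_basis:
  assumes S: "lattice d S"
  obtains b where "triangular d b" "\<And>i. i < d \<Longrightarrow> b i \<in> S"
    "\<And>p. p \<in> S \<Longrightarrow> \<exists>c. (\<forall>i. c i \<in> A) \<and> p = (\<Sum>i<d. smult (c i) (b i))"
proof -
  have S': "amod S" "\<And>p i. p \<in> S \<Longrightarrow> i \<ge> d \<Longrightarrow> coeff p i = 0"
    using S by (auto simp: lattice_def)
  obtain N where N: "N \<in> A" "N \<noteq> 0" "\<And>p. p \<in> S \<Longrightarrow> intp (smult N p)"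
    using S by (auto simp: lattice_def)
  obtain M where M: "M \<in> A" "M \<noteq> 0" "\<And>i. i < d \<Longrightarrow> monom M i \<in> S"
    using S by (auto simp: lattice_def)
  define Q where "Q = (\<lambda>i p. p \<in> S \<and> (\<forall>j>i. coeff p j = 0) \<and> coeff p i \<noteq> 0 \<and>
    (\<forall>q\<in>S. (\<forall>j>i. coeff q j = 0) \<longrightarrow> (\<exists>a\<in>A. coeff q i = a * coeff p i)))"
  have "\<exists>p. Q i p" if i: "i < d" for i
  proof -
    define I where "I = (\<lambda>p. N * coeff p i) ` {p \<in> S. \<forall>j>i. coeff p j = 0}"
    have "\<exists>g\<in>I. \<forall>x\<in>I. \<exists>a\<in>A. x = a * g"
    proof (rule principal)
      show "I \<subseteq> A" using N(3) by (auto simp: I_def intp_def)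
      show "0 \<in> I" using S'(1) by (auto simp: I_def amod_def image_iff intro!: bexI[of _ 0])
    next
      fix x y assume "x \<in> I" "y \<in> I"
      then obtain p q where "p \<in> S" "\<forall>j>i. coeff p j = 0" "x = N * coeff p i"
        "q \<in> S" "\<forall>j>i. coeff q j = 0" "y = N * coeff q i" by (auto simp: I_def)
      thus "x + y \<in> I" unfolding I_def image_iff
        using S'(1) by (intro bexI[of _ "p + q"]) (auto simp: algebra_simps amod_def)
    next
      fix a x assume "a \<in> A" "x \<in> I"
      then obtain p where "p \<in> S" "\<forall>j>i. coeff p j = 0" "x = N * coeff p i" by (auto simp: I_def)
      thus "a * x \<in> I" unfolding I_def image_iff
        using S'(1) \<open>a \<in> A\<close> by (intro bexI[of _ "smult a p"]) (auto simp: algebra_simps amod_def)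
    qed
    then obtain g where g: "g \<in> I" "\<And>x. x \<in> I \<Longrightarrow> \<exists>a\<in>A. x = a * g" by blast
    obtain p where p: "p \<in> S" "\<forall>j>i. coeff p j = 0" "g = N * coeff p i"
      using g(1) unfolding I_def by blast
    have gen: "\<exists>a\<in>A. coeff q i = a * coeff p i" if "q \<in> S" "\<forall>j>i. coeff q j = 0" for q
    proof -
      have "N * coeff q i \<in> I" using that by (auto simp: I_def)
      then obtain a where a: "a \<in> A" "N * coeff q i = a * (N * coeff p i)" using g(2) p(3) by blast
      hence "N * coeff q i = N * (a * coeff p i)" by (simp only: mult.left_commute)
      thus ?thesis using N(2) a(1) by (intro bexI[of _ a]) simp_all
    qed
    moreover have "coeff p i \<noteq> 0"
      using gen[OF M(3)[OF i]] M(2) by auto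
    ultimately show ?thesis using p(1,2) unfolding Q_def by blast
  qed
  then obtain b where Q: "\<And>i. i < d \<Longrightarrow> Q i (b i)" by metis
  have b: "b i \<in> S" "\<And>j. j > i \<Longrightarrow> coeff (b i) j = 0" "coeff (b i) i \<noteq> 0"
    "\<And>q. q \<in> S \<Longrightarrow> (\<And>j. j > i \<Longrightarrow> coeff q j = 0) \<Longrightarrow> \<exists>a\<in>A. coeff q i = a * coeff (b i) i"
    if "i < d" for i
    using Q[OF that] unfolding Q_def by blast+
  have "\<forall>p\<in>S. (\<forall>i\<ge>k. coeff p i = 0) \<longrightarrow> (\<exists>c. (\<forall>i. c i \<in> A) \<and> p = (\<Sum>i<k. smult (c i) (b i)))"
    if "k \<le> d" for k
    using that
  proof (induction k)
    case 0
    show ?case by (auto simp: poly_eq_iff intro!: exI[of _ "\<lambda>_. 0"])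
  next
    case (Suc k)
    show ?case
    proof (intro ballI impI)
      fix p assume p: "p \<in> S" "\<forall>i\<ge>Suc k. coeff p i = 0"
      obtain a where a: "a \<in> A" "coeff p k = a * coeff (b k) k"
        using b(4)[of k p] p Suc.prems by auto
      have "\<forall>i\<ge>k. coeff (p - smult a (b k)) i = 0"
      proof (intro allI impI)
        fix i assume "i \<ge> k"
        thus "coeff (p - smult a (b k)) i = 0"
          using p a b Suc.prems by (cases "i = k") auto
      qed
      moreover have "p - smult a (b k) \<in> S"
        using p a b(1)[of k] S'(1) Suc.prems by (auto intro!: amod_diff amod_smult)
      ultimately obtain e where e: "\<forall>i. e i \<in> A" "p - smult a (b k) = (\<Sum>i<k. smult (e i) (b i))"
        using Suc by (metis Suc_leD)
      have "(\<Sum>i<Suc k. smult ((e(k := a)) i) (b i)) = p"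
        using e by (simp add: algebra_simps)
      moreover have "\<forall>i. (e(k := a)) i \<in> A" using e a by simp
      ultimately show "\<exists>c. (\<forall>i. c i \<in> A) \<and> p = (\<Sum>i<Suc k. smult (c i) (b i))" by metis
    qed
  qed
  from this[of d] have "\<exists>c. (\<forall>i. c i \<in> A) \<and> p = (\<Sum>i<d. smult (c i) (b i))" if "p \<in> S" for p
    using that S'(2) by auto
  thus ?thesis
    using that[of b] b by (simp add: triangular_def)
qed

text \<open>\<open>det_gram\<close> with weight 1 shows that the residue pairing is nondegenerate;
  the dual basis is given by the columns of the inverse Gram matrix.\<close>

lemma dual_basis:
  assumes U: "degree U > 0" and b: "triangular (degree U) b"
  obtains b' where "\<And>j i. i \<ge> degree U \<Longrightarrow> coeff (b' j) i = 0"
    "\<And>i j. i < degree U \<Longrightarrow> j < degree U \<Longrightarrow> rho U (b i * b' j) = (if i = j then 1 else 0)"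
proof -
  let ?d = "degree U"
  have bz: "coeff (b j) i = 0" if "j < ?d" "i \<ge> ?d" for i j
    using b that by (auto simp: triangular_def)
  define G where "G = gram U 1 b"
  have "det G = det (coef_mat ?d b) ^ 2 *
    ((-1) ^ (?d * (?d - 1) div 2) * inverse (lead_coeff U) ^ ?d * nrm U 1)"
    unfolding G_def by (rule det_gram[OF U bz])
  moreover have "U \<noteq> 0" using U by auto
  ultimately have G0: "det G \<noteq> 0"
    using triangular_det[OF b] U by simp
  have G: "G \<in> carrier_mat ?d ?d" by (simp add: G_def)
  define b' where "b' = (\<lambda>j. \<Sum>k<?d. smult (adj_mat G $$ (k, j) / det G) (b k))"
  show ?thesis
  proof (rule that[of b'])
    show "coeff (b' j) i = 0" if "i \<ge> ?d" for i j
      using that by (auto simp: b'_def coeff_sum bz)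
    fix i j assume ij: "i < ?d" "j < ?d"
    have "rho U (b i * b' j) = (\<Sum>k<?d. rho U (1 * b i * b k) * adj_mat G $$ (k, j)) / det G"
      by (simp add: b'_def sum_distrib_left rho_sum rho_smult sum_divide_distrib mult.commute)
    also have "(\<Sum>k<?d. rho U (1 * b i * b k) * adj_mat G $$ (k, j)) = (G * adj_mat G) $$ (i, j)"
      using ij adj_mat(1)[OF G] G by (simp add: scalar_prod_def G_def gram_def lessThan_atLeast0)
    also have "\<dots> = (if i = j then det G else 0)"
      using ij by (simp add: adj_mat(2)[OF G])
    finally show "rho U (b i * b' j) = (if i = j then 1 else 0)"
      using G0 by (auto split: if_splits)
  qed
qed

definition dual :: "'k poly \<Rightarrow> 'k poly set \<Rightarrow> 'k poly set" where
  "dual U S = {y. (\<forall>i\<ge>degree U. coeff y i = 0) \<and> (\<forall>p\<in>S. rho U (p * y) \<in> A)}"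

text \<open>The dual basis of a basis of S lies in the dual of S, and the pairings of y with it are
  the coordinates of y.\<close>

lemma bidual:
  assumes U: "degree U > 0" and S: "lattice (degree U) S" and y: "y \<in> dual U (dual U S)"
  shows "y \<in> S"
proof -
  let ?d = "degree U"
  obtain b where b: "triangular ?d b" "\<And>i. i < ?d \<Longrightarrow> b i \<in> S"
    "\<And>p. p \<in> S \<Longrightarrow> \<exists>c. (\<forall>i. c i \<in> A) \<and> p = (\<Sum>i<?d. smult (c i) (b i))"
    using lattice_basis[OF S] by blast
  obtain b' where b': "\<And>j i. i \<ge> ?d \<Longrightarrow> coeff (b' j) i = 0"
    "\<And>i j. i < ?d \<Longrightarrow> j < ?d \<Longrightarrow> rho U (b i * b' j) = (if i = j then 1 else 0)"
    using dual_basis[OF U b(1)] by blast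
  have pair: "rho U ((\<Sum>i<?d. smult (c i) (b i)) * b' j) = c j" if "j < ?d" for c j
  proof -
    have "rho U ((\<Sum>i<?d. smult (c i) (b i)) * b' j) = (\<Sum>i<?d. if i = j then c i else 0)"
      unfolding sum_distrib_right rho_sum
      by (intro sum.cong refl) (auto simp: rho_smult b' that)
    thus ?thesis using that by simp
  qed
  have b'_dual: "b' j \<in> dual U S" if "j < ?d" for j
    unfolding dual_def using b' b(3) pair[OF that] by fastforce
  obtain e where e: "y = (\<Sum>i<?d. smult (e i) (b i))"
    using triangular_expand[OF b(1), of y] y by (auto simp: dual_def)
  have "e j \<in> A" if "j < ?d" for j
  proof -
    have "rho U (b' j * y) \<in> A" using y b'_dual[OF that] by (auto simp: dual_def)
    thus ?thesis using pair[OF that, of e] by (simp add: e mult.commute)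
  qed
  thus ?thesis
    unfolding e using S b(2) by (intro amod_sum amod_smult) (auto simp: lattice_def)
qed

lemma det_intp:
  assumes "B \<in> carrier_mat d d" "\<And>i j. i < d \<Longrightarrow> j < d \<Longrightarrow> intp (B $$ (i, j))"
  shows "intp (det B)"
proof -
  have s: "intp (signof p :: 'k poly)" for p :: "nat \<Rightarrow> nat"
    by (auto simp: sign_def intp_uminus)
  show ?thesis
    unfolding det_def'[OF assms(1)]
    by (intro intp_sum intp_mult intp_prod s assms(2)) (auto simp: permutes_in_image)
qed

end

section \<open>Residue pairings\<close>

lemma monom_mult_monom_1: "monom (1 :: 'k :: comm_ring_1) i * (monom 1 j * p) = monom 1 (i + j) * p"
  by (simp add: mult_monom flip: mult.assoc)

text \<open>
  The polynomials \<open>poly_shift l p\<close> for \<open>l = 1, \<dots>, deg p\<close> form the basis dual to \<open>1, X, \<dots>\<close>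
  for the pairing \<open>rho p\<close>.
\<close>

lemma monom_poly_shift_mod:
  fixes p :: "'k :: field poly"
  assumes "l \<le> k"
  shows "(monom 1 k * poly_shift l p) mod p =
    (- (\<Sum>j<l. monom (coeff p j) (k - l + j))) mod p"
proof -
  have "p = (\<Sum>j<l. monom (coeff p j) j) + monom 1 l * poly_shift l p"
    by (intro poly_eqI) (auto simp: coeff_sum coeff_monom_mult coeff_poly_shift)
  hence "monom 1 (k - l) * p = monom 1 (k - l) * ((\<Sum>j<l. monom (coeff p j) j) + monom 1 l * poly_shift l p)"
    by (rule arg_cong)
  hence "monom 1 (k - l) * p = monom 1 (k - l) * (\<Sum>j<l. monom (coeff p j) j) + monom 1 k * poly_shift l p"
    using assms by (simp only: distrib_left monom_mult_monom_1 le_add_diff_inverse2)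
  moreover have "monom 1 (k - l) * (\<Sum>j<l. monom (coeff p j) j) = (\<Sum>j<l. monom (coeff p j) (k - l + j))"
    by (simp add: sum_distrib_left mult_monom)
  ultimately have "monom 1 k * poly_shift l p =
      - (\<Sum>j<l. monom (coeff p j) (k - l + j)) + monom 1 (k - l) * p"
    by (simp add: algebra_simps)
  thus ?thesis by (simp only: mod_mult_self1)
qed

lemma rho_poly_shift_monom:
  fixes p :: "'k :: field poly"
  assumes l: "1 \<le> l" "l \<le> degree p" and k: "k < degree p"
  shows "rho p (poly_shift l p * monom 1 k) = (if k = l - 1 then 1 else 0)"
proof (cases "l \<le> k")
  case True
  let ?q = "- (\<Sum>j<l. monom (coeff p j) (k - l + j))"
  have z: "coeff ?q i = 0" if "i \<ge> k" for i
    using that True by (auto simp: coeff_sum intro!: sum.neutral)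
  have "rho p (poly_shift l p * monom 1 k) = rho p ?q"
    using monom_poly_shift_mod[OF True, of p] by (intro rho_cong) (simp add: mult.commute)
  also have "\<dots> = 0"
  proof (rule rho_small)
    show "coeff ?q (degree p - 1) = 0" using k by (intro z) auto
    have "degree ?q \<le> k - 1" using z l True by (intro degree_le) auto
    thus "degree ?q < degree p" using k by simp
  qed
  finally show ?thesis using True l by auto
next
  case False
  let ?q = "monom 1 k * poly_shift l p"
  have c: "coeff ?q i = (if k \<le> i then coeff p (i - k + l) else 0)" for i
    by (simp add: coeff_monom_mult coeff_poly_shift)
  have "degree ?q \<le> degree p - 1"
    using False by (intro degree_le) (auto simp: c intro!: coeff_eq_0)
  hence "rho p ?q = coeff ?q (degree p - 1) / lead_coeff p"
    using k by (intro rho_less) auto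
  also have "\<dots> = (if k = l - 1 then 1 else 0)"
    using False k l unfolding c by (auto intro!: coeff_eq_0)
  finally show ?thesis by (simp add: mult.commute)
qed

lemma rho_poly_shift:
  fixes p :: "'k :: field poly"
  assumes l: "1 \<le> l" "l \<le> degree p" and q: "\<And>i. i \<ge> degree p \<Longrightarrow> coeff q i = 0"
  shows "rho p (poly_shift l p * q) = coeff q (l - 1)"
proof -
  have "rho p (poly_shift l p * q) = (\<Sum>k<degree p. coeff q k * rho p (poly_shift l p * monom 1 k))"
    by (rule rho_expand[OF q])
  also have "\<dots> = (\<Sum>k<degree p. if k = l - 1 then coeff q k else 0)"
    by (intro sum.cong refl) (auto simp: rho_poly_shift_monom[OF l])
  finally show ?thesis using l by simp
qed

lemma rho_monom_small:
  assumes "s + 1 < degree p"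
  shows "rho p (monom 1 s) = 0"
  using assms by (intro rho_small) (auto simp: degree_monom_eq)

text \<open>Coefficients are read off from the top: once the higher ones vanish, the residue of X^K
  q is the next coefficient over the leading one. For K = deg p this is nondegeneracy, for smaller K
  a degree bound.\<close>

lemma rho_monoms_zero_imp:
  fixes p :: "'k :: field poly"
  assumes "\<And>i. i \<ge> degree p \<Longrightarrow> coeff q i = 0" and "\<And>k. k < K \<Longrightarrow> rho p (monom 1 k * q) = 0"
    and "i + K \<ge> degree p"
  shows "coeff q i = 0"
  using assms(2,3)
proof (induction K arbitrary: i)
  case 0
  thus ?case using assms(1) by simp
next
  case (Suc K)
  show ?case
  proof (cases "i + K \<ge> degree p")
    case True
    thus ?thesis using Suc by simp
  next
    case False
    hence i: "degree p = Suc (i + K)" using Suc.prems by simp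
    have z: "coeff q j = 0" if "j > i" for j
      using Suc.IH[of j] Suc.prems that i by simp
    let ?r = "monom 1 K * q"
    have "degree ?r \<le> i + K"
      using z by (intro degree_le) (auto simp: coeff_monom_mult)
    hence "rho p ?r = coeff ?r (degree p - 1) / lead_coeff p"
      using i by (intro rho_less) simp
    also have "coeff ?r (degree p - 1) = coeff q i"
      by (simp add: coeff_monom_mult i)
    finally have "coeff q i / lead_coeff p = 0" using Suc.prems by simp
    moreover have "p \<noteq> 0" using i by auto
    ultimately show ?thesis by simp
  qed
qed

section \<open>Integrality in the residue pairing of a polynomial that need not be monic\<close>

context pid_subring
begin

lemma intp_poly_shift: "intp p \<Longrightarrow> intp (poly_shift l p)"
  by (simp add: intp_def coeff_poly_shift)

definition Lam :: "nat \<Rightarrow> 'k poly set" where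
  "Lam M = {q. intp q \<and> (\<forall>j\<ge>M. coeff q j = 0)}"

lemma Lam_mono: "M \<le> N \<Longrightarrow> q \<in> Lam M \<Longrightarrow> q \<in> Lam N"
  by (auto simp: Lam_def)

lemma Lam_sum: "(\<And>i. i \<in> I \<Longrightarrow> g i \<in> Lam M) \<Longrightarrow> sum g I \<in> Lam M"
  by (auto simp: Lam_def coeff_sum intro: intp_sum)

lemma Lam_smult: "a \<in> A \<Longrightarrow> q \<in> Lam M \<Longrightarrow> smult a q \<in> Lam M"
  by (auto simp: Lam_def intp_smult)

lemma Lam_add: "p \<in> Lam M \<Longrightarrow> q \<in> Lam M \<Longrightarrow> p + q \<in> Lam M"
  by (auto simp: Lam_def intp_add)

text \<open>Reduction modulo a non-monic p normally brings in denominators. Here it does not: for l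
  \<le> k the complementary part of p gives an integral representative of degree less than k, and
  for l > k the product itself is short enough.\<close>

lemma monom_poly_shift_Lam:
  assumes p: "intp p" and l: "1 \<le> l" "l \<le> degree p"
  shows "\<exists>q\<in>Lam (max k (degree p)). (monom 1 k * poly_shift l p) mod p = q mod p"
proof (cases "l \<le> k")
  case True
  let ?q = "- (\<Sum>j<l. monom (coeff p j) (k - l + j))"
  have "intp ?q"
    using p by (intro intp_uminus intp_sum intp_monom) (auto simp: intp_def)
  moreover have "coeff ?q i = 0" if "i \<ge> k" for i
    using that True by (auto simp: coeff_sum intro!: sum.neutral)
  ultimately have "?q \<in> Lam (max k (degree p))" by (auto simp: Lam_def)
  thus ?thesis using monom_poly_shift_mod[OF True] by blast
next
  case False
  have "intp (monom 1 k * poly_shift l p)"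
    by (intro intp_mult intp_monom intp_poly_shift p) simp
  moreover have "coeff (monom 1 k * poly_shift l p) i = 0" if "i \<ge> degree p" for i
    using that False by (auto simp: coeff_monom_mult coeff_poly_shift intro!: coeff_eq_0)
  ultimately have "monom 1 k * poly_shift l p \<in> Lam (max k (degree p))" by (auto simp: Lam_def)
  thus ?thesis by blast
qed

lemma poly_shift_Lam:
  assumes p: "intp p" and l: "1 \<le> l" "l \<le> degree p" and r: "r \<in> Lam M" and M: "M \<ge> degree p"
  shows "\<exists>q\<in>Lam M. (poly_shift l p * r) mod p = q mod p"
proof -
  have "\<forall>k. \<exists>q\<in>Lam (max k (degree p)). (monom 1 k * poly_shift l p) mod p = q mod p"
    using monom_poly_shift_Lam[OF p l] by blast
  then obtain Q where Q: "\<And>k. Q k \<in> Lam (max k (degree p))"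
    "\<And>k. (monom 1 k * poly_shift l p) mod p = Q k mod p" by metis
  have "(poly_shift l p * r) mod p = (\<Sum>k<M. smult (coeff r k) ((poly_shift l p * monom 1 k) mod p))"
    using r by (intro mult_mod_poly_expand) (auto simp: Lam_def)
  also have "\<dots> = (\<Sum>k<M. smult (coeff r k) (Q k)) mod p"
    using Q(2) by (simp add: poly_mod_sum mod_smult_left mult.commute)
  finally have "(poly_shift l p * r) mod p = (\<Sum>k<M. smult (coeff r k) (Q k)) mod p" .
  moreover have "(\<Sum>k<M. smult (coeff r k) (Q k)) \<in> Lam M"
  proof (intro Lam_sum Lam_smult)
    fix k assume "k \<in> {..<M}"
    hence "max k (degree p) \<le> M" using M by simp
    thus "Q k \<in> Lam M" using Q(1) by (rule Lam_mono)
    show "coeff r k \<in> A" using r by (auto simp: Lam_def intp_def)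
  qed
  ultimately show ?thesis by blast
qed

text \<open>The w for which the first M coefficients of the expansion of w / U at infinity lie in A.
  It is the residue dual of \<open>Lam M\<close> modulo U.\<close>

definition Omega :: "'k poly \<Rightarrow> nat \<Rightarrow> 'k poly set" where
  "Omega U M = {w. (\<forall>i\<ge>degree U. coeff w i = 0) \<and> (\<forall>k<M. rho U (monom 1 k * w) \<in> A)}"

lemma Omega_Lam: "w \<in> Omega U M \<Longrightarrow> q \<in> Lam M \<Longrightarrow> rho U (q * w) \<in> A"
proof -
  assume w: "w \<in> Omega U M" and q: "q \<in> Lam M"
  have "rho U (w * q) = (\<Sum>k<M. coeff q k * rho U (w * monom 1 k))"
    using q by (intro rho_expand) (auto simp: Lam_def)
  also have "\<dots> \<in> A"
    using w q by (intro sum_in mult_in) (auto simp: Omega_def Lam_def intp_def mult.commute)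
  finally show ?thesis by (simp add: mult.commute)
qed

lemma amod_Omega: "amod (Omega U M)"
  by (auto simp: amod_def Omega_def distrib_left rho_add rho_smult intro: add_in mult_in)

text \<open>The gain from M to M + 1 comes from \<open>monom_poly_shift_Lam\<close>: even X^M times
  \<open>poly_shift l U\<close> has a representative in \<open>Lam M\<close>, against which w is
  already integral.\<close>

lemma Omega_theta:
  assumes U: "intp U" "1 \<le> l" "l \<le> degree U" and M: "M \<ge> degree U" and w: "w \<in> Omega U M"
  shows "(poly_shift l U * w) mod U \<in> Omega U (Suc M)"
  unfolding Omega_def
proof (intro CollectI conjI allI impI)
  show "coeff ((poly_shift l U * w) mod U) i = 0" if "i \<ge> degree U" for i
    using that U by (intro coeff_mod_eq_0) auto
  fix k assume k: "k < Suc M"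
  obtain q where q: "q \<in> Lam (max k (degree U))" "(monom 1 k * poly_shift l U) mod U = q mod U"
    using monom_poly_shift_Lam[OF U] by blast
  have "rho U (monom 1 k * ((poly_shift l U * w) mod U)) = rho U ((monom 1 k * poly_shift l U) * w)"
    by (intro rho_cong) (simp add: mod_mult_right_eq mult.assoc)
  also have "\<dots> = rho U (q * w)"
    by (intro rho_cong) (metis mod_mult_left_eq q(2))
  also have "\<dots> \<in> A"
    using M k q(1) by (intro Omega_Lam[OF w] Lam_mono[OF _ q(1)]) auto
  finally show "rho U (monom 1 k * ((poly_shift l U * w) mod U)) \<in> A" .
qed

text \<open>The \<open>poly_shift l U\<close> are dual to the monomials, so the coordinates of w are
  its pairings with X^(l-1). If M \<ge> deg U these lie in A, whence
  \<open>Omega_intp\<close>.\<close>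

lemma Omega_expand:
  assumes "w \<in> Omega U M"
  shows "w = (\<Sum>l=1..degree U. smult (rho U (monom 1 (l - 1) * w)) (poly_shift l U))"
proof -
  let ?v = "\<Sum>l=1..degree U. smult (rho U (monom 1 (l - 1) * w)) (poly_shift l U)"
  have z: "coeff (w - ?v) i = 0" if "i \<ge> degree U" for i
  proof -
    have "coeff (poly_shift l U) i = 0" if "l \<ge> 1" for l
      using that \<open>i \<ge> degree U\<close> by (auto simp: coeff_poly_shift intro!: coeff_eq_0)
    thus ?thesis using assms that by (auto simp: coeff_sum Omega_def)
  qed
  have "rho U (monom 1 k * (w - ?v)) = 0" if k: "k < degree U" for k
  proof -
    have "rho U (monom 1 k * ?v) =
        (\<Sum>l=1..degree U. rho U (monom 1 (l - 1) * w) * rho U (poly_shift l U * monom 1 k))"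
      by (simp add: sum_distrib_left rho_sum rho_smult mult.commute)
    also have "\<dots> = (\<Sum>l=1..degree U. if l = Suc k then rho U (monom 1 k * w) else 0)"
      using k by (intro sum.cong refl) (auto simp: rho_poly_shift_monom)
    also have "\<dots> = rho U (monom 1 k * w)" using k by simp
    finally show ?thesis by (simp add: right_diff_distrib rho_diff)
  qed
  hence "coeff (w - ?v) i = 0" for i
    using rho_monoms_zero_imp[of U "w - ?v" "degree U" i] z by simp
  hence "w - ?v = 0" by (intro poly_eqI) simp
  thus ?thesis by simp
qed

lemma Omega_intp:
  assumes "intp U" "w \<in> Omega U M" "M \<ge> degree U"
  shows "intp w"
proof -
  have "intp (\<Sum>l=1..degree U. smult (rho U (monom 1 (l - 1) * w)) (poly_shift l U))"
    using assms by (intro intp_sum intp_smult intp_poly_shift) (auto simp: Omega_def)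
  thus ?thesis using Omega_expand[OF assms(2)] by simp
qed

lemma monom_times_mod:
  fixes U :: "'k poly"
  assumes U: "degree U > 0" and w: "\<And>i. i \<ge> degree U \<Longrightarrow> coeff w i = 0"
  shows "(monom 1 1 * w) mod U = monom 1 1 * w - smult (rho U w) U"
proof -
  let ?r = "monom 1 1 * w - smult (rho U w) U"
  have rw: "rho U w = coeff w (degree U - 1) / lead_coeff U"
    using w U by (intro rho_less) (metis degree_0 leading_coeff_0_iff linorder_not_less)
  have "coeff ?r i = 0" if "i \<ge> degree U" for i
  proof (cases "i = degree U")
    case True
    have "U \<noteq> 0" using U by auto
    thus ?thesis using True U rw by (simp add: coeff_monom_mult)
  next
    case False
    thus ?thesis using that w[of "i - 1"] U by (auto simp: coeff_monom_mult coeff_eq_0)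
  qed
  hence "degree ?r \<le> degree U - 1" using U by (intro degree_le) auto
  hence "?r mod U = ?r" using U by (intro mod_poly_less) auto
  moreover have "?r mod U = (monom 1 1 * w) mod U"
    by (simp add: poly_mod_diff_left mod_smult_left)
  ultimately show ?thesis by simp
qed

text \<open>By \<open>monom_times_mod\<close> each multiplication by X subtracts a residue times U,
  and the residues that occur are exactly those which membership in \<open>Omega U M\<close> makes
  integral.\<close>

lemma Omega_monom_mod_intp:
  assumes U: "intp U" "degree U > 0" and w: "w \<in> Omega U M" "M \<ge> degree U" and N: "N \<le> M"
  shows "intp ((monom 1 N * w) mod U)"
  using N
proof (induction N)
  case 0
  have "w mod U = w"
    using w(1) U(2) by (intro mod_poly_less) (auto simp: Omega_def intro: degree_lessI)
  thus ?case using Omega_intp[OF U(1) w] by (simp add: one_pCons[symmetric] monom_0)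
next
  case (Suc N)
  let ?v = "(monom 1 N * w) mod U"
  have "(monom 1 (Suc N) * w) mod U = (monom 1 1 * ?v) mod U"
    by (simp add: mod_mult_right_eq monom_mult_monom_1)
  also have "\<dots> = monom 1 1 * ?v - smult (rho U ?v) U"
    using U by (intro monom_times_mod) (auto intro: coeff_mod_eq_0)
  also have "rho U ?v = rho U (monom 1 N * w)" by simp
  also have "intp (monom 1 1 * ?v - smult (rho U (monom 1 N * w)) U)"
    using Suc w U by (intro intp_diff intp_mult intp_smult intp_monom) (auto simp: Omega_def)
  finally show ?case .
qed

text \<open>Multiplication by X^N is split. The first min N (m + 1) factors are reduced modulo U
  without denominators; the others merely raise the degree, which stays below m because F + deg U
  \<le> 2m + 1.\<close>

lemma Omega_times_Lam:
  assumes U: "intp U" "degree U > 0" and w: "w \<in> Omega U (Suc m)" and m: "m \<ge> degree U"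
    and f: "f \<in> Lam (Suc F)" and F: "F + degree U \<le> 2 * m + 1"
  shows "\<exists>q\<in>Lam m. (f * w) mod U = q mod U"
proof -
  have "\<exists>q\<in>Lam m. (w * monom 1 N) mod U = q mod U" if N: "N \<le> F" for N
  proof -
    let ?k = "min N (Suc m)"
    let ?v = "(monom 1 ?k * w) mod U"
    let ?q = "monom 1 (N - ?k) * ?v"
    have "intp ?v"
      using m by (intro Omega_monom_mod_intp[OF U w]) auto
    hence "intp ?q" by (intro intp_mult intp_monom) auto
    moreover have "coeff ?q j = 0" if "j \<ge> m" for j
    proof -
      have "N - ?k + degree U \<le> m" using m F N by auto
      thus ?thesis using that U(2) by (auto simp: coeff_monom_mult intro!: coeff_mod_eq_0)
    qed
    moreover have "?q mod U = (w * monom 1 N) mod U"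
    proof -
      have "?q mod U = (monom 1 (N - ?k) * (monom 1 ?k * w)) mod U"
        by (simp add: mod_mult_right_eq)
      also have "monom 1 (N - ?k) * (monom 1 ?k * w) = monom 1 N * w"
        by (simp only: monom_mult_monom_1) simp
      finally show ?thesis by (simp add: mult.commute)
    qed
    ultimately show ?thesis by (auto simp: Lam_def intro!: bexI[of _ ?q])
  qed
  then obtain Q where Q: "\<And>N. N \<le> F \<Longrightarrow> Q N \<in> Lam m \<and> (w * monom 1 N) mod U = Q N mod U"
    by metis
  have "(w * f) mod U = (\<Sum>N<Suc F. smult (coeff f N) ((w * monom 1 N) mod U))"
    using f by (intro mult_mod_poly_expand) (auto simp: Lam_def)
  also have "\<dots> = (\<Sum>N<Suc F. smult (coeff f N) (Q N)) mod U"
    unfolding poly_mod_sum mod_smult_left using Q by (intro sum.cong refl) auto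
  finally have "(f * w) mod U = (\<Sum>N<Suc F. smult (coeff f N) (Q N)) mod U"
    by (simp add: mult.commute)
  moreover have "(\<Sum>N<Suc F. smult (coeff f N) (Q N)) \<in> Lam m"
    using Q f by (intro Lam_sum Lam_smult) (auto simp: Lam_def intp_def)
  ultimately show ?thesis by blast
qed

text \<open>For deg U = 2h - 1 this is the A-span of \<open>poly_shift i U\<close> with 1 \<le> i <
  h and of the monomials of degree < h. It mixes two mutually dual bases half and half: small enough
  for products of two elements to stay integral against every \<open>poly_shift l U\<close>, large
  enough to contain its own dual.\<close>

definition Pmod :: "'k poly \<Rightarrow> nat \<Rightarrow> 'k poly set" where
  "Pmod U h = {c \<in> Lam (degree U). \<forall>k. Suc k < h \<longrightarrow> rho U (monom 1 k * c) \<in> A}"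

lemma amod_Pmod: "amod (Pmod U h)"
  by (auto simp: amod_def Pmod_def Lam_def distrib_left rho_add rho_smult intp_add intp_smult
      intro: add_in mult_in)

lemma theta_Pmod:
  assumes "intp U" "1 \<le> l" "l \<le> degree U" "h \<le> degree U"
  shows "poly_shift l U \<in> Pmod U h"
proof -
  have "poly_shift l U \<in> Lam (degree U)"
    using assms by (auto simp: Lam_def intp_poly_shift coeff_poly_shift intro!: coeff_eq_0)
  thus ?thesis
    using assms by (auto simp: Pmod_def rho_poly_shift_monom mult.commute[of "monom 1 _"])
qed

lemma monom_Pmod:
  assumes "degree U + 1 = 2 * h" "k < h"
  shows "monom 1 k \<in> Pmod U h"
proof -
  have "monom 1 k \<in> Lam (degree U)"
    using assms by (auto simp: Lam_def intro: intp_monom)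
  moreover have "rho U (monom 1 j * monom 1 k) \<in> A" if "Suc j < h" for j
    using assms that by (simp add: mult_monom rho_monom_small)
  ultimately show ?thesis by (simp add: Pmod_def)
qed

text \<open>Testing b against \<open>poly_shift (i + 1) U\<close> reads off its coefficients;
  testing against X^k with k < h gives h integral residues, one more than \<open>Pmod\<close> asks
  for. The additional one lets X b satisfy the conditions as well.\<close>

lemma dual_Pmod:
  assumes U: "intp U" "degree U + 1 = 2 * h" and b: "b \<in> dual U (Pmod U h)"
  shows "b \<in> Pmod U h" "(monom 1 1 * b) mod U \<in> Pmod U h"
proof -
  have d: "degree U > 0" "h \<le> degree U" "h > 0" using U(2) by presburger+
  have bz: "coeff b i = 0" if "i \<ge> degree U" for i
    using b that by (auto simp: dual_def)
  have coef: "coeff b i \<in> A" for i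
  proof (cases "i < degree U")
    case True
    hence "rho U (poly_shift (Suc i) U * b) \<in> A"
      using b theta_Pmod[OF U(1), of "Suc i" h] d by (auto simp: dual_def)
    thus ?thesis using True rho_poly_shift[of "Suc i" U b] bz by simp
  qed (simp add: bz)
  have e: "rho U (monom 1 k * b) \<in> A" if "k < h" for k
    using b monom_Pmod[OF U(2) that] by (auto simp: dual_def)
  show "b \<in> Pmod U h"
    using coef e bz by (auto simp: Pmod_def Lam_def intp_def)
  have m: "(monom 1 1 * b) mod U = monom 1 1 * b - smult (rho U b) U"
    by (rule monom_times_mod[OF d(1) bz])
  have "rho U b \<in> A" using e[of 0] d by (simp add: monom_0 one_pCons[symmetric])
  hence "intp ((monom 1 1 * b) mod U)"
    unfolding m using coef U(1) by (intro intp_diff intp_mult intp_smult intp_monom) (auto simp: intp_def)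
  hence "(monom 1 1 * b) mod U \<in> Lam (degree U)"
    using coeff_mod_eq_0[OF d(1)] by (auto simp: Lam_def)
  moreover have "rho U (monom 1 k * ((monom 1 1 * b) mod U)) \<in> A" if "Suc k < h" for k
  proof -
    have "rho U (monom 1 k * ((monom 1 1 * b) mod U)) = rho U (monom 1 (Suc k) * b)"
      by (intro rho_cong) (simp add: mod_mult_right_eq monom_mult_monom_1)
    thus ?thesis using e[OF that] by simp
  qed
  ultimately show "(monom 1 1 * b) mod U \<in> Pmod U h" by (simp add: Pmod_def)
qed

text \<open>Subtracting the combination of the first h - 1 shifts with the residues of c as
  coefficients kills these residues, and \<open>rho_monoms_zero_imp\<close> bounds the degree of the
  rest below deg U - (h - 1) = h.\<close>

lemma Pmod_expand:
  assumes U: "intp U" "degree U + 1 = 2 * h" and c: "c \<in> Pmod U h"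
  shows "\<exists>e q. (\<forall>i. e i \<in> A) \<and> q \<in> Lam h \<and> c = (\<Sum>i=1..<h. smult (e i) (poly_shift i U)) + q"
proof -
  have d: "h \<le> degree U" using U(2) by auto
  define e where "e = (\<lambda>i. if i \<in> {1..<h} then rho U (monom 1 (i - 1) * c) else 0)"
  define v where "v = (\<Sum>i=1..<h. smult (e i) (poly_shift i U))"
  have e: "e i \<in> A" for i using c by (auto simp: e_def Pmod_def)
  have vint: "intp v"
    unfolding v_def by (intro intp_sum intp_smult intp_poly_shift U e)
  have cint: "intp c" "coeff c i = 0" if "i \<ge> degree U" for i
    using c that by (auto simp: Pmod_def Lam_def)
  have z: "coeff (c - v) i = 0" if "i \<ge> degree U" for i
    using cint(2)[OF that] that by (auto simp: v_def coeff_sum coeff_poly_shift intro!: sum.neutral coeff_eq_0)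
  have "rho U (monom 1 k * (c - v)) = 0" if k: "k < h - 1" for k
  proof -
    have "rho U (monom 1 k * v) = (\<Sum>i=1..<h. e i * rho U (poly_shift i U * monom 1 k))"
      by (simp add: v_def sum_distrib_left rho_sum rho_smult mult.commute)
    also have "\<dots> = (\<Sum>i=1..<h. if i = Suc k then rho U (monom 1 k * c) else 0)"
      using k d by (intro sum.cong refl) (auto simp: rho_poly_shift_monom e_def)
    also have "\<dots> = rho U (monom 1 k * c)" using k by simp
    finally show ?thesis by (simp add: right_diff_distrib rho_diff)
  qed
  hence "coeff (c - v) i = 0" if "i \<ge> h" for i
    using rho_monoms_zero_imp[of U "c - v" "h - 1" i] z U(2) that by auto
  moreover have "intp (c - v)"
    using cint(1)[of "degree U"] vint by (intro intp_diff) auto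
  ultimately have "c - v \<in> Lam h" by (simp add: Lam_def)
  thus ?thesis using e v_def by (intro exI[of _ e] exI[of _ "c - v"]) auto
qed

lemma theta_theta_Lam:
  assumes U: "intp U" "1 \<le> l" "l \<le> degree U" "1 \<le> i" "i \<le> degree U" and x: "x \<in> Lam (degree U)"
  shows "rho U (poly_shift l U * (poly_shift i U * x)) \<in> A"
proof -
  obtain q where q: "q \<in> Lam (degree U)" "(poly_shift i U * x) mod U = q mod U"
    using poly_shift_Lam[OF U(1,4,5) x] by blast
  have "rho U (poly_shift l U * (poly_shift i U * x)) = rho U (poly_shift l U * q)"
    by (intro rho_cong) (metis mod_mult_right_eq q(2))
  also have "\<dots> = coeff q (l - 1)"
    using q by (intro rho_poly_shift U) (auto simp: Lam_def)
  finally show ?thesis using q by (auto simp: Lam_def intp_def)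
qed

text \<open>After expanding both factors, terms containing a shift are covered by
  \<open>theta_theta_Lam\<close>; the remaining product q q' has degree at most 2h - 2 < deg U, so
  the shift simply reads off a coefficient.\<close>

lemma theta_Pmod_Pmod:
  assumes U: "intp U" "degree U + 1 = 2 * h" and l: "1 \<le> l" "l \<le> degree U"
    and c: "c \<in> Pmod U h" and c': "c' \<in> Pmod U h"
  shows "rho U (poly_shift l U * (c * c')) \<in> A"
proof -
  have d: "h \<le> degree U" using U(2) by auto
  obtain e q where e: "\<And>i. e i \<in> A" "q \<in> Lam h" "c = (\<Sum>i=1..<h. smult (e i) (poly_shift i U)) + q"
    using Pmod_expand[OF U c] by blast
  obtain e' q' where e': "\<And>i. e' i \<in> A" "q' \<in> Lam h" "c' = (\<Sum>i=1..<h. smult (e' i) (poly_shift i U)) + q'"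
    using Pmod_expand[OF U c'] by blast
  have c'L: "c' \<in> Lam (degree U)" and qL: "q \<in> Lam (degree U)"
    using c' e(2) d Lam_mono by (auto simp: Pmod_def)
  have "q * q' \<in> Lam (degree U)"
  proof -
    have "coeff (q * q') j = 0" if "j \<ge> degree U" for j
      unfolding coeff_mult
    proof (intro sum.neutral ballI)
      fix i assume "i \<in> {..j}"
      hence "i \<ge> h \<or> j - i \<ge> h" using that U(2) by auto
      thus "coeff q i * coeff q' (j - i) = 0" using e(2) e'(2) by (auto simp: Lam_def)
    qed
    thus ?thesis using e(2) e'(2) by (auto simp: Lam_def intp_mult)
  qed
  hence "intp (q * q')" "rho U (poly_shift l U * (q * q')) = coeff (q * q') (l - 1)"
    by (simp add: Lam_def, intro rho_poly_shift[OF l], simp add: Lam_def)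
  hence qq: "rho U (poly_shift l U * (q * q')) \<in> A" by (simp add: intp_def)
  have "rho U (poly_shift l U * (q * c')) =
      (\<Sum>i=1..<h. e' i * rho U (poly_shift l U * (poly_shift i U * q))) + rho U (poly_shift l U * (q * q'))"
    unfolding e'(3) by (simp add: distrib_left rho_add sum_distrib_left rho_sum rho_smult mult.commute)
  hence qc: "rho U (poly_shift l U * (q * c')) \<in> A"
    using e' qL d l U qq by (auto intro!: add_in sum_in mult_in theta_theta_Lam)
  have "rho U (poly_shift l U * (c * c')) =
      (\<Sum>i=1..<h. e i * rho U (poly_shift l U * (poly_shift i U * c'))) + rho U (poly_shift l U * (q * c'))"
    unfolding e(3) by (simp add: distrib_left distrib_right rho_add sum_distrib_left sum_distrib_right rho_sum rho_smult)
  thus ?thesis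
    using e c'L d l U qc by (auto intro!: add_in sum_in mult_in theta_theta_Lam)
qed

end

section \<open>The lattice attached to a square root of \<open>f\<close> modulo \<open>U\<close>\<close>

context pid_subring
begin

lemma amod_dual: "amod (dual U S)"
  by (auto simp: amod_def dual_def distrib_left rho_add rho_smult intro: add_in mult_in)

lemma gauss_power: "primp U \<Longrightarrow> intp (U ^ n * p) \<Longrightarrow> intp p"
  by (induction n) (auto simp: mult.assoc intro: gauss)

lemma bounded_image_mod:
  fixes V :: "'k poly"
  shows "\<exists>N\<in>A. N \<noteq> 0 \<and> (\<forall>w\<in>Lam M. intp (smult N ((V * w) mod U)))"
proof -
  obtain N where N: "N \<in> A" "N \<noteq> 0" "\<forall>k\<in>{..<M}. intp (smult N ((V * monom 1 k) mod U))"
    using common_denominator_polys[of "{..<M}" "\<lambda>k. (V * monom 1 k) mod U"] by auto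
  have "intp (smult N ((V * w) mod U))" if w: "w \<in> Lam M" for w
  proof -
    have "smult N ((V * w) mod U) = (\<Sum>k<M. smult (coeff w k) (smult N ((V * monom 1 k) mod U)))"
      using w by (subst mult_mod_poly_expand[of M]) (auto simp: Lam_def smult_sum2 mult.commute)
    also have "intp \<dots>"
      using w N by (intro intp_sum intp_smult[of "coeff w _"]) (auto simp: Lam_def intp_def)
    finally show ?thesis .
  qed
  thus ?thesis using N by blast
qed

lemma pairing_denominator:
  "\<exists>N\<in>A. N \<noteq> 0 \<and> (\<forall>p\<in>Lam (degree U). \<forall>i<degree U. N * rho U (p * monom 1 i) \<in> A)"
proof -
  obtain N where N: "N \<in> A" "N \<noteq> 0"
    "\<forall>ki\<in>{..<degree U} \<times> {..<degree U}. N * rho U (monom 1 (fst ki + snd ki)) \<in> A"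
    using common_denominator[of "{..<degree U} \<times> {..<degree U}" "\<lambda>ki. rho U (monom 1 (fst ki + snd ki))"]
    by auto
  have "N * rho U (p * monom 1 i) \<in> A" if p: "p \<in> Lam (degree U)" and i: "i < degree U" for p i
  proof -
    have "rho U (monom 1 i * p) = (\<Sum>k<degree U. coeff p k * rho U (monom 1 i * monom 1 k))"
      using p by (intro rho_expand) (auto simp: Lam_def)
    hence "N * rho U (p * monom 1 i) = (\<Sum>k<degree U. coeff p k * (N * rho U (monom 1 (k + i))))"
      by (simp add: sum_distrib_left mult_monom mult_ac add.commute)
    also have "\<dots> \<in> A"
    proof (rule sum_in)
      show "coeff p k * (N * rho U (monom 1 (k + i))) \<in> A" if "k \<in> {..<degree U}" for k
        by (rule mult_in) (use N(3) p i that in \<open>auto simp: Lam_def intp_def\<close>)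
    qed
    finally show ?thesis .
  qed
  thus ?thesis using N by blast
qed

text \<open>Multiplication by X - t and by (U(X) - U(t)) / (X - t) compose to - U(t) modulo U(X).
  Between \<phi> and its dual basis the first is the Gram matrix \<open>Gt\<close>; the second has
  the coefficients \<open>poly_shift (k + 1) U\<close> in t and is an integral matrix
  \<open>Ct\<close> by the hypothesis on the dual. Since det Gt is a constant K times U, det Ct is
  U^(d-1) / K up to sign, and primitivity of U makes 1 / K integral.\<close>

lemma lattice_det_unit:
  assumes U: "primp U" "degree U > 0"
    and S: "lattice (degree U) S"
    and \<theta>: "\<And>l v. 1 \<le> l \<Longrightarrow> l \<le> degree U \<Longrightarrow> v \<in> dual U S \<Longrightarrow> (poly_shift l U * v) mod U \<in> S"
  obtains \<phi> where "\<And>i. i < degree U \<Longrightarrow> \<phi> i \<in> S" "det (coef_mat (degree U) \<phi>) \<noteq> 0"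
    "lead_coeff U ^ (degree U + 1) / det (coef_mat (degree U) \<phi>) ^ 2 \<in> A"
proof -
  let ?d = "degree U"
  obtain \<phi> where \<phi>: "triangular ?d \<phi>" "\<And>i. i < ?d \<Longrightarrow> \<phi> i \<in> S"
    "\<And>p. p \<in> S \<Longrightarrow> \<exists>c. (\<forall>i. c i \<in> A) \<and> p = (\<Sum>i<?d. smult (c i) (\<phi> i))"
    using lattice_basis[OF S] by blast
  obtain \<phi>' where \<phi>': "\<And>j i. i \<ge> ?d \<Longrightarrow> coeff (\<phi>' j) i = 0"
    "\<And>i j. i < ?d \<Longrightarrow> j < ?d \<Longrightarrow> rho U (\<phi> i * \<phi>' j) = (if i = j then 1 else 0)"
    using dual_basis[OF U(2) \<phi>(1)] by blast
  have \<phi>z: "coeff (\<phi> j) i = 0" if "j < ?d" "i \<ge> ?d" for i j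
    using \<phi>(1) that by (auto simp: triangular_def)
  have dual: "\<phi>' j \<in> dual U S" if j: "j < ?d" for j
    unfolding dual_def
  proof (intro CollectI conjI ballI allI impI)
    fix p assume "p \<in> S"
    then obtain c where c: "\<forall>i. c i \<in> A" "p = (\<Sum>i<?d. smult (c i) (\<phi> i))" using \<phi>(3) by blast
    have "rho U (p * \<phi>' j) = (\<Sum>i<?d. if i = j then c i else 0)"
      unfolding c(2) sum_distrib_right rho_sum
      by (intro sum.cong refl) (auto simp: rho_smult \<phi>' j)
    thus "rho U (p * \<phi>' j) \<in> A" using c(1) j by simp
  qed (use \<phi>' in auto)
  have "\<exists>c. (\<forall>l. c l \<in> A) \<and> (poly_shift (Suc k) U * \<phi>' j) mod U = (\<Sum>l<?d. smult (c l) (\<phi> l))"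
    if j: "j < ?d" for k j
  proof (cases "k < ?d")
    case True
    thus ?thesis using \<phi>(3) \<theta>[of "Suc k" "\<phi>' j"] dual[OF j] by simp
  next
    case False
    hence "poly_shift (Suc k) U = 0"
      by (intro poly_eqI) (auto simp: coeff_poly_shift intro!: coeff_eq_0)
    thus ?thesis by (intro exI[of _ "\<lambda>_. 0"]) simp
  qed
  hence "\<forall>k j. \<exists>c. j < ?d \<longrightarrow> (\<forall>l. c l \<in> A) \<and>
      (poly_shift (Suc k) U * \<phi>' j) mod U = (\<Sum>l<?d. smult (c l) (\<phi> l))" by blast
  then obtain C where "\<forall>k j. j < ?d \<longrightarrow> (\<forall>l. C k j l \<in> A) \<and>
      (poly_shift (Suc k) U * \<phi>' j) mod U = (\<Sum>l<?d. smult (C k j l) (\<phi> l))"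
    by metis
  hence C: "\<And>k j l. j < ?d \<Longrightarrow> C k j l \<in> A"
    "\<And>k j. j < ?d \<Longrightarrow> (poly_shift (Suc k) U * \<phi>' j) mod U = (\<Sum>l<?d. smult (C k j l) (\<phi> l))"
    by blast+
  have C_rho: "rho U (q * (poly_shift (Suc k) U * \<phi>' j)) = (\<Sum>l<?d. C k j l * rho U (q * \<phi> l))"
    if "j < ?d" for q k j
  proof -
    have "rho U (q * (poly_shift (Suc k) U * \<phi>' j)) = rho U (q * ((poly_shift (Suc k) U * \<phi>' j) mod U))"
      by (intro rho_cong) (simp add: mod_mult_right_eq)
    thus ?thesis
      unfolding C(2)[OF that] by (simp add: sum_distrib_left rho_sum rho_smult)
  qed
  \<comment> \<open>C was obtained by choice. For k \<ge> d the shift is zero and pairing with the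
    dual basis forces zero coordinates, so the truncated sum defining \<open>Ct\<close> has the
    expected coefficients in every degree.\<close>
  have C0: "C k j l = 0" if "j < ?d" "k \<ge> ?d" "l < ?d" for k j l
  proof -
    have "poly_shift (Suc k) U = 0"
      using that by (intro poly_eqI) (auto simp: coeff_poly_shift intro!: coeff_eq_0)
    hence "rho U (\<phi>' l * (poly_shift (Suc k) U * \<phi>' j)) = 0" by simp
    moreover have "(\<Sum>i<?d. C k j i * rho U (\<phi>' l * \<phi> i)) = (\<Sum>i<?d. if i = l then C k j i else 0)"
      using that by (intro sum.cong refl) (auto simp: \<phi>' mult.commute[of "\<phi>' l"])
    ultimately show ?thesis
      using C_rho[OF that(1), of "\<phi>' l" k] that by simp
  qed
  define Ct where "Ct = mat ?d ?d (\<lambda>(l, j). \<Sum>k<?d. monom (C k j l) k)"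
  define Gt where "Gt = mat ?d ?d (\<lambda>(i, l). [:rho U (monom 1 1 * (\<phi> i * \<phi> l)), - rho U (\<phi> i * \<phi> l):])"
  have Ct: "Ct \<in> carrier_mat ?d ?d" and Gt: "Gt \<in> carrier_mat ?d ?d"
    by (auto simp: Ct_def Gt_def)
  have Ct_coeff: "coeff (Ct $$ (l, j)) k = C k j l" if "l < ?d" "j < ?d" for l j k
    using that C0 by (auto simp: Ct_def coeff_sum not_less)
  have GC: "Gt * Ct = (- U) \<cdot>\<^sub>m 1\<^sub>m ?d"
  proof (intro eq_matI)
    fix i j assume "i < dim_row ((- U) \<cdot>\<^sub>m 1\<^sub>m ?d)" "j < dim_col ((- U) \<cdot>\<^sub>m 1\<^sub>m ?d)"
    hence ij: "i < ?d" "j < ?d" by auto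
    \<comment> \<open>This is the telescoping in the division by X - t: everything cancels except
      \<open>coeff U e\<close> times the pairing of \<phi>_i with \<phi>'_j.\<close>
    have shift: "monom 1 1 * poly_shift (Suc e) U = poly_shift e U - [:coeff U e:]" for e
      by (intro poly_eqI) (auto simp: coeff_monom_mult coeff_poly_shift coeff_pCons split: nat.split)
    have "(Gt * Ct) $$ (i, j) = (\<Sum>l<?d. Gt $$ (i, l) * Ct $$ (l, j))"
      using ij Ct Gt by (simp add: scalar_prod_def lessThan_atLeast0)
    also have "\<dots> = (if i = j then - U else 0)"
    proof (rule poly_eqI)
      fix e
      have "coeff (\<Sum>l<?d. Gt $$ (i, l) * Ct $$ (l, j)) e =
          (\<Sum>l<?d. C e j l * rho U (monom 1 1 * (\<phi> i * \<phi> l))) -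
          (if e = 0 then 0 else (\<Sum>l<?d. C (e - 1) j l * rho U (\<phi> i * \<phi> l)))"
        using ij Ct_coeff
        by (cases e) (simp_all add: coeff_sum Gt_def sum_subtractf[symmetric] mult.commute)
      also have "(\<Sum>l<?d. C e j l * rho U (monom 1 1 * (\<phi> i * \<phi> l))) =
          rho U (\<phi> i * (poly_shift e U - [:coeff U e:]) * \<phi>' j)"
        unfolding shift[symmetric] using C_rho[OF ij(2), of "monom 1 1 * \<phi> i" e] by (simp add: mult_ac)
      also have "\<dots> = rho U (\<phi> i * (poly_shift e U * \<phi>' j)) - coeff U e * (if i = j then 1 else 0)"
        using ij \<phi>'(2) by (simp add: algebra_simps rho_diff rho_smult)
      also have "rho U (\<phi> i * (poly_shift e U * \<phi>' j)) =
          (if e = 0 then 0 else (\<Sum>l<?d. C (e - 1) j l * rho U (\<phi> i * \<phi> l)))"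
      proof (cases e)
        case 0
        have "rho U (\<phi> i * (U * \<phi>' j)) = rho U 0"
          by (intro rho_cong) simp
        thus ?thesis using 0 by simp
      next
        case (Suc e')
        thus ?thesis using C_rho[OF ij(2), of "\<phi> i" e'] by simp
      qed
      finally show "coeff (\<Sum>l<?d. Gt $$ (i, l) * Ct $$ (l, j)) e = coeff (if i = j then - U else 0) e"
        by auto
    qed
    finally show "(Gt * Ct) $$ (i, j) = ((- U) \<cdot>\<^sub>m 1\<^sub>m ?d) $$ (i, j)" using ij by simp
  qed (use Gt Ct in auto)
  define \<delta> where "\<delta> = det (coef_mat ?d \<phi>)"
  define \<epsilon> :: 'k where "\<epsilon> = (-1) ^ (?d * (?d - 1) div 2) * (-1) ^ ?d"
  have \<epsilon>: "\<epsilon> * \<epsilon> = 1" by (simp add: \<epsilon>_def minus_one_power_iff)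
  \<comment> \<open>K collects the constants from \<open>det_gram\<close> and from the norm of X -
    t; \<epsilon> gathers their signs.\<close>
  define K where "K = \<delta> ^ 2 * \<epsilon> * inverse (lead_coeff U) ^ (?d + 1)"
  have "\<delta> \<noteq> 0" unfolding \<delta>_def by (rule triangular_det[OF \<phi>(1)])
  have u: "lead_coeff U \<noteq> 0" using U(2) by auto
  have K0: "K \<noteq> 0" using \<open>\<delta> \<noteq> 0\<close> \<epsilon> u by (auto simp: K_def)
  have "det Gt = smult K U"
  proof (subst poly_eq_poly_eq_iff[symmetric], rule ext)
    fix x :: 'k
    have ev: "comm_ring_hom (\<lambda>p. poly p x)"
      by unfold_locales auto
    have "poly (det Gt) x = det (map_mat (\<lambda>p. poly p x) Gt)"
      by (rule comm_ring_hom.hom_det[OF ev, symmetric])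
    also have "map_mat (\<lambda>p. poly p x) Gt = gram U [:- x, 1:] \<phi>"
    proof -
      have "[:- x, 1:] * \<phi> i * \<phi> j = monom 1 1 * (\<phi> i * \<phi> j) - smult x (\<phi> i * \<phi> j)" for i j
        by (simp add: monom_altdef algebra_simps)
      hence "rho U ([:- x, 1:] * \<phi> i * \<phi> j) = rho U (monom 1 1 * (\<phi> i * \<phi> j)) - x * rho U (\<phi> i * \<phi> j)" for i j
        by (simp only: rho_diff rho_smult)
      thus ?thesis by (intro eq_matI) (auto simp: Gt_def gram_def simp del: mult_pCons_left)
    qed
    also have "det (gram U [:- x, 1:] \<phi>) = \<delta> ^ 2 * ((-1) ^ (?d * (?d - 1) div 2) *
        inverse (lead_coeff U) ^ ?d * ((-1) ^ ?d * poly U x / lead_coeff U))"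
      using det_gram[OF U(2) \<phi>z] nrm_linear[OF U(2)] by (simp only: \<delta>_def)
    also have "\<dots> = poly (smult K U) x"
      by (simp add: K_def \<epsilon>_def field_simps)
    finally show "poly (det Gt) x = poly (smult K U) x" .
  qed
  moreover have "det Gt * det Ct = (- U) ^ ?d"
    using det_mult[OF Gt Ct] by (simp add: GC det_smult)
  ultimately have "smult K U * det Ct = (- U) ^ ?d" by simp
  also have "(- U) ^ ?d = U * smult ((-1) ^ ?d) (U ^ (?d - 1))"
    using U(2) by (cases ?d) (auto simp: power_minus[of U] minus_one_power_iff)
  finally have "U * smult K (det Ct) = U * smult ((-1) ^ ?d) (U ^ (?d - 1))" by simp
  hence "smult K (det Ct) = smult ((-1) ^ ?d) (U ^ (?d - 1))" using U(2) by (metis degree_0 less_irrefl mult_cancel_left)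
  hence "smult (inverse K) (smult K (det Ct)) = smult (inverse K) (smult ((-1) ^ ?d) (U ^ (?d - 1)))"
    by (rule arg_cong)
  hence "U ^ (?d - 1) * [:inverse K * (-1) ^ ?d:] = det Ct"
    using K0 by (simp add: mult.commute)
  moreover have "intp (det Ct)"
  proof (rule det_intp[OF Ct])
    show "intp (Ct $$ (l, j))" if "l < ?d" "j < ?d" for l j
      using Ct_coeff[OF that] C(1)[OF that(2)] by (simp add: intp_def)
  qed
  ultimately have "intp [:inverse K * (-1) ^ ?d:]"
    using gauss_power[OF U(1)] by metis
  hence "coeff [:inverse K * (-1) ^ ?d:] 0 \<in> A" unfolding intp_def by blast
  hence 1: "inverse K * (-1) ^ ?d \<in> A" by simp
  have 2: "(-1) ^ ?d * \<epsilon> \<in> A"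
    unfolding \<epsilon>_def by (intro mult_in power_in uminus_in one_in)
  have "inverse K * \<epsilon> = (inverse K * (-1) ^ ?d) * ((-1) ^ ?d * \<epsilon>)"
    by (simp add: minus_one_power_iff)
  also have "\<dots> \<in> A" by (rule mult_in[OF 1 2])
  also have "inverse K * \<epsilon> = lead_coeff U ^ (?d + 1) / \<delta> ^ 2"
  proof -
    have "inverse \<epsilon> = \<epsilon>" using \<epsilon> by (metis inverse_unique)
    moreover have "\<epsilon> \<noteq> 0" using \<epsilon> by auto
    ultimately show ?thesis using \<epsilon> \<open>\<delta> \<noteq> 0\<close> u
      by (simp add: K_def field_simps)
  qed
  finally show ?thesis
    using that[of \<phi>] \<phi>(2) \<open>\<delta> \<noteq> 0\<close> by (simp add: \<delta>_def)
qed

text \<open>V F lies in \<open>Lam M\<close> modulo U: for V V \<Omega> = f \<Omega> by a degree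
  count, and for V B because B pairs integrally with V \<Omega>_M, which puts V B into the bidual of
  \<open>Lam M\<close>. Integrality on F splits into B with B, handled by \<open>dual_Pmod\<close>,
  and F with V \<Omega>, where \<Omega>_(M+1) tolerates the factor X. For the determinant,
  \<open>lattice_det_unit\<close> requires that the shifts of U map the dual of F into F.\<close>

lemma core_lattice:
  fixes U f V :: "'k poly" and h s :: nat
  assumes U: "primp U" "degree U + 1 = 2 * h"
    and f: "intp f" "degree f \<le> 2 * s" and hs: "h \<le> s"
    and V: "(V * V) mod U = f mod U"
  obtains \<phi> where "\<And>j i. j < degree U \<Longrightarrow> i \<ge> degree U \<Longrightarrow> coeff (\<phi> j) i = 0"
    "\<And>i j. i < degree U \<Longrightarrow> j < degree U \<Longrightarrow> rho U (\<phi> i * \<phi> j) \<in> A"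
    "\<And>i j. i < degree U \<Longrightarrow> j < degree U \<Longrightarrow> rho U (monom 1 1 * (\<phi> i * \<phi> j)) \<in> A"
    "\<And>i. i < degree U \<Longrightarrow> \<exists>r\<in>Lam (h + s - 1). (V * \<phi> i) mod U = r mod U"
    "det (coef_mat (degree U) \<phi>) \<noteq> 0"
    "lead_coeff U ^ (degree U + 1) / det (coef_mat (degree U) \<phi>) ^ 2 \<in> A"
proof -
  let ?d = "degree U"
  \<comment> \<open>This makes 2s + deg U = 2M + 1, the borderline case of
    \<open>Omega_times_Lam\<close>; h \<le> s gives M \<ge> deg U.\<close>
  define M where "M = h + s - 1"
  have Uint: "intp U" using U(1) by (simp add: primp_def)
  have d: "?d > 0" "h \<le> ?d" "h > 0" using U(2) by presburger+
  have M: "M \<ge> ?d" using U(2) hs by (simp add: M_def)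
  define P where "P = Pmod U h"
  define L where "L = {c + (V * w) mod U | c w. c \<in> P \<and> w \<in> Omega U M}"
  \<comment> \<open>Duality against P supplies the two integral forms on B, duality against V
    \<Omega>_M the integrality of V B.\<close>
  define B where "B = dual U L"
  define F where "F = {b + (V * w) mod U | b w. b \<in> B \<and> w \<in> Omega U (Suc M)}"
  have amodP: "amod P" unfolding P_def by (rule amod_Pmod)
  have amodB: "amod B" unfolding B_def by (rule amod_dual)
  have amod_sum_image: "amod {c + (V * w) mod U | c w. c \<in> C \<and> w \<in> W}" if "amod C" "amod W" for C W
    unfolding amod_def
  proof (intro conjI ballI)
    show "0 \<in> {c + (V * w) mod U | c w. c \<in> C \<and> w \<in> W}"
      using that by (auto simp: amod_def intro!: exI[of _ 0])
  next
    fix p q assume "p \<in> {c + (V * w) mod U | c w. c \<in> C \<and> w \<in> W}" "q \<in> {c + (V * w) mod U | c w. c \<in> C \<and> w \<in> W}"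
    then obtain c w c' w' where *: "p = c + (V * w) mod U" "q = c' + (V * w') mod U"
      "c \<in> C" "w \<in> W" "c' \<in> C" "w' \<in> W" by blast
    have "p + q = (c + c') + (V * (w + w')) mod U"
      by (simp add: * distrib_left poly_mod_add_left)
    moreover have "c + c' \<in> C" "w + w' \<in> W" using that * by (auto simp: amod_def)
    ultimately show "p + q \<in> {c + (V * w) mod U | c w. c \<in> C \<and> w \<in> W}" by blast
  next
    fix a p assume a: "a \<in> A" and "p \<in> {c + (V * w) mod U | c w. c \<in> C \<and> w \<in> W}"
    then obtain c w where *: "p = c + (V * w) mod U" "c \<in> C" "w \<in> W" by blast
    have "smult a p = smult a c + (V * smult a w) mod U"
      by (simp add: * smult_add_right mod_smult_left)
    moreover have "smult a c \<in> C" "smult a w \<in> W" using that * a by (auto simp: amod_def)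
    ultimately show "smult a p \<in> {c + (V * w) mod U | c w. c \<in> C \<and> w \<in> W}" by blast
  qed
  have \<Omega>_Lam: "w \<in> Lam ?d" if "w \<in> Omega U N" "N \<ge> ?d" for w N
    using Omega_intp[OF Uint that] that(1) by (auto simp: Lam_def Omega_def)
  obtain N1 where N1: "N1 \<in> A" "N1 \<noteq> 0" "\<And>w. w \<in> Lam ?d \<Longrightarrow> intp (smult N1 ((V * w) mod U))"
    using bounded_image_mod[of ?d V U] by blast
  obtain N2 where N2: "N2 \<in> A" "N2 \<noteq> 0"
    "\<And>p i. p \<in> Lam ?d \<Longrightarrow> i < ?d \<Longrightarrow> N2 * rho U (p * monom 1 i) \<in> A"
    using pairing_denominator[of U] by blast
  have PL: "P \<subseteq> Lam ?d" by (auto simp: P_def Pmod_def)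
  have \<Omega>0: "0 \<in> Omega U N" for N using amod_Omega by (auto simp: amod_def)
  have P_L: "c \<in> L" if "c \<in> P" for c
  proof -
    have "c = c + (V * 0) mod U" by simp
    thus ?thesis unfolding L_def using that \<Omega>0[of M] by blast
  qed
  have L_bound: "smult N1 l \<in> Lam ?d" if l: "l \<in> L" for l
  proof -
    obtain c w where *: "l = c + (V * w) mod U" "c \<in> P" "w \<in> Omega U M" using l by (auto simp: L_def)
    have "intp (smult N1 c + smult N1 ((V * w) mod U))"
      by (rule intp_add[OF intp_smult[OF N1(1)] N1(3)])
         (use *(2,3) PL \<Omega>_Lam[OF _ M] in \<open>auto simp: Lam_def\<close>)
    moreover have "smult N1 l = smult N1 c + smult N1 ((V * w) mod U)"
      by (simp add: * smult_add_right)
    moreover have "coeff l i = 0" if "i \<ge> ?d" for i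
      using * PL that coeff_mod_eq_0[OF d(1)] by (auto simp: Lam_def)
    hence "\<forall>i\<ge>?d. coeff (smult N1 l) i = 0" by simp
    ultimately show ?thesis unfolding Lam_def by simp
  qed
  have latL: "lattice ?d L"
    unfolding lattice_def
  proof (intro conjI)
    show "amod L" unfolding L_def by (rule amod_sum_image[OF amodP amod_Omega])
    show "\<forall>p\<in>L. \<forall>i\<ge>?d. coeff p i = 0"
      using PL coeff_mod_eq_0[OF d(1)] by (auto simp: L_def Lam_def)
    show "\<exists>N\<in>A. N \<noteq> 0 \<and> (\<forall>p\<in>L. intp (smult N p))"
      using N1 L_bound by (auto simp: Lam_def)
    have "monom N2 i \<in> L" if i: "i < ?d" for i
    proof (rule P_L)
      have "rho U (monom 1 k * monom N2 i) = N2 * rho U (monom 1 k * monom 1 i)" for k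
        by (metis mult.right_neutral mult_smult_right rho_smult smult_monom)
      moreover have "N2 * rho U (monom 1 k * monom 1 i) \<in> A" if "k < ?d" for k
        using that i by (intro N2(3)) (auto simp: Lam_def intro: intp_monom)
      ultimately show "monom N2 i \<in> P"
        unfolding P_def Pmod_def using i d N2(1) by (auto simp: Lam_def intro: intp_monom)
    qed
    thus "\<exists>M\<in>A. M \<noteq> 0 \<and> (\<forall>i<?d. monom M i \<in> L)" using N2 by blast
  qed
  have B_dualP: "b \<in> dual U P" if "b \<in> B" for b
    using that P_L by (auto simp: B_def dual_def)
  have B_P: "b \<in> P" "(monom 1 1 * b) mod U \<in> P" if "b \<in> B" for b
    using dual_Pmod[OF Uint U(2)] B_dualP[OF that] by (auto simp: P_def)
  have B_F: "b \<in> F" if "b \<in> B" for b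
  proof -
    have "b = b + (V * 0) mod U" by simp
    thus ?thesis unfolding F_def using that \<Omega>0[of "Suc M"] by blast
  qed
  have \<Omega>_F: "(V * w) mod U \<in> F" if "w \<in> Omega U (Suc M)" for w
  proof -
    have "0 \<in> B" using amodB by (auto simp: amod_def)
    moreover have "(V * w) mod U = 0 + (V * w) mod U" by simp
    ultimately show ?thesis unfolding F_def using that by blast
  qed
  have latF: "lattice ?d F"
    unfolding lattice_def
  proof (intro conjI)
    show "amod F" unfolding F_def by (rule amod_sum_image[OF amodB amod_Omega])
    show "\<forall>p\<in>F. \<forall>i\<ge>?d. coeff p i = 0"
      using coeff_mod_eq_0[OF d(1)] by (auto simp: F_def B_def dual_def)
    have "intp (smult N1 p)" if p: "p \<in> F" for p
    proof -
      obtain c w where *: "p = c + (V * w) mod U" "c \<in> P" "w \<in> Omega U (Suc M)"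
        using p B_P(1) unfolding F_def by blast
      have "intp (smult N1 c + smult N1 ((V * w) mod U))"
        by (rule intp_add[OF intp_smult[OF N1(1)] N1(3)])
           (use *(2,3) PL \<Omega>_Lam[of w "Suc M"] M in \<open>auto simp: Lam_def\<close>)
      thus ?thesis by (simp add: * smult_add_right)
    qed
    thus "\<exists>N\<in>A. N \<noteq> 0 \<and> (\<forall>p\<in>F. intp (smult N p))" using N1 by blast
    have "monom (N1 * N2) i \<in> F" if i: "i < ?d" for i
    proof (rule B_F)
      have "rho U (l * monom (N1 * N2) i) \<in> A" if "l \<in> L" for l
      proof -
        have "monom (N1 * N2) i = smult N2 (smult N1 (monom 1 i))"
          by (simp add: smult_monom mult.commute)
        hence "l * monom (N1 * N2) i = smult N2 (smult N1 l * monom 1 i)"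
          by (simp only: mult_smult_right mult_smult_left)
        thus ?thesis using N2(3)[OF L_bound[OF that] i] by (simp only: rho_smult)
      qed
      thus "monom (N1 * N2) i \<in> B" using i by (auto simp: B_def dual_def)
    qed
    thus "\<exists>M\<in>A. M \<noteq> 0 \<and> (\<forall>i<?d. monom M i \<in> F)"
      using N1 N2 by (intro bexI[of _ "N1 * N2"]) (auto intro: mult_in)
  qed
  \<comment> \<open>\<Omega>_M is exhibited as the dual of a lattice, so that \<open>bidual\<close>
    can turn integrality against \<Omega>_M into membership in the image of
    \<open>Lam M\<close>.\<close>
  define I where "I = (\<lambda>q. q mod U) ` Lam M"
  have latI: "lattice ?d I"
    unfolding lattice_def
  proof (intro conjI)
    show "amod I"
      unfolding amod_def I_def
    proof (intro conjI ballI)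
      have "0 \<in> Lam M" by (simp add: Lam_def)
      thus "0 \<in> (\<lambda>q. q mod U) ` Lam M" by (rule image_eqI[rotated]) simp
      show "p + q \<in> (\<lambda>q. q mod U) ` Lam M" if "p \<in> (\<lambda>q. q mod U) ` Lam M" "q \<in> (\<lambda>q. q mod U) ` Lam M" for p q
        using that by (auto simp: poly_mod_add_left[symmetric] intro!: imageI Lam_add)
      show "smult a p \<in> (\<lambda>q. q mod U) ` Lam M" if "a \<in> A" "p \<in> (\<lambda>q. q mod U) ` Lam M" for a p
        using that by (auto simp: mod_smult_left[symmetric] intro!: imageI Lam_smult)
    qed
    show "\<forall>p\<in>I. \<forall>i\<ge>?d. coeff p i = 0" using coeff_mod_eq_0[OF d(1)] by (auto simp: I_def)
    show "\<exists>N\<in>A. N \<noteq> 0 \<and> (\<forall>p\<in>I. intp (smult N p))"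
      using bounded_image_mod[of M 1 U] by (auto simp: I_def)
    show "\<exists>M\<in>A. M \<noteq> 0 \<and> (\<forall>i<?d. monom M i \<in> I)"
    proof (intro bexI[of _ 1] conjI allI impI)
      fix i assume i: "i < ?d"
      have "monom 1 i = monom 1 i mod U" using i by (intro mod_poly_less[symmetric]) (simp add: degree_monom_eq)
      moreover have "monom 1 i \<in> Lam M" using i M by (auto simp: Lam_def intro: intp_monom)
      ultimately show "monom 1 i \<in> I" unfolding I_def by blast
    qed auto
  qed
  have \<Omega>_dualI: "Omega U M = dual U I"
  proof (intro equalityI subsetI)
    fix w assume w: "w \<in> Omega U M"
    have "rho U ((q mod U) * w) \<in> A" if "q \<in> Lam M" for q
    proof -
      have "rho U ((q mod U) * w) = rho U (q * w)" by (intro rho_cong) (simp add: mod_mult_left_eq)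
      thus ?thesis using Omega_Lam[OF w that] by simp
    qed
    thus "w \<in> dual U I" using w by (auto simp: dual_def I_def Omega_def)
  next
    fix w assume w: "w \<in> dual U I"
    have "rho U (monom 1 k * w) \<in> A" if "k < M" for k
    proof -
      have "monom 1 k \<in> Lam M" using that by (auto simp: Lam_def intro: intp_monom)
      hence "rho U ((monom 1 k mod U) * w) \<in> A" using w by (auto simp: dual_def I_def)
      moreover have "rho U ((monom 1 k mod U) * w) = rho U (monom 1 k * w)"
        by (intro rho_cong) (simp add: mod_mult_left_eq)
      ultimately show ?thesis by simp
    qed
    thus "w \<in> Omega U M" using w by (auto simp: dual_def Omega_def)
  qed
  have f\<Omega>: "\<exists>q\<in>Lam M. (f * w) mod U = q mod U" if "w \<in> Omega U (Suc M)" for w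
  proof (rule Omega_times_Lam[OF Uint d(1) that M, of _ "2 * s"])
    show "f \<in> Lam (Suc (2 * s))" using f by (auto simp: Lam_def intro!: coeff_eq_0)
    show "2 * s + ?d \<le> 2 * M + 1" using U(2) hs by (simp add: M_def)
  qed
  have B_V: "\<exists>r\<in>Lam M. (V * b) mod U = r mod U" if b: "b \<in> B" for b
  proof -
    have "rho U (w * ((V * b) mod U)) \<in> A" if w: "w \<in> Omega U M" for w
    proof -
      have "0 \<in> P" "(V * w) mod U = 0 + (V * w) mod U" using amodP by (simp_all add: amod_def)
      hence "(V * w) mod U \<in> L"
        unfolding L_def using w by blast
      hence "rho U (((V * w) mod U) * b) \<in> A" using b by (auto simp: B_def dual_def)
      moreover have "rho U (((V * w) mod U) * b) = rho U (w * ((V * b) mod U))"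
        by (intro rho_cong) (simp add: mod_mult_left_eq mod_mult_right_eq mult_ac)
      ultimately show ?thesis by simp
    qed
    hence "(V * b) mod U \<in> dual U (dual U I)"
      unfolding \<Omega>_dualI[symmetric] using coeff_mod_eq_0[OF d(1)] by (auto simp: dual_def)
    hence "(V * b) mod U \<in> I" by (rule bidual[OF d(1) latI])
    thus ?thesis by (auto simp: I_def)
  qed
  have F_V: "\<exists>r\<in>Lam M. (V * b) mod U = r mod U" if b: "b \<in> F" for b
  proof -
    obtain c w where *: "b = c + (V * w) mod U" "c \<in> B" "w \<in> Omega U (Suc M)"
      using b unfolding F_def by blast
    obtain r where r: "r \<in> Lam M" "(V * c) mod U = r mod U" using B_V[OF *(2)] by blast
    obtain q where q: "q \<in> Lam M" "(f * w) mod U = q mod U" using f\<Omega>[OF *(3)] by blast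
    have "(V * ((V * w) mod U)) mod U = ((V * V) mod U * w) mod U"
      by (simp add: mod_mult_left_eq mod_mult_right_eq mult.assoc)
    also have "\<dots> = q mod U" unfolding V using q(2) by (simp add: mod_mult_left_eq)
    finally have "(V * b) mod U = (r + q) mod U"
      by (simp add: * distrib_left poly_mod_add_left r)
    thus ?thesis using r q Lam_add by blast
  qed
  \<comment> \<open>V is moved from w to b: V b has a representative in \<open>Lam M\<close>, and X
    times it lies in \<open>Lam (Suc M)\<close>, with which w pairs integrally.\<close>
  have F_\<Omega>: "rho U (b * ((V * w) mod U)) \<in> A" "rho U (monom 1 1 * (b * ((V * w) mod U))) \<in> A"
    if b: "b \<in> F" and w: "w \<in> Omega U (Suc M)" for b w
  proof -
    obtain r where r: "r \<in> Lam M" "(V * b) mod U = r mod U" using F_V[OF b] by blast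
    have *: "rho U (q * (b * ((V * w) mod U))) = rho U (q * r * w)" for q
    proof (rule rho_cong)
      have "(q * (b * ((V * w) mod U))) mod U = (q * (((V * b) mod U) * w)) mod U"
        by (metis (no_types, opaque_lifting) mod_mult_left_eq mod_mult_right_eq mult.assoc mult.commute)
      also have "\<dots> = (q * ((r mod U) * w)) mod U" by (simp add: r)
      also have "\<dots> = (q * (r * w)) mod U"
        by (metis mod_mult_left_eq mod_mult_right_eq)
      finally show "(q * (b * ((V * w) mod U))) mod U = (q * r * w) mod U" by (simp add: mult.assoc)
    qed
    show "rho U (b * ((V * w) mod U)) \<in> A"
      using *[of 1] Omega_Lam[OF w Lam_mono[OF _ r(1)]] by simp
    have "intp (monom 1 1 * r)"
      using r(1) by (intro intp_mult intp_monom) (auto simp: Lam_def)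
    hence "monom 1 1 * r \<in> Lam (Suc M)"
      using r(1) by (auto simp: Lam_def coeff_monom_mult)
    thus "rho U (monom 1 1 * (b * ((V * w) mod U))) \<in> A"
      using *[of "monom 1 1"] Omega_Lam[OF w] by simp
  qed
  have BB: "rho U (b * b') \<in> A" "rho U (monom 1 1 * (b * b')) \<in> A" if b: "b \<in> B" "b' \<in> B" for b b'
  proof -
    show "rho U (b * b') \<in> A"
      using B_P(1)[OF b(1)] B_dualP[OF b(2)] by (auto simp: dual_def)
    have "rho U (((monom 1 1 * b) mod U) * b') \<in> A"
      using B_P(2)[OF b(1)] B_dualP[OF b(2)] by (auto simp: dual_def)
    moreover have "rho U (((monom 1 1 * b) mod U) * b') = rho U (monom 1 1 * (b * b'))"
      by (intro rho_cong) (simp add: mod_mult_left_eq mult.assoc)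
    ultimately show "rho U (monom 1 1 * (b * b')) \<in> A" by simp
  qed
  have FF: "rho U (b * b') \<in> A \<and> rho U (monom 1 1 * (b * b')) \<in> A" if b: "b \<in> F" "b' \<in> F" for b b'
  proof -
    obtain c w where 1: "b = c + (V * w) mod U" "c \<in> B" "w \<in> Omega U (Suc M)"
      using b unfolding F_def by blast
    obtain c' w' where 2: "b' = c' + (V * w') mod U" "c' \<in> B" "w' \<in> Omega U (Suc M)"
      using b unfolding F_def by blast
    have e: "b * b' = c * c' + c * ((V * w') mod U) + b' * ((V * w) mod U)"
      by (simp add: 1(1) 2(1) algebra_simps)
    show ?thesis
      unfolding e distrib_left rho_add
      using BB[OF 1(2) 2(2)] F_\<Omega>[OF B_F[OF 1(2)] 2(3)] F_\<Omega>[OF b(2) 1(3)]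
      by (auto intro!: add_in)
  qed
  \<comment> \<open>The dual of F lies in the dual of B, which is L by biduality, so v = c + V w
    with c in P. The part with w moves into V \<Omega>_(M+1) by \<open>Omega_theta\<close>; it
    remains to place the shift times c in B.\<close>
  have \<theta>F: "(poly_shift l U * v) mod U \<in> F" if l: "1 \<le> l" "l \<le> ?d" and v: "v \<in> dual U F" for l v
  proof -
    have "v \<in> dual U (dual U L)"
      using v B_F by (auto simp: B_def dual_def)
    hence "v \<in> L" by (rule bidual[OF d(1) latL])
    then obtain c w where *: "v = c + (V * w) mod U" "c \<in> P" "w \<in> Omega U M"
      unfolding L_def by blast
    let ?\<theta> = "poly_shift l U"
    have \<Omega>: "(?\<theta> * w') mod U \<in> Omega U (Suc M)" if "w' \<in> Omega U M" for w'
      by (rule Omega_theta[OF Uint l M that])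
    have "(?\<theta> * c) mod U \<in> B"
      unfolding B_def dual_def
    proof (intro CollectI conjI ballI allI impI)
      show "coeff ((?\<theta> * c) mod U) i = 0" if "i \<ge> ?d" for i
        using that by (rule coeff_mod_eq_0[OF d(1)])
      fix l' assume "l' \<in> L"
      then obtain c' w' where 2: "l' = c' + (V * w') mod U" "c' \<in> P" "w' \<in> Omega U M"
        unfolding L_def by blast
      let ?w = "(?\<theta> * w') mod U"
      obtain q where q: "q \<in> Lam M" "(f * ?w) mod U = q mod U" using f\<Omega>[OF \<Omega>[OF 2(3)]] by blast
      \<comment> \<open>The shift is passed from c to w', where it lands in \<Omega>_(M+1). Pairing
        the resulting element of F with v is integral by assumption, and the part of v containing V
        is removed using V V = f.\<close>
      have "rho U (((V * ?w) mod U) * v) \<in> A"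
        using v \<Omega>_F[OF \<Omega>[OF 2(3)]] by (auto simp: dual_def)
      moreover have "rho U (((V * ?w) mod U) * v) = rho U (((V * ?w) mod U) * c) + rho U (q * w)"
      proof -
        have "rho U (((V * ?w) mod U) * ((V * w) mod U)) = rho U (q * w)"
        proof (rule rho_cong)
          have "(((V * ?w) mod U) * ((V * w) mod U)) mod U = ((((V * V) mod U) * ?w) mod U * w) mod U"
            by (metis (no_types, opaque_lifting) mod_mult_eq mod_mult_left_eq mult.assoc mult.left_commute)
          also have "\<dots> = (q mod U * w) mod U"
            unfolding V using q(2) by (simp only: mod_mult_left_eq)
          finally show "(((V * ?w) mod U) * ((V * w) mod U)) mod U = (q * w) mod U"
            by (simp only: mod_mult_left_eq)
        qed
        thus ?thesis by (simp add: *(1) distrib_left rho_add)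
      qed
      moreover have "rho U (q * w) \<in> A" by (rule Omega_Lam[OF *(3) q(1)])
      ultimately have 3: "rho U (((V * ?w) mod U) * c) \<in> A"
        by (metis add_diff_cancel_right' diff_in)
      have "rho U (l' * ((?\<theta> * c) mod U)) = rho U (?\<theta> * (c' * c)) + rho U (((V * ?w) mod U) * c)"
      proof -
        have "rho U (c' * ((?\<theta> * c) mod U)) = rho U (?\<theta> * (c' * c))"
          by (intro rho_cong) (simp add: mod_mult_right_eq mult.left_commute)
        moreover have "rho U (((V * w') mod U) * ((?\<theta> * c) mod U)) = rho U (((V * ?w) mod U) * c)"
        proof (rule rho_cong)
          have "(((V * w') mod U) * ((?\<theta> * c) mod U)) mod U = ((V * w') * (?\<theta> * c)) mod U"
            by (rule mod_mult_eq)
          also have "(V * w') * (?\<theta> * c) = (V * (?\<theta> * w')) * c"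
            by (simp only: mult_ac)
          also have "\<dots> mod U = (((V * ?w) mod U) * c) mod U"
            by (simp add: mod_mult_left_eq mod_mult_right_eq)
          finally show "(((V * w') mod U) * ((?\<theta> * c) mod U)) mod U = (((V * ?w) mod U) * c) mod U" .
        qed
        ultimately show ?thesis by (simp add: 2(1) distrib_right rho_add)
      qed
      moreover have "rho U (?\<theta> * (c' * c)) \<in> A"
        using theta_Pmod_Pmod[OF Uint U(2) l] 2(2) *(2) by (simp add: P_def)
      ultimately show "rho U (l' * ((?\<theta> * c) mod U)) \<in> A" using 3 add_in by simp
    qed
    moreover have "(?\<theta> * v) mod U = (?\<theta> * c) mod U + (V * ((?\<theta> * w) mod U)) mod U"
      by (simp add: *(1) distrib_left poly_mod_add_left mod_mult_right_eq mult.left_commute)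
    ultimately show ?thesis
      unfolding F_def using \<Omega>[OF *(3)] by blast
  qed
  obtain \<phi> where "\<And>i. i < ?d \<Longrightarrow> \<phi> i \<in> F" "det (coef_mat ?d \<phi>) \<noteq> 0"
    "lead_coeff U ^ (?d + 1) / det (coef_mat ?d \<phi>) ^ 2 \<in> A"
    using lattice_det_unit[OF U(1) d(1) latF \<theta>F] by blast
  moreover from latF have "\<forall>p\<in>F. \<forall>i\<ge>?d. coeff p i = 0" by (simp add: lattice_def)
  ultimately show ?thesis
    using that[of \<phi>] FF F_V unfolding M_def by blast
qed

end

section \<open>The substitution \<open>y \<mapsto> y + c x\<close> on binary forms\<close>

text \<open>
  A form of degree \<open>N\<close> is represented by its dehomogenisation at \<open>y = 1\<close>, of degree at most \<open>N\<close>.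
\<close>

definition shear :: "'k :: field \<Rightarrow> nat \<Rightarrow> 'k poly \<Rightarrow> 'k poly" where
  "shear c N p = (\<Sum>i\<le>N. smult (coeff p i) (monom 1 i * [:1, c:] ^ (N - i)))"

lemma poly_eqI_cofinite:
  fixes p q :: "'k :: {idom, ring_char_0} poly"
  assumes "finite S" "\<And>x. x \<notin> S \<Longrightarrow> poly p x = poly q x"
  shows "p = q"
proof (rule ccontr)
  assume "p \<noteq> q"
  hence "finite {x. poly (p - q) x = 0}" by (intro poly_roots_finite) auto
  moreover have "UNIV - S \<subseteq> {x. poly (p - q) x = 0}" using assms by auto
  ultimately have "finite (UNIV :: 'k set)" using assms(1) by (metis finite_Diff2 finite_subset)
  thus False using infinite_UNIV_char_0 by blast
qed

lemma poly_shear: "poly (shear c N p) x = (\<Sum>i\<le>N. coeff p i * x ^ i * (1 + c * x) ^ (N - i))"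
  by (simp add: shear_def poly_sum poly_monom mult_ac)

text \<open>In the affine coordinate the substitution is x / (1 + c x), up to the automorphy factor.
  Identities between shears are verified through this at all points except the pole, which suffices
  over an infinite field.\<close>

lemma poly_shear':
  assumes "degree p \<le> N" "1 + c * x \<noteq> 0"
  shows "poly (shear c N p) x = (1 + c * x) ^ N * poly p (x / (1 + c * x))"
proof -
  have "poly p y = (\<Sum>i\<le>N. coeff p i * y ^ i)" for y
    unfolding poly_altdef using assms(1) by (intro sum.mono_neutral_left) (auto simp: coeff_eq_0)
  hence "(1 + c * x) ^ N * poly p (x / (1 + c * x)) =
      (\<Sum>i\<le>N. (1 + c * x) ^ N * (coeff p i * (x / (1 + c * x)) ^ i))"
    by (simp add: sum_distrib_left)
  also have "\<dots> = (\<Sum>i\<le>N. coeff p i * x ^ i * (1 + c * x) ^ (N - i))"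
  proof (intro sum.cong refl)
    fix i assume "i \<in> {..N}"
    hence "(1 + c * x) ^ N = (1 + c * x) ^ (N - i) * (1 + c * x) ^ i"
      by (simp flip: power_add)
    thus "(1 + c * x) ^ N * (coeff p i * (x / (1 + c * x)) ^ i) = coeff p i * x ^ i * (1 + c * x) ^ (N - i)"
      using assms(2) by (simp add: power_divide)
  qed
  finally show ?thesis by (simp add: poly_shear)
qed

lemma degree_shear: "degree (shear c N p) \<le> N"
  unfolding shear_def
proof (intro degree_sum_le)
  fix i assume i: "i \<in> {..N}"
  have "degree (monom 1 i * [:1, c:] ^ (N - i)) \<le> i + (N - i)"
    by (intro order_trans[OF degree_mult_le] add_mono degree_monom_le order_trans[OF degree_power_le]) auto
  thus "degree (smult (coeff p i) (monom 1 i * [:1, c:] ^ (N - i))) \<le> N"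
    using i degree_smult_le order_trans by fastforce
qed auto

lemma shear_add: "shear c N (p + q) = shear c N p + shear c N q"
  by (simp add: shear_def smult_add_left sum.distrib)

lemma shear_smult: "shear c N (smult a p) = smult a (shear c N p)"
  by (simp add: shear_def smult_sum2)

lemma shear_0 [simp]: "shear c N 0 = 0"
  by (simp add: shear_def)

lemma shear_monom: "i \<le> N \<Longrightarrow> shear c N (monom 1 i) = monom 1 i * [:1, c:] ^ (N - i)"
  by (simp add: shear_def if_distrib[of "\<lambda>x. smult x _"] cong: if_cong)

lemma finite_linear_roots: "finite {x :: 'k :: field. 1 + c * x = 0}"
  using poly_roots_finite[of "[:1, c:]"] by (simp add: mult.commute)

lemma shear_mult:
  fixes p q :: "'k :: field_char_0 poly"
  assumes "degree p \<le> M" "degree q \<le> N"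
  shows "shear c (M + N) (p * q) = shear c M p * shear c N q"
proof (rule poly_eqI_cofinite[OF finite_linear_roots[of c]])
  fix x assume "x \<notin> {x. 1 + c * x = 0}"
  moreover have "degree (p * q) \<le> M + N" using assms degree_mult_le[of p q] by linarith
  ultimately show "poly (shear c (M + N) (p * q)) x = poly (shear c M p * shear c N q) x"
    using assms by (simp add: poly_shear' power_add mult_ac)
qed

lemma shear_shear:
  fixes p :: "'k :: field_char_0 poly"
  assumes "degree p \<le> N"
  shows "shear c N (shear (- c) N p) = p"
proof (rule poly_eqI_cofinite[OF finite_linear_roots[of c]])
  fix x assume "x \<notin> {x. 1 + c * x = 0}"
  hence x: "1 + c * x \<noteq> 0" by simp
  let ?y = "x / (1 + c * x)"
  have e: "1 + - c * ?y = 1 / (1 + c * x)" using x by (simp add: field_simps)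
  have "poly (shear c N (shear (- c) N p)) x = (1 + c * x) ^ N * poly (shear (- c) N p) ?y"
    using degree_shear x by (rule poly_shear')
  also have "poly (shear (- c) N p) ?y = (1 / (1 + c * x)) ^ N * poly p (?y / (1 / (1 + c * x)))"
    using poly_shear'[OF assms, of "- c" ?y] e x by simp
  also have "?y / (1 / (1 + c * x)) = x" using x by simp
  finally show "poly (shear c N (shear (- c) N p)) x = poly p x"
    using x by (simp add: power_divide)
qed

lemma shear_1_1: "shear c 1 1 = [:1, c:]"
  using shear_monom[of 0 1 c] by simp

lemma shear_1_monom: "shear c 1 (monom 1 1) = monom 1 1"
  using shear_monom[of 1 1 c] by simp

text \<open>The pole -1/c of the new coordinate is the point at infinity of the old one, where a
  form of degree N takes its top coefficient as value.\<close>

lemma poly_shear_pole: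
  assumes "c \<noteq> 0"
  shows "poly (shear c N p) (- 1 / c) = coeff p N * (- 1 / c) ^ N"
proof -
  have "poly (shear c N p) (- 1 / c) = (\<Sum>i\<le>N. if i = N then coeff p N * (- 1 / c) ^ N else 0)"
    unfolding poly_shear using assms by (intro sum.cong refl) auto
  thus ?thesis by simp
qed

lemma degree_mult_cancel_le:
  fixes p q :: "'k :: idom poly"
  assumes "degree (p * q) \<le> degree p + N" "p \<noteq> 0"
  shows "degree q \<le> N"
  using assms by (cases "q = 0") (auto simp: degree_mult_eq)

text \<open>
  Reciprocity: the sum of the residues of \<open>p / (U f)\<close> over the zeros of \<open>f\<close> and of \<open>U\<close> vanishes.
  The first residues are computed in the chart \<open>y = 1\<close>, the second ones in a chart in which no
  zero of \<open>U\<close> lies at infinity.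
\<close>

lemma residue_reciprocity:
  fixes f U :: "'k :: field_char_0 poly"
  assumes c: "c \<noteq> 0" and f: "degree f > 0" and U: "degree U > 0"
    and bezout: "a * U + b * shear c (degree f) f = 1"
    and p: "degree p \<le> degree U + degree f - 2"
    and h: "(shear (- c) (degree U) U * h) mod f = p mod f" "degree h < degree f"
    and s: "(shear c (degree f) f * s) mod U = shear c (degree U + degree f - 2) p mod U" "degree s < degree U"
  shows "rho f h = - rho U s"
proof -
  define n d where "n = degree f" and "d = degree U"
  define f' where "f' = shear c n f"
  define U0 where "U0 = shear (- c) d U"
  have n: "n > 0" and d: "d > 0" using f U by (simp_all add: n_def d_def)
  have f0: "f \<noteq> 0" and U00: "U \<noteq> 0" using f U by auto
  have df': "degree f' \<le> n" and dU0: "degree U0 \<le> d" by (auto simp: f'_def U0_def degree_shear)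
  have hd: "degree h \<le> n - 1" and sd: "degree s \<le> d - 1" using h(2) s(2) by (auto simp: n_def d_def)
  define s1 where "s1 = (p - U0 * h) div f"
  have "f dvd (p - U0 * h)"
    using h(1) by (metis U0_def d_def mod_eq_dvd_iff)
  hence s1: "p = U0 * h + f * s1" by (simp add: s1_def)
  have "degree s1 \<le> d - 1"
  proof (rule degree_mult_cancel_le[OF _ f0])
    have "degree (U0 * h) \<le> d + (n - 1)"
      using dU0 hd degree_mult_le[of U0 h] by linarith
    hence "degree (p - U0 * h) \<le> n + (d - 1)"
      using p n d by (intro degree_diff_le) (auto simp: n_def d_def)
    thus "degree (f * s1) \<le> degree f + (d - 1)"
      using s1 by (simp add: n_def)
  qed
  define M where "M = shear c (d + n - 2) p"
  have dM: "degree M \<le> d + n - 2" by (simp add: M_def degree_shear)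
  define h1 where "h1 = (M - f' * s) div U"
  have "U dvd (M - f' * s)"
    using s(1) by (metis M_def d_def f'_def mod_eq_dvd_iff n_def)
  hence h1: "M = f' * s + U * h1" by (simp add: h1_def)
  have "degree (shear c (n - 1) h) \<le> n - 1" "degree (shear c (d - 1) s1) \<le> d - 1"
    by (rule degree_shear)+
  note sh = this
  \<comment> \<open>Sheared in degree d + n - 1 instead of d + n - 2, p acquires the factor 1 + c X,
    the image of y. That degree fits the products U0 h and f s1, whose second factors have degree at
    most n - 1 and d - 1.\<close>
  have "shear c ((d + n - 2) + 1) (p * 1) = M * [:1, c:]"
    unfolding M_def using p by (subst shear_mult) (auto simp: shear_1_1[simplified] n_def d_def)
  hence "[:1, c:] * M = shear c (d + n - 1) p"
    using n d by (simp add: Suc_diff_Suc numeral_2_eq_2 mult.commute del: mult_pCons_left mult_pCons_right)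
  also have "\<dots> = shear c (d + (n - 1)) (U0 * h) + shear c (n + (d - 1)) (f * s1)"
  proof -
    have "d + (n - 1) = d + n - 1" "n + (d - 1) = d + n - 1" using n d by auto
    thus ?thesis unfolding s1 shear_add by simp
  qed
  also have "shear c (d + (n - 1)) (U0 * h) = U * shear c (n - 1) h"
    using dU0 hd by (subst shear_mult) (auto simp: U0_def shear_shear d_def)
  also have "shear c (n + (d - 1)) (f * s1) = f' * shear c (d - 1) s1"
    using \<open>degree s1 \<le> d - 1\<close> by (subst shear_mult) (auto simp: f'_def n_def)
  finally have "U * ([:1, c:] * h1 - shear c (n - 1) h) = f' * (shear c (d - 1) s1 - [:1, c:] * s)"
    unfolding h1 by (simp add: algebra_simps)
  note key = this
  hence "U dvd f' * (shear c (d - 1) s1 - [:1, c:] * s)" by (metis dvd_triv_left)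
  moreover define E where "E = shear c (d - 1) s1 - [:1, c:] * s"
  ultimately have "U dvd f' * E" by simp
  have "E = (a * U + b * f') * E"
    using bezout by (simp add: f'_def n_def)
  also have "\<dots> = U * (a * E) + b * (f' * E)"
    by (simp add: algebra_simps)
  also have "U dvd \<dots>" using \<open>U dvd f' * E\<close> by simp
  finally obtain k where "E = U * k" by (rule dvdE)
  hence k: "shear c (d - 1) s1 - [:1, c:] * s = U * k" by (simp only: E_def)
  have "degree k \<le> 0"
  proof (rule degree_mult_cancel_le[OF _ U00])
    have "degree ([:1, c:] * s) \<le> 1 + (d - 1)"
      using sd degree_mult_le[of "[:1, c:]" s] c by (simp del: mult_pCons_left)
    hence "degree (shear c (d - 1) s1 - [:1, c:] * s) \<le> d"
      using sh d by (intro degree_diff_le) auto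
    thus "degree (U * k) \<le> degree U + 0" using k by (simp add: d_def)
  qed
  \<comment> \<open>The divisions with remainder in the two charts differ by this constant only;
    both residues turn out to be \<kappa> / c up to sign.\<close>
  then obtain \<kappa> where \<kappa>: "k = [:\<kappa>:]" using degree0_coeffs[of k] by auto
  have E1: "shear c (d - 1) s1 - [:1, c:] * s = smult \<kappa> U" using k \<kappa> by simp
  have "U * ([:1, c:] * h1 - shear c (n - 1) h) = U * (smult \<kappa> f')"
    using key unfolding E1 by (simp only: mult_smult_right mult.commute)
  hence E2: "[:1, c:] * h1 - shear c (n - 1) h = smult \<kappa> f'"
    unfolding mult_left_cancel[OF U00] .
  have "coeff (shear c (d - 1) s1 - [:1, c:] * s) d = - (c * coeff s (d - 1))"
  proof -
    have "coeff (shear c (d - 1) s1) d = 0" using sh d by (intro coeff_eq_0) auto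
    moreover have "coeff s d = 0" using sd d by (intro coeff_eq_0) auto
    ultimately show ?thesis using d by (cases d) auto
  qed
  hence "- (c * coeff s (d - 1)) = \<kappa> * lead_coeff U" unfolding E1 by (simp add: d_def)
  hence cs: "c * coeff s (d - 1) = - (\<kappa> * lead_coeff U)" by (metis minus_minus)
  have alg: "x / u = - k / c" if "c * x = - (k * u)" "u \<noteq> 0" for x u k :: 'k
    using that c by (simp add: field_simps)
  have 1: "coeff s (d - 1) / lead_coeff U = - \<kappa> / c"
    by (rule alg[OF cs]) (use U00 in simp)
  \<comment> \<open>At this point 1 + c X vanishes, which removes h1, and the shears reduce to top
    coefficients: the residue of h becomes visible.\<close>
  define z where "z = - 1 / c"
  have z: "poly [:1, c:] z = 0" "z \<noteq> 0" using c by (auto simp: z_def)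
  have "poly ([:1, c:] * h1 - shear c (n - 1) h) z = poly (smult \<kappa> f') z"
    using E2 by simp
  hence "- (coeff h (n - 1) * z ^ (n - 1)) = \<kappa> * (coeff f n * z ^ n)"
    unfolding f'_def poly_diff poly_mult poly_smult z(1)
    using poly_shear_pole[OF c, folded z_def] by simp
  also have "z ^ n = z ^ (n - 1) * z"
    using n by (metis Suc_diff_1 power_Suc2)
  finally have "- coeff h (n - 1) * z ^ (n - 1) = (\<kappa> * coeff f n * z) * z ^ (n - 1)"
    by (simp only: mult_ac minus_mult_left)
  hence "- coeff h (n - 1) = \<kappa> * coeff f n * z"
    using z(2) by (metis mult_right_cancel power_not_zero)
  hence "coeff h (n - 1) = \<kappa> * coeff f n / c"
    by (simp add: z_def)
  moreover have "coeff f n \<noteq> 0" using f0 by (simp add: n_def)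
  ultimately have 2: "coeff h (n - 1) / lead_coeff f = \<kappa> / c" by (simp add: n_def)
  show ?thesis
    using 1 2 h(2) s(2) by (simp add: rho_less n_def d_def)
qed

section \<open>Passage to the algebraic closure and reciprocity of norms\<close>

lemma map_poly_to_ac_add: "map_poly to_ac (p + q) = map_poly to_ac p + map_poly to_ac q"
  by (rule poly_eqI) (simp add: coeff_map_poly)

lemma map_poly_to_ac_smult: "map_poly to_ac (smult a p) = smult (to_ac a) (map_poly to_ac p)"
  by (rule poly_eqI) (simp add: coeff_map_poly)

lemma map_poly_to_ac_mult: "map_poly to_ac (p * q) = map_poly to_ac p * map_poly to_ac q"
  by (rule poly_eqI) (simp add: coeff_map_poly coeff_mult to_ac_sum)

lemma map_poly_to_ac_sum: "map_poly to_ac (\<Sum>i\<in>I. p i) = (\<Sum>i\<in>I. map_poly to_ac (p i))"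
  by (induction I rule: infinite_finite_induct) (auto simp: map_poly_to_ac_add)

lemma map_poly_to_ac_power: "map_poly to_ac (p ^ n) = map_poly to_ac p ^ n"
  by (induction n) (auto simp: map_poly_to_ac_mult)

lemma map_poly_to_ac_monom: "map_poly to_ac (monom a n) = monom (to_ac a) n"
  by (rule poly_eqI) (simp add: coeff_map_poly)

lemma map_poly_to_ac_pCons: "map_poly to_ac (pCons a p) = pCons (to_ac a) (map_poly to_ac p)"
  by (rule poly_eqI) (simp add: coeff_map_poly coeff_pCons split: nat.split)

lemma map_poly_shear:
  "map_poly to_ac (shear c N p) = shear (to_ac c) N (map_poly to_ac p)"
  by (simp add: shear_def map_poly_to_ac_sum map_poly_to_ac_smult map_poly_to_ac_mult
      map_poly_to_ac_power map_poly_to_ac_monom map_poly_to_ac_pCons coeff_map_poly)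

lemma shear_prod_mset:
  fixes p :: "'b \<Rightarrow> 'k :: field_char_0 poly"
  assumes "\<And>x. x \<in># A \<Longrightarrow> degree (p x) \<le> 1"
  shows "shear c (size A) (\<Prod>x\<in>#A. p x) = (\<Prod>x\<in>#A. shear c 1 (p x))"
proof -
  have "degree (\<Prod>x\<in>#A. p x) \<le> size A \<and> shear c (size A) (\<Prod>x\<in>#A. p x) = (\<Prod>x\<in>#A. shear c 1 (p x))"
    using assms
  proof (induction A)
    case empty
    show ?case using shear_monom[of 0 0 c] by simp
  next
    case (add x A)
    have IH: "degree (\<Prod>x\<in>#A. p x) \<le> size A" "shear c (size A) (\<Prod>x\<in>#A. p x) = (\<Prod>x\<in>#A. shear c 1 (p x))"
      and x: "degree (p x) \<le> 1" using add by auto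
    have "degree (p x * (\<Prod>x\<in>#A. p x)) \<le> 1 + size A"
      using degree_mult_le[of "p x"] IH(1) x by (meson add_mono order_trans)
    moreover have "shear c (1 + size A) (p x * (\<Prod>x\<in>#A. p x)) = shear c 1 (p x) * shear c (size A) (\<Prod>x\<in>#A. p x)"
      by (rule shear_mult[OF x IH(1)])
    ultimately show ?case using IH(2) by simp
  qed
  thus ?thesis by simp
qed

lemma map_poly_coef_mat: "map_mat to_ac (coef_mat n b) = coef_mat n (\<lambda>j. map_poly to_ac (b j))"
  by (intro eq_matI) (auto simp: coef_mat_def coeff_map_poly)

lemma map_nrm: "nrm (map_poly to_ac f) (map_poly to_ac a) = to_ac (nrm f a)"
proof -
  interpret to_ac: field_hom to_ac by unfold_locales auto
  have "map_mat to_ac (mul_mat f a) = mul_mat (map_poly to_ac f) (map_poly to_ac a)"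
    by (simp add: mul_mat_def map_poly_coef_mat hom_distribs map_poly_to_ac_monom map_poly_to_ac_mult)
  thus ?thesis unfolding nrm_def by (metis to_ac.hom_det)
qed

text \<open>Both sides are the resultant of the two forms. Over the closure U splits into linear
  forms; the left side is a product of values of f at them, and \<open>nrm_linear_form\<close> gives
  the same values on the right. The even degree of f absorbs the signs.\<close>

lemma nrm_reciprocity:
  fixes f U :: "'k :: field_char_0 poly"
  assumes f: "degree f > 0" "even (degree f)" and U: "degree U > 0"
  shows "lead_coeff U ^ degree f * nrm U (shear c (degree f) f) =
    lead_coeff f ^ degree U * nrm f (shear (- c) (degree U) U)"
proof -
  interpret to_ac: field_hom to_ac by unfold_locales auto
  let ?f = "map_poly to_ac f" and ?U = "map_poly to_ac U" and ?c = "to_ac c"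
  have df: "degree ?f = degree f" and dU: "degree ?U = degree U" by simp_all
  have lf: "lead_coeff ?f = to_ac (lead_coeff f)" and lU: "lead_coeff ?U = to_ac (lead_coeff U)" by simp_all
  have U0: "U \<noteq> 0" and f0: "f \<noteq> 0" using U f by auto
  hence "?U \<noteq> 0" by simp
  then obtain A where A: "size A = degree ?U" "?U = smult (lead_coeff ?U) (\<Prod>x\<in>#A. [:- x, 1:])"
    using alg_closed_imp_factorization by blast
  have "A \<noteq> {#}" using A(1) U dU by auto
  have 1: "nrm ?U (shear ?c (degree f) ?f) = (\<Prod>x\<in>#A. poly (shear ?c (degree f) ?f) x)"
    by (rule nrm_eq_prod_roots[OF A(2)]) (use U0 \<open>A \<noteq> {#}\<close> in auto)
  have sh: "shear (- ?c) 1 [:- x, 1:] = [:- x, - (- (1 + ?c * x)):]" for x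
    by (simp add: shear_def monom_altdef algebra_simps)
  have lin: "nrm ?f [:- x, - (- (1 + ?c * x)):] = poly (shear ?c (degree f) ?f) x / lead_coeff ?f" for x
  proof -
    have "nrm ?f [:- x, - (- (1 + ?c * x)):] =
        (\<Sum>i\<le>degree ?f. coeff ?f i * (- x) ^ i * (- (1 + ?c * x)) ^ (degree ?f - i)) / lead_coeff ?f"
      using f df by (intro nrm_linear_form) simp
    also have "(\<Sum>i\<le>degree ?f. coeff ?f i * (- x) ^ i * (- (1 + ?c * x)) ^ (degree ?f - i)) =
        (\<Sum>i\<le>degree f. coeff ?f i * x ^ i * (1 + ?c * x) ^ (degree f - i))"
      unfolding df
    proof (intro sum.cong refl)
      fix i assume i: "i \<in> {..degree f}"
      have "(- x) ^ i * (- (1 + ?c * x)) ^ (degree f - i) =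
          ((-1) ^ i * (-1) ^ (degree f - i)) * (x ^ i * (1 + ?c * x) ^ (degree f - i))"
        unfolding power_minus[of x] power_minus[of "1 + ?c * x"] by (simp only: mult_ac)
      also have "(-1 :: 'k alg_closure) ^ i * (-1) ^ (degree f - i) = 1"
        using i f(2) by (simp flip: power_add)
      finally show "coeff ?f i * (- x) ^ i * (- (1 + ?c * x)) ^ (degree f - i) =
          coeff ?f i * x ^ i * (1 + ?c * x) ^ (degree f - i)" by (simp add: mult.assoc)
    qed
    finally show ?thesis by (simp add: poly_shear)
  qed
  have "shear (- ?c) (size A) ?U = smult (lead_coeff ?U) (\<Prod>x\<in>#A. shear (- ?c) 1 [:- x, 1:])"
    by (subst A(2), subst shear_smult, subst shear_prod_mset) auto
  hence "nrm ?f (shear (- ?c) (size A) ?U) =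
      nrm ?f ([:lead_coeff ?U:] * (\<Prod>x\<in>#A. [:- x, - (- (1 + ?c * x)):]))"
    unfolding sh by simp
  also have "\<dots> = lead_coeff ?U ^ degree f * (\<Prod>x\<in>#A. poly (shear ?c (degree f) ?f) x / lead_coeff ?f)"
    using f by (simp only: nrm_mult nrm_const nrm_prod_mset df lin)
  also have "(\<Prod>x\<in>#A. poly (shear ?c (degree f) ?f) x / lead_coeff ?f) =
      (\<Prod>x\<in>#A. poly (shear ?c (degree f) ?f) x) / lead_coeff ?f ^ size A"
    by (induction A) auto
  finally have "nrm ?f (shear (- ?c) (size A) ?U) =
      lead_coeff ?U ^ degree f * (nrm ?U (shear ?c (degree f) ?f) / lead_coeff ?f ^ size A)"
    by (simp add: 1)
  moreover have "shear (- ?c) (size A) ?U = map_poly to_ac (shear (- c) (degree U) U)"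
    by (simp only: map_poly_shear A(1) dU to_ac_minus)
  moreover have "shear ?c (degree f) ?f = map_poly to_ac (shear c (degree f) f)"
    by (simp only: map_poly_shear)
  ultimately have "to_ac (nrm f (shear (- c) (degree U) U)) =
      to_ac (lead_coeff U ^ degree f * (nrm U (shear c (degree f) f) / lead_coeff f ^ degree U))"
    by (simp only: map_nrm A(1) dU df lf lU to_ac_mult to_ac_divide to_ac_power coeff_map_poly[where f = to_ac, OF to_ac_0])
  hence "nrm f (shear (- c) (degree U) U) =
      lead_coeff U ^ degree f * (nrm U (shear c (degree f) f) / lead_coeff f ^ degree U)"
    by (simp only: to_ac_eq_iff)
  thus ?thesis using f0 by (simp add: field_simps)
qed

section \<open>The integral representative\<close>

lemma coef_mat_lincomb:
  fixes b :: "nat \<Rightarrow> 'k :: comm_ring_1 poly"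
  assumes B: "B \<in> carrier_mat N N"
  shows "coef_mat N (\<lambda>j. \<Sum>i<N. smult (B $$ (i, j)) (b i)) = coef_mat N b * B"
  using B by (intro eq_matI)
    (auto simp: coef_mat_def scalar_prod_def coeff_sum lessThan_atLeast0 mult.commute)

lemma prod_list_diag_mat:
  "A \<in> carrier_mat n n \<Longrightarrow> prod_list (diag_mat A) = (\<Prod>i<n. A $$ (i, i))"
  by (simp add: diag_mat_def prod.list_conv_set_nth lessThan_atLeast0)

text \<open>On polynomials of degree at most m the substitution is unipotent triangular, since X^i
  (1 + c X)^(m-i) begins with X^i.\<close>

lemma det_shear:
  fixes b :: "nat \<Rightarrow> 'k :: field poly"
  assumes b: "\<And>j. j \<le> m \<Longrightarrow> degree (b j) \<le> m"
  shows "det (coef_mat (Suc m) (\<lambda>j. shear c m (b j))) = det (coef_mat (Suc m) b)"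
proof -
  define T where "T = (\<lambda>i. monom 1 i * [:1, c:] ^ (m - i))"
  have "coef_mat (Suc m) (\<lambda>j. shear c m (b j)) =
      coef_mat (Suc m) (\<lambda>j. \<Sum>i<Suc m. smult (coef_mat (Suc m) b $$ (i, j)) (T i))"
    by (intro eq_matI) (auto simp: coef_mat_def shear_def T_def coeff_sum lessThan_Suc_atMost)
  also have "\<dots> = coef_mat (Suc m) T * coef_mat (Suc m) b"
    by (rule coef_mat_lincomb) simp
  also have "det \<dots> = det (coef_mat (Suc m) T) * det (coef_mat (Suc m) b)"
    by (rule det_mult) auto
  also have "det (coef_mat (Suc m) T) = prod_list (diag_mat (coef_mat (Suc m) T))"
    by (rule det_lower_triangular[where n = "Suc m"]) (auto simp: coef_mat_def T_def coeff_monom_mult)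
  also have "\<dots> = (\<Prod>i<Suc m. 1)"
  proof (subst prod_list_diag_mat[of _ "Suc m"])
    show "(\<Prod>i<Suc m. coef_mat (Suc m) T $$ (i, i)) = (\<Prod>i<Suc m. 1)"
    proof (intro prod.cong refl)
      fix i assume "i \<in> {..<Suc m}"
      have "coeff ([:1, c:] ^ k) 0 = 1" for k by (induction k) (auto simp: coeff_mult)
      thus "coef_mat (Suc m) T $$ (i, i) = 1"
        using \<open>i \<in> {..<Suc m}\<close> by (simp add: coef_mat_def T_def coeff_monom_mult)
    qed
  qed simp
  finally show ?thesis by simp
qed

section \<open>Block determinants and division by U; unimodular functionals\<close>

lemma det_block_lower:
  fixes B :: "'k :: idom mat"
  assumes B: "B \<in> carrier_mat (p + q) (p + q)"
    and z: "\<And>i j. i < p \<Longrightarrow> p \<le> j \<Longrightarrow> j < p + q \<Longrightarrow> B $$ (i, j) = 0"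
  shows "det B = det (mat p p (\<lambda>(i, j). B $$ (i, j))) * det (mat q q (\<lambda>(i, j). B $$ (p + i, p + j)))"
proof -
  have "B = four_block_mat (mat p p (\<lambda>(i, j). B $$ (i, j))) (0\<^sub>m p q)
      (mat q p (\<lambda>(i, j). B $$ (p + i, j))) (mat q q (\<lambda>(i, j). B $$ (p + i, p + j)))"
    using B z by (intro eq_matI) auto
  also have "det \<dots> = det (mat p p (\<lambda>(i, j). B $$ (i, j))) * det (mat q q (\<lambda>(i, j). B $$ (p + i, p + j)))"
    by (rule det_four_block_mat_upper_right_zero) auto
  finally show ?thesis .
qed

lemma det_block_upper:
  fixes B :: "'k :: idom mat"
  assumes B: "B \<in> carrier_mat (p + q) (p + q)"
    and z: "\<And>i j. p \<le> i \<Longrightarrow> i < p + q \<Longrightarrow> j < p \<Longrightarrow> B $$ (i, j) = 0"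
  shows "det B = det (mat p p (\<lambda>(i, j). B $$ (i, j))) * det (mat q q (\<lambda>(i, j). B $$ (p + i, p + j)))"
proof -
  have "B = four_block_mat (mat p p (\<lambda>(i, j). B $$ (i, j))) (mat p q (\<lambda>(i, j). B $$ (i, p + j)))
      (0\<^sub>m q p) (mat q q (\<lambda>(i, j). B $$ (p + i, p + j)))"
    using B z by (intro eq_matI) auto
  also have "det \<dots> = det (mat p p (\<lambda>(i, j). B $$ (i, j))) * det (mat q q (\<lambda>(i, j). B $$ (p + i, p + j)))"
    by (rule det_four_block_mat_lower_left_zero) auto
  finally show ?thesis .
qed

text \<open>The comparison basis is 1, ..., X^(d-1), U, U X, ..., U X^e, which is triangular with
  diagonal entries 1 and lead(U). In it the coordinates of r_j are the coefficients of
  \<open>r j mod U\<close> followed by those of \<open>r j div U\<close>.\<close>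

lemma det_remainders_multiples:
  fixes U :: "'k :: field poly"
  assumes U: "degree U = d" "d > 0" and r: "\<And>j. j < d \<Longrightarrow> degree (r j) \<le> d + e"
    and rU: "\<And>k. k \<le> e \<Longrightarrow> r (d + k) = U * monom 1 k"
  shows "det (coef_mat (Suc (d + e)) r) = lead_coeff U ^ Suc e * det (coef_mat d (\<lambda>j. r j mod U))"
proof -
  let ?N = "Suc (d + e)"
  define bb where "bb = (\<lambda>i. if i < d then monom 1 i else U * monom 1 (i - d))"
  define B where "B = mat ?N ?N (\<lambda>(i, j).
    if i < d then (if j < d then coeff (r j mod U) i else 0)
    else (if j < d then coeff (r j div U) (i - d) else if i = j then 1 else 0))"
  have B: "B \<in> carrier_mat ?N ?N" by (simp add: B_def)
  have U0: "U \<noteq> 0" using U by auto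
  have eq: "(\<Sum>i<?N. smult (B $$ (i, j)) (bb i)) = r j" if j: "j < ?N" for j
  proof -
    have split: "(\<Sum>i<?N. g i) = (\<Sum>i<d. g i) + (\<Sum>k<Suc e. g (d + k))" for g :: "nat \<Rightarrow> 'k poly"
    proof -
      have "(\<Sum>i<d + m. g i) = (\<Sum>i<d. g i) + (\<Sum>k<m. g (d + k))" for m
        by (induction m) (auto simp: add.assoc)
      from this[of "Suc e"] show ?thesis by simp
    qed
    show ?thesis
    proof (cases "j < d")
      case True
      have dq: "degree (r j div U) \<le> e"
      proof (rule degree_mult_cancel_le[OF _ U0])
        have "degree (r j mod U) \<le> d + e"
          using U by (intro degree_le) (auto intro: coeff_mod_eq_0)
        hence "degree (r j - r j mod U) \<le> d + e"
          using r[OF True] by (intro degree_diff_le)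
        thus "degree (U * (r j div U)) \<le> degree U + e"
          by (simp add: minus_mod_eq_mult_div U)
      qed
      have "(\<Sum>i<d. smult (B $$ (i, j)) (bb i)) = (\<Sum>i<d. monom (coeff (r j mod U) i) i)"
        using True by (intro sum.cong refl) (auto simp: B_def bb_def smult_monom)
      also have "\<dots> = r j mod U"
        using coeff_mod_eq_0[of U] U by (intro poly_eq_sum_monom[symmetric]) auto
      finally have 1: "(\<Sum>i<d. smult (B $$ (i, j)) (bb i)) = r j mod U" .
      have "(\<Sum>k<Suc e. smult (B $$ (d + k, j)) (bb (d + k))) = (\<Sum>k<Suc e. U * monom (coeff (r j div U) k) k)"
        using True by (intro sum.cong refl) (auto simp: B_def bb_def smult_monom simp flip: mult_smult_right)
      also have "\<dots> = U * (r j div U)"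
        unfolding sum_distrib_left[symmetric]
        using dq by (intro arg_cong2[where f = times] refl poly_eq_sum_monom[symmetric] coeff_eq_0) auto
      finally show ?thesis unfolding split 1 by simp
    next
      case False
      define k where "k = j - d"
      have k: "j = d + k" "k \<le> e" using False j by (auto simp: k_def)
      have "(\<Sum>i<d. smult (B $$ (i, j)) (bb i)) = 0"
        using False j by (intro sum.neutral) (auto simp: B_def)
      moreover have "(\<Sum>l<Suc e. smult (B $$ (d + l, j)) (bb (d + l))) = (\<Sum>l<Suc e. if l = k then U * monom 1 k else 0)"
        using k by (intro sum.cong refl) (auto simp: B_def bb_def)
      ultimately show ?thesis unfolding split using k rU by simp
    qed
  qed
  have "coef_mat ?N r = coef_mat ?N (\<lambda>j. \<Sum>i<?N. smult (B $$ (i, j)) (bb i))"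
    by (intro eq_matI) (simp_all add: coef_mat_def eq del: sum.lessThan_Suc)
  also have "\<dots> = coef_mat ?N bb * B" by (rule coef_mat_lincomb[OF B])
  also have "det \<dots> = det (coef_mat ?N bb) * det B" by (rule det_mult[OF _ B]) simp
  also have "det B = det (mat d d (\<lambda>(i, j). B $$ (i, j))) * det (mat (Suc e) (Suc e) (\<lambda>(i, j). B $$ (d + i, d + j)))"
    by (rule det_block_lower) (auto simp: B_def)
  also have "mat d d (\<lambda>(i, j). B $$ (i, j)) = coef_mat d (\<lambda>j. r j mod U)"
    by (intro eq_matI) (auto simp: B_def coef_mat_def)
  also have "mat (Suc e) (Suc e) (\<lambda>(i, j). B $$ (d + i, d + j)) = 1\<^sub>m (Suc e)"
    by (intro eq_matI) (auto simp: B_def)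
  also have "det (coef_mat ?N bb) = prod_list (diag_mat (coef_mat ?N bb))"
  proof (rule det_upper_triangular[where n = ?N])
    show "upper_triangular (coef_mat ?N bb)"
      using U by (auto simp: upper_triangular_def coef_mat_def bb_def mult.commute[of U] coeff_monom_mult
          intro!: coeff_eq_0)
  qed simp
  also have "\<dots> = (\<Prod>i<?N. if i < d then 1 else lead_coeff U)"
    unfolding prod_list_diag_mat[OF coef_mat_carrier]
    using U by (intro prod.cong refl) (auto simp: coef_mat_def bb_def mult.commute[of U] coeff_monom_mult)
  also have "\<dots> = lead_coeff U ^ Suc e"
  proof -
    have "(\<Prod>i<d + k. if i < d then 1 else lead_coeff U) =
        (\<Prod>i<d. if i < d then 1 else lead_coeff U) * lead_coeff U ^ k" for k
      by (induction k) (auto simp: mult_ac)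
    from this[of "Suc e"] show ?thesis by simp
  qed
  finally show ?thesis by simp
qed

context pid_subring
begin

lemma det_in:
  assumes "B \<in> carrier_mat d d" "\<And>i j. i < d \<Longrightarrow> j < d \<Longrightarrow> B $$ (i, j) \<in> A"
  shows "det B \<in> A"
proof -
  have s: "(signof p :: 'k) \<in> A" for p :: "nat \<Rightarrow> nat"
    by (auto simp: sign_def intro: uminus_in)
  show ?thesis
    unfolding det_def'[OF assms(1)]
    by (intro sum_in mult_in prod_in s assms(2)) (auto simp: permutes_in_image)
qed

text \<open>
  As \<open>U\<close> is primitive, the multiples \<open>U, X U, \<dots>, X\<^sup>q\<^sup>-\<^sup>1 U\<close> generate a saturated submodule, so
  there are functionals whose values on them form a unimodular matrix.
\<close>

lemma unimodular_functionals:
  assumes U: "primp U" and n: "degree U + q \<le> n"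
  obtains a where "\<And>k i. a k i \<in> A"
    "det (mat q q (\<lambda>(j, k). \<Sum>i<n. a k i * coeff (monom 1 j * U) i)) \<noteq> 0"
    "inverse (det (mat q q (\<lambda>(j, k). \<Sum>i<n. a k i * coeff (monom 1 j * U) i))) \<in> A"
proof -
  have Uint: "intp U" and U0: "U \<noteq> 0" using U by (auto simp: primp_def)
  \<comment> \<open>\<open>col i\<close> stores the coefficients of X^i in U, X U, ..., X^(q-1) U as
    a polynomial in an auxiliary variable. A functional with coefficients in A then becomes an
    element of the module S spanned by these columns.\<close>
  define col where "col = (\<lambda>i. \<Sum>j<q. monom (coeff (monom 1 j * U) i) j)"
  have col: "coeff (col i) j = (if j < q then coeff (monom 1 j * U) i else 0)" for i j
    by (auto simp: col_def coeff_sum)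
  define S where "S = {\<Sum>i<n. smult (s i) (col i) | s. \<forall>i. s i \<in> A}"
  have colS: "col i \<in> S" if "i < n" for i
  proof -
    have "col i = (\<Sum>j<n. smult (if j = i then 1 else 0) (col j))"
      using that by (simp add: if_distrib[of "\<lambda>x. smult x _"] cong: if_cong)
    thus ?thesis unfolding S_def by (auto intro!: exI[of _ "\<lambda>j. if j = i then 1 else 0"])
  qed
  have S: "amod S"
    unfolding amod_def
  proof (intro conjI ballI)
    show "0 \<in> S" unfolding S_def by (auto intro!: exI[of _ "\<lambda>_. 0"])
    fix x y assume "x \<in> S" "y \<in> S"
    then obtain s t where st: "\<forall>i. s i \<in> A" "\<forall>i. t i \<in> A" "x = (\<Sum>i<n. smult (s i) (col i))" "y = (\<Sum>i<n. smult (t i) (col i))"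
      by (auto simp: S_def)
    have "x + y = (\<Sum>i<n. smult (s i + t i) (col i))"
      by (simp add: st smult_add_left sum.distrib)
    thus "x + y \<in> S" unfolding S_def using st add_in by (auto intro!: exI[of _ "\<lambda>i. s i + t i"])
  next
    fix c x assume c: "c \<in> A" and "x \<in> S"
    then obtain s where st: "\<forall>i. s i \<in> A" "x = (\<Sum>i<n. smult (s i) (col i))"
      by (auto simp: S_def)
    have "smult c x = (\<Sum>i<n. smult (c * s i) (col i))"
      by (simp add: st smult_sum2)
    thus "smult c x \<in> S" unfolding S_def using st c mult_in by (auto intro!: exI[of _ "\<lambda>i. c * s i"])
  qed
  \<comment> \<open>The lowest nonzero coefficient of U makes the columns triangular: in column i0 +
    k the entries after position k vanish. This gives S full rank.\<close>
  define i0 where "i0 = (LEAST i. coeff U i \<noteq> 0)"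
  have i0: "coeff U i0 \<noteq> 0" "\<And>i. i < i0 \<Longrightarrow> coeff U i = 0"
    unfolding i0_def using U0 by (metis (mono_tags, lifting) LeastI leading_coeff_0_iff, metis not_less_Least)
  hence i0d: "i0 \<le> degree U" by (metis coeff_eq_0 not_less)
  have full: "\<exists>M\<in>A. M \<noteq> 0 \<and> (\<forall>j<k. monom M j \<in> S)" if "k \<le> q" for k
    using that
  proof (induction k)
    case 0
    show ?case by (auto intro!: bexI[of _ 1])
  next
    case (Suc k)
    then obtain M where M: "M \<in> A" "M \<noteq> 0" "\<And>j. j < k \<Longrightarrow> monom M j \<in> S" by auto
    let ?c = "coeff U i0"
    have ck: "smult M (col (i0 + k)) = monom (M * ?c) k + (\<Sum>j<k. smult (coeff U (i0 + k - j)) (monom M j))"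
    proof (rule poly_eqI)
      fix j
      show "coeff (smult M (col (i0 + k))) j =
          coeff (monom (M * ?c) k + (\<Sum>j<k. smult (coeff U (i0 + k - j)) (monom M j))) j"
        using Suc.prems i0(2)[of "i0 + k - j"]
        by (cases j k rule: linorder_cases) (auto simp: col coeff_monom_mult coeff_sum smult_monom)
    qed
    have "smult M (col (i0 + k)) \<in> S"
      using Suc.prems n i0d by (intro amod_smult[OF S M(1)] colS) auto
    moreover have "(\<Sum>j<k. smult (coeff U (i0 + k - j)) (monom M j)) \<in> S"
      using Uint M(3) by (intro amod_sum[OF S] amod_smult[OF S]) (auto simp: intp_def)
    ultimately have "monom (M * ?c) k \<in> S"
      using amod_diff[OF S] unfolding ck by fastforce
    moreover have "monom (M * ?c) j \<in> S" if "j < k" for j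
    proof -
      have "smult ?c (monom M j) \<in> S"
        by (rule amod_smult[OF S _ M(3)[OF that]]) (use Uint in \<open>simp add: intp_def\<close>)
      thus ?thesis by (simp add: smult_monom mult.commute)
    qed
    ultimately show ?case
      using M i0(1) Uint by (intro bexI[of _ "M * ?c"]) (auto simp: less_Suc_eq intp_def intro: mult_in)
  qed
  have lat: "lattice q S"
    unfolding lattice_def
  proof (intro conjI)
    show "\<forall>p\<in>S. \<forall>i\<ge>q. coeff p i = 0" by (auto simp: S_def coeff_sum col)
    have "intp (col i)" for i
      unfolding col_def using intp_mult[OF intp_monom[OF one_in] Uint]
      by (intro intp_sum intp_monom) (auto simp: intp_def)
    hence "intp p" if "p \<in> S" for p using that by (auto simp: S_def intro!: intp_sum intp_smult)
    thus "\<exists>N\<in>A. N \<noteq> 0 \<and> (\<forall>p\<in>S. intp (smult N p))" by (intro bexI[of _ 1]) auto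
  qed (use S full in auto)
  obtain b where b: "triangular q b" "\<And>i. i < q \<Longrightarrow> b i \<in> S"
    "\<And>p. p \<in> S \<Longrightarrow> \<exists>c. (\<forall>i. c i \<in> A) \<and> p = (\<Sum>i<q. smult (c i) (b i))"
    using lattice_basis[OF lat] by blast
  have "\<forall>k. \<exists>s. k < q \<longrightarrow> (\<forall>i. s i \<in> A) \<and> b k = (\<Sum>i<n. smult (s i) (col i))"
    using b(2) unfolding S_def by blast
  then obtain s where s: "\<And>k. k < q \<Longrightarrow> (\<forall>i. s k i \<in> A) \<and> b k = (\<Sum>i<n. smult (s k i) (col i))"
    by metis
  define a where "a = (\<lambda>k i. if k < q then s k i else 0)"
  have a: "a k i \<in> A" for k i using s by (auto simp: a_def)
  define N where "N = mat q q (\<lambda>(j, k). \<Sum>i<n. a k i * coeff (monom 1 j * U) i)"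
  have N: "N \<in> carrier_mat q q" by (simp add: N_def)
  have "N = coef_mat q b"
  proof (intro eq_matI)
    fix j k assume "j < dim_row (coef_mat q b)" "k < dim_col (coef_mat q b)"
    hence jk: "j < q" "k < q" by auto
    hence "coeff (b k) j = (\<Sum>i<n. s k i * coeff (col i) j)"
      using s[OF jk(2)] by (simp add: coeff_sum)
    thus "N $$ (j, k) = coef_mat q b $$ (j, k)"
      using jk by (simp add: N_def coef_mat_def a_def col)
  qed (auto simp: N_def)
  hence detN: "det N \<noteq> 0" using triangular_det[OF b(1)] by simp
  define R where "R = inverse (det N) \<cdot>\<^sub>m adj_mat N"
  have R: "R \<in> carrier_mat q q" using adj_mat(1)[OF N] by (simp add: R_def)
  have RN: "R * N = 1\<^sub>m q"
    unfolding R_def using adj_mat[OF N] N detN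
    by (subst mult_smult_assoc_mat[of _ q q]) (auto intro!: eq_matI)
  have RA: "R $$ (k, j) \<in> A" if kj: "k < q" "j < q" for k j
  proof -
    define Y where "Y = (\<Sum>j<q. monom (R $$ (k, j)) j)"
    have Yc: "coeff Y j = (if j < q then R $$ (k, j) else 0)" for j
      by (auto simp: Y_def coeff_sum)
    define pair where "pair = (\<lambda>p. \<Sum>j<q. R $$ (k, j) * coeff p j)"
    have pb: "pair (b l) = (if k = l then 1 else 0)" if l: "l < q" for l
    proof -
      have "pair (b l) = (R * N) $$ (k, l)"
        using kj l R N \<open>N = coef_mat q b\<close>
        by (simp add: pair_def scalar_prod_def coef_mat_def lessThan_atLeast0)
      thus ?thesis using RN kj l by simp
    qed
    have pS: "pair p \<in> A" if "p \<in> S" for p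
    proof -
      obtain c where c: "\<forall>i. c i \<in> A" "p = (\<Sum>i<q. smult (c i) (b i))" using b(3) \<open>p \<in> S\<close> by blast
      have "pair p = (\<Sum>i<q. c i * pair (b i))"
        unfolding c(2) pair_def coeff_sum coeff_smult sum_distrib_left
        by (subst sum.swap) (simp add: mult_ac)
      also have "\<dots> = (\<Sum>i<q. if i = k then c i else 0)"
        using pb by (intro sum.cong refl) auto
      finally show ?thesis using c(1) by simp
    qed
    \<comment> \<open>Row k of the inverse R is integral on S, in particular on every column. These
      values are the coefficients of U Y, so Gauss's lemma makes the row integral and N
      unimodular.\<close>
    have "coeff (U * Y) i = pair (col i)" for i
    proof -
      have "U * Y = (\<Sum>j<q. smult (R $$ (k, j)) (monom 1 j * U))"
        unfolding Y_def sum_distrib_left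
        by (intro sum.cong refl) (metis mult.commute mult.right_neutral mult_smult_left smult_monom)
      thus ?thesis by (simp add: coeff_sum pair_def col)
    qed
    moreover have "coeff (U * Y) i = 0" if "i \<ge> n" for i
    proof (rule coeff_eq_0)
      have "degree Y \<le> q - 1" by (rule degree_le) (auto simp: Yc)
      hence "degree (U * Y) < degree U + q"
        using kj degree_mult_le[of U Y] by linarith
      thus "degree (U * Y) < i" using that n by simp
    qed
    ultimately have "coeff (U * Y) i \<in> A" for i
      using pS[OF colS[of i]] by (cases "i < n") auto
    hence "intp (U * Y)" by (simp add: intp_def)
    hence "intp Y" by (rule gauss[OF U])
    thus ?thesis using Yc[of j] kj by (metis intp_def)
  qed
  have "det R \<in> A" by (rule det_in[OF R RA])
  moreover have "det R * det N = 1"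
    using det_mult[OF R N] by (simp add: RN)
  ultimately have "inverse (det N) \<in> A" by (metis inverse_unique mult.commute)
  thus ?thesis using that[of a] a detN by (simp add: N_def)
qed

end

section \<open>The integral basis attached to U and a square root V\<close>

lemma degree_mod_lt:
  fixes f :: "'k :: field poly"
  assumes "degree f > 0"
  shows "degree (p mod f) < degree f"
proof (cases "p mod f = 0")
  case False
  moreover have "f \<noteq> 0" using assms by auto
  ultimately show ?thesis using degree_mod_less'[of f p] by simp
qed (use assms in simp)

context pid_subring
begin

lemma intp_shear:
  assumes "c \<in> A" "intp p"
  shows "intp (shear c N p)"
  unfolding shear_def using assms
  by (intro intp_sum intp_smult intp_mult intp_power intp_monom intp_pCons) (auto simp: intp_def)

text \<open>The inverse substitution writes the coefficients of U as integral combinations of those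
  of W, so the Bezout relation for U transfers to W.\<close>

lemma primp_shear:
  assumes U: "primp U" "degree U \<le> d" and c: "c \<in> A"
  shows "primp (shear c d U)"
proof -
  define W where "W = shear c d U"
  have W: "intp W" using U c by (auto simp: W_def primp_def intro: intp_shear)
  have dW: "degree W \<le> d" by (simp add: W_def degree_shear)
  have UW: "U = shear (- c) d W" using shear_shear[OF U(2), of "- c"] by (simp add: W_def)
  define T where "T = (\<lambda>j. monom 1 j * [:1, - c:] ^ (d - j))"
  have T: "intp (T j)" for j
    unfolding T_def using c by (intro intp_mult intp_power intp_monom intp_pCons uminus_in) auto
  obtain k where k: "\<And>i. k i \<in> A" "(\<Sum>i\<le>degree U. k i * coeff U i) = 1"
    using U by (auto simp: primp_def)
  define k' where "k' = (\<lambda>j. \<Sum>i\<le>degree U. k i * coeff (T j) i)"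
  have k': "k' j \<in> A" for j
    unfolding k'_def using k T by (intro sum_in mult_in) (auto simp: intp_def)
  have Ui: "coeff U i = (\<Sum>j\<le>d. coeff W j * coeff (T j) i)" for i
    by (subst UW) (simp add: shear_def T_def coeff_sum)
  have "1 = (\<Sum>i\<le>degree U. \<Sum>j\<le>d. k i * (coeff W j * coeff (T j) i))"
    using k(2) by (simp add: Ui sum_distrib_left)
  also have "\<dots> = (\<Sum>j\<le>d. k' j * coeff W j)"
    unfolding k'_def by (subst sum.swap) (simp add: sum_distrib_left mult_ac)
  also have "\<dots> = (\<Sum>j\<le>degree W. k' j * coeff W j)"
    using dW by (intro sum.mono_neutral_right) (auto simp: coeff_eq_0)
  finally show ?thesis using W k' unfolding primp_def W_def[symmetric] by metis
qed

text \<open>The basis consists of d lifts of V \<phi>_j and e + 1 multiples of U, both brought back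
  to the chart of f, and of q vectors representing integral functionals. On the first two blocks
  reciprocity reduces the forms to those on \<phi>, because V^2 = f' modulo U cancels the factor f'.
  The determinant is lead(U)^(e+1) N(V) det(\<phi>) det T; squaring it allows
  \<open>nrm_reciprocity\<close> to bring in the norm of W.\<close>

lemma integral_basis:
  fixes f U V Ui a b :: "'k poly" and s h :: nat
  assumes f: "intp f" "degree f = 2 * s"
    and U: "primp U" "degree U + 1 = 2 * h" and hs: "h < s"
    and c: "c \<in> A" "c \<noteq> 0"
    and V: "(V * V) mod U = shear c (degree f) f mod U"
    and bezout: "a * U + b * shear c (degree f) f = 1"
    and Ui: "(shear (- c) (degree U) U * Ui) mod f = 1"
  obtains r where "\<And>j i. j < degree f \<Longrightarrow> i \<ge> degree f \<Longrightarrow> coeff (r j) i = 0"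
    "\<And>i j. i < degree f \<Longrightarrow> j < degree f \<Longrightarrow> rho f (Ui * (r i * r j)) \<in> A"
    "\<And>i j. i < degree f \<Longrightarrow> j < degree f \<Longrightarrow> rho f (monom 1 1 * (Ui * (r i * r j))) \<in> A"
    "det (coef_mat (degree f) r) \<noteq> 0"
    "nrm f (shear (- c) (degree U) U) * lead_coeff f ^ (degree f + 1) / det (coef_mat (degree f) r) ^ 2 \<in> A"
proof -
  \<comment> \<open>There are e + 1 multiples U X^k of degree at most m = d + e, and q = e + 2
    vectors complete n = (m + 1) + q. The bound h < s protects e from truncated subtraction.\<close>
  define n d e m q where "n = degree f" and "d = degree U" and "e = s - 1 - h" and "m = d + e"
    and "q = e + 2"
  have d: "d > 0" "d + 1 = 2 * h" using U(2) unfolding d_def by presburger+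
  have n: "n = 2 * s" "n > 0" using f(2) hs by (auto simp: n_def)
  have nm: "n = Suc m + q" "d + n - 2 = m + m + 1" "m = h + s - 2" "Suc m = h + s - 1"
    using d n hs by (auto simp: m_def q_def e_def)
  have f0: "f \<noteq> 0" using n(2) by (auto simp: n_def)
  have Uint: "intp U" using U(1) by (simp add: primp_def)
  have U0: "U \<noteq> 0" using d by (auto simp: d_def)
  define f' where "f' = shear c n f"
  define W where "W = shear (- c) d U"
  have Wp: "primp W" unfolding W_def by (rule primp_shear) (use U c uminus_in d_def in auto)
  have Wint: "intp W" using Wp by (simp add: primp_def)
  have dW: "degree W \<le> d" by (simp add: W_def degree_shear)
  have V': "(V * V) mod U = f' mod U" using V by (simp add: f'_def n_def)
  obtain \<phi> where \<phi>: "\<And>j i. j < degree U \<Longrightarrow> i \<ge> degree U \<Longrightarrow> coeff (\<phi> j) i = 0"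
    "\<And>i j. i < degree U \<Longrightarrow> j < degree U \<Longrightarrow> rho U (\<phi> i * \<phi> j) \<in> A"
    "\<And>i j. i < degree U \<Longrightarrow> j < degree U \<Longrightarrow> rho U (monom 1 1 * (\<phi> i * \<phi> j)) \<in> A"
    "\<And>i. i < degree U \<Longrightarrow> \<exists>r\<in>Lam (h + s - 1). (V * \<phi> i) mod U = r mod U"
    "det (coef_mat (degree U) \<phi>) \<noteq> 0"
    "lead_coeff U ^ (degree U + 1) / det (coef_mat (degree U) \<phi>) ^ 2 \<in> A"
  proof (rule core_lattice[OF U _ _ _ V', of s])
    show "intp f'" unfolding f'_def by (rule intp_shear[OF c(1) f(1)])
    show "degree f' \<le> 2 * s" unfolding f'_def n(1) by (rule degree_shear)
    show "h \<le> s" using hs by simp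
  qed blast
  have "\<forall>i. \<exists>r. i < d \<longrightarrow> r \<in> Lam (Suc m) \<and> (V * \<phi> i) mod U = r mod U"
    using \<phi>(4) unfolding nm(4) d_def by blast
  then obtain R where R: "\<And>i. i < d \<Longrightarrow> R i \<in> Lam (Suc m)" "\<And>i. i < d \<Longrightarrow> (V * \<phi> i) mod U = R i mod U"
    by metis
  \<comment> \<open>Multiples of U vanish modulo U; giving them the partner 0 lets a single formula
    cover both blocks.\<close>
  define \<phi>0 where "\<phi>0 = (\<lambda>j. if j < d then \<phi> j else 0)"
  define \<rho> where "\<rho> = (\<lambda>j. if j < d then R j else U * monom 1 (j - d))"
  have \<rho>_Lam: "\<rho> j \<in> Lam (Suc m)" if "j \<le> m" for j
  proof (cases "j < d")
    case True
    thus ?thesis using R by (simp add: \<rho>_def)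
  next
    case False
    have "coeff (U * monom 1 (j - d)) i = 0" if "i \<ge> Suc m" for i
      using that False \<open>j \<le> m\<close> by (auto simp: mult.commute[of U] coeff_monom_mult d_def intro!: coeff_eq_0)
    thus ?thesis using False Uint by (auto simp: \<rho>_def Lam_def intro!: intp_mult intp_monom)
  qed
  have \<rho>_deg: "degree (\<rho> j) \<le> m" if "j \<le> m" for j
    using \<rho>_Lam[OF that] by (intro degree_le) (auto simp: Lam_def)
  have \<rho>_mod: "\<rho> j mod U = (V * \<phi>0 j) mod U" for j
    using R(2) by (auto simp: \<rho>_def \<phi>0_def)
  have \<phi>0: "rho U (\<phi>0 i * \<phi>0 j) \<in> A" "rho U (monom 1 1 * (\<phi>0 i * \<phi>0 j)) \<in> A" for i j
    using \<phi>(2,3) by (auto simp: \<phi>0_def d_def)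
  define lift where "lift = (\<lambda>j. shear (- c) m (\<rho> j))"
  have lift_deg: "degree (lift j) \<le> m" for j by (simp add: lift_def degree_shear)
  have lift_int: "intp (lift j)" if "j \<le> m" for j
    unfolding lift_def using \<rho>_Lam[OF that] c by (intro intp_shear uminus_in) (auto simp: Lam_def)
  have lift_Lam: "lift j \<in> Lam n" "monom 1 1 * lift j \<in> Lam n" if "j \<le> m" for j
  proof -
    have z: "coeff (lift j) i = 0" if "i > m" for i
      using that lift_deg[of j] by (intro coeff_eq_0) auto
    show "lift j \<in> Lam n" using lift_int[OF that] z nm(1) by (auto simp: Lam_def)
    have "intp (monom 1 1 * lift j)" using lift_int[OF that] by (intro intp_mult intp_monom) auto
    thus "monom 1 1 * lift j \<in> Lam n"
      using z nm(1) by (auto simp: Lam_def coeff_monom_mult q_def)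
  qed
  have shear_lift: "shear c m (lift j) = \<rho> j" if "j \<le> m" for j
    unfolding lift_def by (rule shear_shear[OF \<rho>_deg[OF that]])
  obtain g where g: "\<And>k i. g k i \<in> A"
    "det (mat q q (\<lambda>(j, k). \<Sum>i<n. g k i * coeff (monom 1 j * W) i)) \<noteq> 0"
    "inverse (det (mat q q (\<lambda>(j, k). \<Sum>i<n. g k i * coeff (monom 1 j * W) i))) \<in> A"
  proof (rule unimodular_functionals[OF Wp, of q n])
    show "degree W + q \<le> n" using dW nm(1) by (simp add: m_def)
  qed blast
  \<comment> \<open>In the form of weight \<open>Ui\<close> the factor W cancels and the shifts of f
    read off coefficients, so pairing with t_k is the functional g_k.\<close>
  define t0 where "t0 = (\<lambda>k. \<Sum>i<n. smult (g k i) (poly_shift (Suc i) f * W))"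
  define t where "t = (\<lambda>k. t0 k mod f)"
  have t_deg: "coeff (t k) i = 0" if "i \<ge> n" for k i
    unfolding t_def using that n by (intro coeff_mod_eq_0) (auto simp: n_def)
  have t_rho: "rho f (p * t k) = (\<Sum>i<n. g k i * rho f (poly_shift (Suc i) f * (p * W)))" for p k
  proof -
    have "rho f (p * t k) = rho f (p * t0 k)"
      unfolding t_def by (intro rho_cong) (simp add: mod_mult_right_eq)
    also have "p * t0 k = (\<Sum>i<n. smult (g k i) (poly_shift (Suc i) f * (p * W)))"
      by (simp add: t0_def sum_distrib_left mult.left_commute)
    finally show ?thesis by (simp add: rho_sum rho_smult)
  qed
  have Ui_W: "(W * (Ui * p)) mod f = p mod f" for p
  proof -
    have "(W * (Ui * p)) mod f = ((W * Ui) mod f * p) mod f"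
      by (simp add: mod_mult_left_eq mult.assoc)
    thus ?thesis using Ui by (simp add: W_def d_def)
  qed
  have t_rho_Ui: "rho f (Ui * (p * t k)) = (\<Sum>i<n. g k i * rho f (poly_shift (Suc i) f * p))" for p k
  proof -
    have "rho f (Ui * p * t k) = (\<Sum>i<n. g k i * rho f (poly_shift (Suc i) f * (Ui * p * W)))"
      by (rule t_rho)
    also have "\<dots> = (\<Sum>i<n. g k i * rho f (poly_shift (Suc i) f * p))"
    proof (intro sum.cong arg_cong2[where f = times] refl rho_cong)
      fix i
      show "(poly_shift (Suc i) f * (Ui * p * W)) mod f = (poly_shift (Suc i) f * p) mod f"
        by (metis Ui_W mod_mult_right_eq mult.commute)
    qed
    finally show ?thesis by (simp add: mult.assoc)
  qed
  have shift_Lam: "rho f (poly_shift (Suc i) f * p) = coeff p i" if "p \<in> Lam n" "i < n" for p i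
    using that rho_poly_shift[of "Suc i" f p] by (auto simp: Lam_def n_def)
  have W_Lam: "monom 1 j * W \<in> Lam n" if "j < q" for j
  proof -
    have "intp (monom 1 j * W)" using Wint by (intro intp_mult intp_monom) auto
    moreover have "coeff (monom 1 j * W) i = 0" if "i \<ge> n" for i
      using that \<open>j < q\<close> dW nm(1) by (auto simp: coeff_monom_mult m_def intro!: coeff_eq_0)
    ultimately show ?thesis by (auto simp: Lam_def)
  qed
  have lift_t: "rho f (Ui * (lift j * t k)) \<in> A" "rho f (monom 1 1 * (Ui * (lift j * t k))) \<in> A"
    if "j \<le> m" for j k
  proof -
    have *: "rho f (Ui * (p * t k)) \<in> A" if "p \<in> Lam n" for p
      unfolding t_rho_Ui using that g shift_Lam[OF that] by (intro sum_in mult_in) (auto simp: Lam_def intp_def)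
    show "rho f (Ui * (lift j * t k)) \<in> A" using lift_Lam[OF that] by (intro *)
    show "rho f (monom 1 1 * (Ui * (lift j * t k))) \<in> A"
      using *[OF lift_Lam(2)[OF that]] by (simp add: mult_ac)
  qed
  have t_t: "rho f (Ui * (t l * t k)) \<in> A" "rho f (monom 1 1 * (Ui * (t l * t k))) \<in> A" for l k
  proof -
    \<comment> \<open>One factor W survives here: two shifts of f are integral on X^j W, which has
      degree less than n for j < q. The two forms are the cases j = 0 and j = 1, available as q
      \<ge> 2.\<close>
    have *: "rho f (Ui * (monom 1 j * t l * t k)) \<in> A" if j: "j < q" for j
    proof -
      have "rho f (poly_shift (Suc i) f * (monom 1 j * t l)) \<in> A" if "i < n" for i
      proof -
        have "rho f (poly_shift (Suc i) f * (monom 1 j * t l)) =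
            (\<Sum>i'<n. g l i' * rho f (poly_shift (Suc i') f * (poly_shift (Suc i) f * (monom 1 j * W))))"
          using t_rho[of "poly_shift (Suc i) f * monom 1 j" l] by (simp add: mult.assoc)
        also have "\<dots> \<in> A"
          using g(1) \<open>i < n\<close> W_Lam[OF j] f(1)
          by (intro sum_in mult_in theta_theta_Lam) (auto simp: n_def)
        finally show ?thesis .
      qed
      thus ?thesis unfolding t_rho_Ui using g(1) by (intro sum_in mult_in) auto
    qed
    show "rho f (Ui * (t l * t k)) \<in> A" using *[of 0] by (simp add: q_def)
    show "rho f (monom 1 1 * (Ui * (t l * t k))) \<in> A" using *[of 1] by (simp add: q_def mult_ac)
  qed
  have lift_lift0: "rho f (Ui * p) = - rho U s0"
    if p: "degree p \<le> d + n - 2" and s0: "shear c (d + n - 2) p mod U = (f' * s0) mod U" for p s0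
  proof -
    have "rho f ((Ui * p) mod f) = - rho U (s0 mod U)"
    proof (rule residue_reciprocity[OF c(2) _ _ bezout])
      show "degree f > 0" "degree U > 0" using n d by (auto simp: n_def d_def)
      show "degree p \<le> degree U + degree f - 2" using p by (simp add: n_def d_def)
      show "(shear (- c) (degree U) U * (Ui * p mod f)) mod f = p mod f"
        using Ui_W[of p] by (simp add: W_def d_def mod_mult_right_eq)
      show "(shear c (degree f) f * (s0 mod U)) mod U = shear c (degree U + degree f - 2) p mod U"
        using s0 by (simp add: n_def d_def f'_def mod_mult_right_eq)
      show "degree (Ui * p mod f) < degree f" "degree (s0 mod U) < degree U"
        by (rule degree_mod_lt, use n d in \<open>simp add: n_def d_def\<close>)+
    qed
    thus ?thesis by simp
  qed
  have lift_lift: "rho f (Ui * (lift i * lift j)) \<in> A" "rho f (monom 1 1 * (Ui * (lift i * lift j))) \<in> A"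
    if ij: "i \<le> m" "j \<le> m" for i j
  proof -
    \<comment> \<open>A linear form l treats both matrices at once: under the substitution 1 becomes
      1 + c X, while X remains X.\<close>
    have *: "rho f (Ui * (l * (lift i * lift j))) = - rho U (shear c 1 l * (\<phi>0 i * \<phi>0 j))"
      if l: "degree l \<le> 1" for l
    proof (rule lift_lift0)
      have ll: "degree (lift i * lift j) \<le> m + m"
        using lift_deg[of i] lift_deg[of j] degree_mult_le[of "lift i" "lift j"] by linarith
      thus "degree (l * (lift i * lift j)) \<le> d + n - 2"
        using l degree_mult_le[of l "lift i * lift j"] unfolding nm(2) by linarith
      have "shear c (1 + (m + m)) (l * (lift i * lift j)) = shear c 1 l * (\<rho> i * \<rho> j)"
        by (simp only: shear_mult[OF l ll] shear_mult[OF lift_deg lift_deg] shear_lift[OF ij(1)] shear_lift[OF ij(2)])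
      hence "shear c (d + n - 2) (l * (lift i * lift j)) mod U = (shear c 1 l * (\<rho> i * \<rho> j)) mod U"
        unfolding nm(2) by (simp only: add.commute)
      also have "\<dots> = (shear c 1 l * ((V * \<phi>0 i) * (V * \<phi>0 j))) mod U"
        by (intro mod_mult_cong refl \<rho>_mod)
      also have "\<dots> = ((V * V) mod U * (shear c 1 l * (\<phi>0 i * \<phi>0 j))) mod U"
        unfolding mod_mult_left_eq by (simp only: mult_ac)
      also have "\<dots> = (f' * (shear c 1 l * (\<phi>0 i * \<phi>0 j))) mod U"
        unfolding V' mod_mult_left_eq ..
      finally show "shear c (d + n - 2) (l * (lift i * lift j)) mod U =
          (f' * (shear c 1 l * (\<phi>0 i * \<phi>0 j))) mod U" .
    qed
    have "[:1, c:] = 1 + smult c (monom 1 1)"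
      by (simp add: monom_altdef one_pCons)
    hence e: "[:1, c:] * p = p + smult c (monom 1 1 * p)" for p :: "'k poly"
      by (simp only: distrib_right mult_1_left mult_smult_left)
    have "rho f (Ui * (lift i * lift j)) = - rho U ([:1, c:] * (\<phi>0 i * \<phi>0 j))"
      using *[of 1] by (simp only: shear_1_1) simp
    also have "\<dots> = - (rho U (\<phi>0 i * \<phi>0 j) + c * rho U (monom 1 1 * (\<phi>0 i * \<phi>0 j)))"
      by (simp only: e rho_add rho_smult)
    also have "\<dots> \<in> A" using \<phi>0 c(1) by (intro uminus_in add_in mult_in)
    finally show "rho f (Ui * (lift i * lift j)) \<in> A" .
    have "rho f (Ui * (monom 1 1 * (lift i * lift j))) = - rho U (monom 1 1 * (\<phi>0 i * \<phi>0 j))"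
      using *[OF degree_monom_le] by (simp only: shear_1_monom)
    also have "\<dots> \<in> A" using \<phi>0 by (intro uminus_in)
    finally show "rho f (monom 1 1 * (Ui * (lift i * lift j))) \<in> A"
      by (simp only: mult.left_commute)
  qed
  define r where "r = (\<lambda>j. if j \<le> m then lift j else t (j - Suc m))"
  have rz: "coeff (r j) i = 0" if "i \<ge> n" for i j
    using that t_deg lift_deg[of j] nm(1) by (auto simp: r_def intro!: coeff_eq_0)
  have rr: "rho f (Ui * (r i * r j)) \<in> A \<and> rho f (monom 1 1 * (Ui * (r i * r j))) \<in> A" for i j
  proof (cases "i \<le> m"; cases "j \<le> m")
    assume "i \<le> m" "\<not> j \<le> m"
    thus ?thesis using lift_t[of i] by (simp add: r_def)
  next
    assume "\<not> i \<le> m" "j \<le> m"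
    thus ?thesis using lift_t[of j "i - Suc m"] by (simp add: r_def mult.commute[of "t _"])
  qed (use lift_lift[of i j] t_t in \<open>simp_all add: r_def\<close>)
  \<comment> \<open>The lifts have degree at most m, so the coordinate matrix is block triangular
    and only the coefficients of the t_k above m matter.\<close>
  define T where "T = mat q q (\<lambda>(i, j). coeff (t j) (Suc m + i))"
  have T: "T \<in> carrier_mat q q" by (simp add: T_def)
  have det_r: "det (coef_mat n r) = lead_coeff U ^ Suc e * (nrm U V * det (coef_mat d \<phi>)) * det T"
  proof -
    have "det (coef_mat n r) = det (mat (Suc m) (Suc m) (\<lambda>(i, j). coef_mat n r $$ (i, j))) *
        det (mat q q (\<lambda>(i, j). coef_mat n r $$ (Suc m + i, Suc m + j)))"
    proof (rule det_block_upper)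
      show "coef_mat n r \<in> carrier_mat (Suc m + q) (Suc m + q)" by (simp add: nm(1))
      show "coef_mat n r $$ (i, j) = 0" if "Suc m \<le> i" "i < Suc m + q" "j < Suc m" for i j
        using that lift_deg[of j] by (auto simp: coef_mat_def nm(1) r_def intro!: coeff_eq_0)
    qed
    also have "mat (Suc m) (Suc m) (\<lambda>(i, j). coef_mat n r $$ (i, j)) = coef_mat (Suc m) (\<lambda>j. shear (- c) m (\<rho> j))"
      by (intro eq_matI) (auto simp: coef_mat_def nm(1) r_def lift_def)
    also have "mat q q (\<lambda>(i, j). coef_mat n r $$ (Suc m + i, Suc m + j)) = T"
      by (intro eq_matI) (auto simp: coef_mat_def nm(1) r_def T_def)
    also have "det (coef_mat (Suc m) (\<lambda>j. shear (- c) m (\<rho> j))) = det (coef_mat (Suc m) \<rho>)"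
      by (rule det_shear[OF \<rho>_deg])
    also have "\<dots> = lead_coeff U ^ Suc e * det (coef_mat d (\<lambda>j. \<rho> j mod U))"
      unfolding m_def
    proof (rule det_remainders_multiples)
      show "degree (\<rho> j) \<le> d + e" if "j < d" for j using \<rho>_deg[of j] that by (simp add: m_def)
      show "\<rho> (d + k) = U * monom 1 k" for k by (simp add: \<rho>_def)
    qed (use d d_def in auto)
    also have "coef_mat d (\<lambda>j. \<rho> j mod U) = coef_mat d (\<lambda>j. (V * \<phi> j) mod U)"
      using \<rho>_mod by (intro eq_matI) (auto simp: coef_mat_def \<phi>0_def)
    also have "\<dots> = mul_mat U V * coef_mat d \<phi>"
      unfolding d_def by (rule coef_mat_mult_mod) (rule \<phi>(1))
    also have "det \<dots> = nrm U V * det (coef_mat d \<phi>)"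
      unfolding nrm_def by (rule det_mult[where n = d]) (auto simp: d_def)
    finally show ?thesis .
  qed
  \<comment> \<open>For j < q the residue of X^j t_k involves only coefficients above m, through an
    antitriangular Hankel matrix. Hence det T is det N / det H, with det N a unit of A.\<close>
  define H where "H = mat q q (\<lambda>(i, j). rho f (monom 1 (Suc m + (i + j))))"
  have H: "H \<in> carrier_mat q q" by (simp add: H_def)
  define N where "N = mat q q (\<lambda>(j, k). \<Sum>i<n. g k i * coeff (monom 1 j * W) i)"
  have HT: "H * T = N"
  proof (intro eq_matI)
    fix j k assume "j < dim_row N" "k < dim_col N"
    hence jk: "j < q" "k < q" by (auto simp: N_def)
    have "rho f (monom 1 j * t k) = (\<Sum>i<n. g k i * rho f (poly_shift (Suc i) f * (monom 1 j * W)))"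
      by (rule t_rho)
    also have "\<dots> = (\<Sum>i<n. g k i * coeff (monom 1 j * W) i)"
      using shift_Lam[OF W_Lam[OF jk(1)]] by (intro sum.cong refl) auto
    finally have 1: "rho f (monom 1 j * t k) = N $$ (j, k)" using jk by (simp add: N_def)
    have "rho f (monom 1 j * t k) = (\<Sum>l<n. coeff (t k) l * rho f (monom 1 j * monom 1 l))"
      by (rule rho_expand[OF t_deg])
    also have "\<dots> = (\<Sum>l<Suc m + q. coeff (t k) l * rho f (monom 1 (j + l)))"
      by (simp add: mult_monom nm(1))
    also have "\<dots> = (\<Sum>l<Suc m. coeff (t k) l * rho f (monom 1 (j + l))) +
        (\<Sum>l<q. coeff (t k) (Suc m + l) * rho f (monom 1 (j + (Suc m + l))))"
    proof -
      have "(\<Sum>i<p + q. F i) = (\<Sum>i<p. F i) + (\<Sum>i<q. F (p + i))" for p q and F :: "nat \<Rightarrow> 'k"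
        by (induction q) (auto simp: add.assoc)
      thus ?thesis .
    qed
    also have "(\<Sum>l<Suc m. coeff (t k) l * rho f (monom 1 (j + l))) = 0"
    proof (intro sum.neutral ballI)
      fix l assume "l \<in> {..<Suc m}"
      hence "j + l + 1 < degree f" using jk nm(1) by (simp add: n_def)
      thus "coeff (t k) l * rho f (monom 1 (j + l)) = 0" by (simp add: rho_monom_small)
    qed
    also have "0 + (\<Sum>l<q. coeff (t k) (Suc m + l) * rho f (monom 1 (j + (Suc m + l)))) = (H * T) $$ (j, k)"
      using jk by (simp add: H_def T_def scalar_prod_def lessThan_atLeast0 mult.commute add.left_commute)
    finally show "(H * T) $$ (j, k) = N $$ (j, k)" using 1 by simp
  qed (auto simp: H_def T_def N_def)
  have detH: "det H ^ 2 * lead_coeff f ^ (2 * q) = 1"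
  proof -
    have "det H = (-1) ^ (q * (q - 1) div 2) * rho f (monom 1 (Suc m + (q - 1))) ^ q"
      unfolding H_def
    proof (rule det_hankel)
      fix k assume "Suc k < q"
      hence "Suc m + k + 1 < degree f" using nm(1) by (simp add: n_def)
      thus "rho f (monom 1 (Suc m + k)) = 0" by (rule rho_monom_small)
    qed
    also have "rho f (monom 1 (Suc m + (q - 1))) = inverse (lead_coeff f)"
    proof -
      have "Suc m + (q - 1) = degree f - 1" using nm(1) by (simp add: n_def q_def)
      thus ?thesis using n by (subst rho_monom_less) (auto simp: n_def)
    qed
    finally have "det H = (-1) ^ (q * (q - 1) div 2) * inverse (lead_coeff f) ^ q" .
    hence "det H ^ 2 = inverse (lead_coeff f) ^ (2 * q)"
      by (simp add: power_mult_distrib flip: power_mult) (simp add: mult.commute)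
    thus ?thesis using f0 by (simp flip: power_mult_distrib)
  qed
  have detHT: "det H * det T = det N" using det_mult[OF H T] by (simp add: HT)
  have rec: "lead_coeff U ^ n * nrm U f' = lead_coeff f ^ d * nrm f W"
    unfolding f'_def W_def n_def d_def using n d by (intro nrm_reciprocity) (auto simp: n_def d_def)
  \<comment> \<open>Only the square of the norm of V is determined by f'; this is where the argument
    passes to squares.\<close>
  have nV: "nrm U V ^ 2 = nrm U f'"
  proof -
    have "nrm U V ^ 2 = nrm U (V * V)" using d by (simp add: nrm_mult d_def power2_eq_square)
    also have "\<dots> = nrm U ((V * V) mod U)" by simp
    finally show ?thesis unfolding V' by simp
  qed
  have nW: "nrm f W \<noteq> 0"
  proof -
    have "nrm f W * nrm f Ui = nrm f ((W * Ui) mod f)" using n by (simp add: nrm_mult n_def)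
    also have "(W * Ui) mod f = 1" using Ui by (simp add: W_def d_def)
    finally show ?thesis using n by (auto simp: n_def)
  qed
  let ?u = "lead_coeff U" and ?F = "lead_coeff f" and ?p = "det (coef_mat d \<phi>)"
  have u0: "?u \<noteq> 0" and F0: "?F \<noteq> 0" using U0 f0 by auto
  have N0: "det N \<noteq> 0" using g(2) by (simp add: N_def)
  have p0: "?p \<noteq> 0" using \<phi>(5) by (simp add: d_def)
  have T2: "det T ^ 2 = det N ^ 2 * ?F ^ (2 * q)"
  proof -
    have "det N ^ 2 * ?F ^ (2 * q) = (det H ^ 2 * ?F ^ (2 * q)) * det T ^ 2"
      by (simp add: detHT[symmetric] power_mult_distrib)
    thus ?thesis by (simp add: detH)
  qed
  have "det (coef_mat n r) ^ 2 * ?u ^ n = (?u ^ Suc e) ^ 2 * ?p ^ 2 * det T ^ 2 * (?u ^ n * nrm U f')"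
    unfolding det_r nV[symmetric] by (simp add: power_mult_distrib)
  also have "\<dots> = ?u ^ (2 * e + 2) * ?p ^ 2 * det N ^ 2 * nrm f W * ?F ^ (n + 1)"
  proof -
    have "2 * e + 2 = Suc e * 2" by simp
    hence "(?u ^ Suc e) ^ 2 = ?u ^ (2 * e + 2)" by (simp only: power_mult)
    moreover have "?F ^ (n + 1) = ?F ^ (2 * q) * ?F ^ d"
    proof -
      have "n + 1 = 2 * q + d" using nm(1) by (simp add: m_def q_def)
      thus ?thesis by (simp only: power_add)
    qed
    ultimately show ?thesis unfolding rec T2 by simp
  qed
  also have "?u ^ n = ?u ^ (2 * e + 2) * ?u ^ (d + 1)"
  proof -
    have "n = (2 * e + 2) + (d + 1)" using nm(1) by (simp add: m_def q_def)
    thus ?thesis by (metis power_add)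
  qed
  finally have key: "det (coef_mat n r) ^ 2 * ?u ^ (d + 1) = ?p ^ 2 * det N ^ 2 * nrm f W * ?F ^ (n + 1)"
    using u0 by (simp add: mult.left_commute[of _ "?u ^ (2 * e + 2)"] mult.assoc del: power_Suc)
  hence D0: "det (coef_mat n r) \<noteq> 0"
    using u0 F0 N0 p0 nW by auto
  have "nrm f W * ?F ^ (n + 1) / det (coef_mat n r) ^ 2 = (?u ^ (d + 1) / ?p ^ 2) * inverse (det N) ^ 2"
  proof -
    have "(nrm f W * ?F ^ (n + 1)) * (?p ^ 2 * det N ^ 2) = ?u ^ (d + 1) * det (coef_mat n r) ^ 2"
      using key by (simp only: mult_ac)
    hence "nrm f W * ?F ^ (n + 1) / det (coef_mat n r) ^ 2 = ?u ^ (d + 1) / (?p ^ 2 * det N ^ 2)"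
      using D0 p0 N0 by (simp add: frac_eq_eq)
    thus ?thesis by (simp add: divide_inverse power_inverse)
  qed
  also have "\<dots> \<in> A"
    using \<phi>(6) g(3) by (intro mult_in power_in) (auto simp: d_def N_def)
  finally have "nrm f W * ?F ^ (n + 1) / det (coef_mat n r) ^ 2 \<in> A" .
  thus ?thesis
    using that[of r] rz rr D0 by (auto simp: n_def W_def d_def)
qed

end

section \<open>The fixed field of the automorphisms of an algebraic closure\<close>

interpretation to_ac: field_hom to_ac
  by unfold_locales auto

section \<open>Partial isomorphisms of the algebraic closure as graphs\<close>

lemma degree_pos_of_root:
  assumes "p \<noteq> 0" "poly p x = 0"
  shows "degree p > 0"
proof (rule ccontr)
  assume "\<not> degree p > 0"
  then obtain c where "p = [:c:]" by (auto elim: degree_eq_zeroE)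
  thus False using assms by auto
qed

text \<open>A partial isomorphism over K, as a relation: the clause on zeros yields
  single-valuedness and injectivity together. In this form converses and unions of chains are
  immediate; closure under inverses follows from algebraicity.\<close>

definition field_graph :: "('k :: field alg_closure \<times> 'k alg_closure) set \<Rightarrow> bool" where
  "field_graph G \<longleftrightarrow> (\<forall>a. (to_ac a, to_ac a) \<in> G) \<and>
     (\<forall>x x' y y'. (x, x') \<in> G \<longrightarrow> (y, y') \<in> G \<longrightarrow> (x + y, x' + y') \<in> G \<and> (x * y, x' * y') \<in> G) \<and>
     (\<forall>x x'. (x, x') \<in> G \<longrightarrow> (x = 0 \<longleftrightarrow> x' = 0))"

definition graph_polys :: "('a :: zero \<times> 'a) set \<Rightarrow> ('a poly \<times> 'a poly) set" where
  "graph_polys G = {(p, q). \<forall>i. (coeff p i, coeff q i) \<in> G}"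

context
  fixes G :: "('k :: field alg_closure \<times> 'k alg_closure) set"
  assumes G: "field_graph G"
begin

lemma graph_const: "(to_ac a, to_ac a) \<in> G"
  using G by (auto simp: field_graph_def)

lemma graph_0: "(0, 0) \<in> G"
  using graph_const[of 0] by simp

lemma graph_1: "(1, 1) \<in> G"
  using graph_const[of 1] by simp

lemma graph_add: "(x, x') \<in> G \<Longrightarrow> (y, y') \<in> G \<Longrightarrow> (x + y, x' + y') \<in> G"
  using G by (auto simp: field_graph_def)

lemma graph_mult: "(x, x') \<in> G \<Longrightarrow> (y, y') \<in> G \<Longrightarrow> (x * y, x' * y') \<in> G"
  using G by (auto simp: field_graph_def)

lemma graph_zero_iff: "(x, x') \<in> G \<Longrightarrow> x = 0 \<longleftrightarrow> x' = 0"
  using G by (auto simp: field_graph_def)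

lemma graph_uminus: "(x, x') \<in> G \<Longrightarrow> (- x, - x') \<in> G"
  using graph_mult[OF graph_const[of "-1"], of x x'] by simp

lemma graph_diff: "(x, x') \<in> G \<Longrightarrow> (y, y') \<in> G \<Longrightarrow> (x - y, x' - y') \<in> G"
  using graph_add[of x x' "- y" "- y'"] graph_uminus by simp

lemma graph_sum: "(\<And>i. i \<in> A \<Longrightarrow> (g i, g' i) \<in> G) \<Longrightarrow> (sum g A, sum g' A) \<in> G"
  by (induction A rule: infinite_finite_induct) (auto simp: graph_0 graph_add)

lemma graph_poly_base: "(x, x') \<in> G \<Longrightarrow> (poly (map_poly to_ac p) x, poly (map_poly to_ac p) x') \<in> G"
  by (induction p) (auto simp: graph_0 map_poly_pCons intro!: graph_add graph_mult graph_const)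

text \<open>A polynomial over K of least degree vanishing at x has a nonzero constant term, so 1 / x
  is a polynomial in x with coefficients in K, and relations are preserved under such
  polynomials.\<close>

lemma graph_inverse:
  assumes x: "(x, x') \<in> G"
  shows "(inverse x, inverse x') \<in> G"
proof (cases "x = 0")
  case True
  thus ?thesis using x graph_zero_iff[OF x] graph_0 by simp
next
  case False
  define P where "P = (\<lambda>p :: 'k poly. p \<noteq> 0 \<and> poly (map_poly to_ac p) x = 0)"
  obtain p0 where "P p0"
    unfolding P_def using alg_closure_algebraic[of x] by blast
  then obtain p where p: "P p" and min: "\<And>q. P q \<Longrightarrow> degree p \<le> degree q"
    using ex_has_least_nat[of P p0 degree] by blast
  obtain c q where pq: "p = pCons c q"
    using pCons_cases by blast
  have "c \<noteq> 0"
  proof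
    assume "c = 0"
    hence "P q"
      using p False pq by (auto simp: P_def map_poly_pCons)
    moreover from this have "degree q < degree p"
      by (auto simp: pq P_def)
    ultimately show False using min[of q] by simp
  qed
  define r r' where "r = to_ac (- inverse c) * poly (map_poly to_ac q) x"
    and "r' = to_ac (- inverse c) * poly (map_poly to_ac q) x'"
  have r: "(r, r') \<in> G"
    unfolding r_def r'_def by (intro graph_mult graph_const graph_poly_base x)
  have "to_ac c + x * poly (map_poly to_ac q) x = 0"
    using p unfolding P_def pq to_ac.map_poly_pCons_hom by simp
  hence "x * poly (map_poly to_ac q) x = - to_ac c"
    by (simp add: eq_neg_iff_add_eq_0 add.commute)
  hence xr: "x * r = 1"
    unfolding r_def using \<open>c \<noteq> 0\<close> by (simp add: mult.left_commute[of x])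
  have "(x * r - 1, x' * r' - 1) \<in> G"
    by (intro graph_diff graph_mult x r graph_1)
  hence "x' * r' = 1"
    using graph_zero_iff xr by fastforce
  thus ?thesis using r xr inverse_unique by metis
qed

lemma graph_polys_coeff_zero_iff: "(p, p') \<in> graph_polys G \<Longrightarrow> coeff p i = 0 \<longleftrightarrow> coeff p' i = 0"
  using graph_zero_iff unfolding graph_polys_def by blast

lemma graph_polys_zero_iff: "(p, p') \<in> graph_polys G \<Longrightarrow> p = 0 \<longleftrightarrow> p' = 0"
  using graph_polys_coeff_zero_iff[of p p'] by (simp add: poly_eq_iff)

lemma graph_polys_degree: "(p, p') \<in> graph_polys G \<Longrightarrow> degree p = degree p'"
  using graph_polys_coeff_zero_iff[of p p'] by (metis antisym degree_le coeff_eq_0)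

lemma graph_polys_add:
  "(p, p') \<in> graph_polys G \<Longrightarrow> (q, q') \<in> graph_polys G \<Longrightarrow> (p + q, p' + q') \<in> graph_polys G"
  by (auto simp: graph_polys_def graph_add)

lemma graph_polys_diff:
  "(p, p') \<in> graph_polys G \<Longrightarrow> (q, q') \<in> graph_polys G \<Longrightarrow> (p - q, p' - q') \<in> graph_polys G"
  by (auto simp: graph_polys_def graph_diff)

lemma graph_polys_mult:
  "(p, p') \<in> graph_polys G \<Longrightarrow> (q, q') \<in> graph_polys G \<Longrightarrow> (p * q, p' * q') \<in> graph_polys G"
  by (auto simp: graph_polys_def coeff_mult intro!: graph_sum graph_mult)

lemma graph_polys_monom: "(c, c') \<in> G \<Longrightarrow> (monom c n, monom c' n) \<in> graph_polys G"
  by (simp add: graph_polys_def graph_0)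

lemma graph_polys_base: "(map_poly to_ac p, map_poly to_ac p) \<in> graph_polys G"
  by (auto simp: graph_polys_def coeff_map_poly graph_const)

text \<open>Long division is run on both sides in parallel; each quotient coefficient uses
  \<open>graph_inverse\<close>, and degrees agree because zeros correspond.\<close>

lemma graph_polys_division:
  assumes p: "(p, p') \<in> graph_polys G" "p \<noteq> 0"
    and q: "(q, q') \<in> graph_polys G"
  shows "\<exists>s s' r r'. (s, s') \<in> graph_polys G \<and> (r, r') \<in> graph_polys G \<and>
    q = p * s + r \<and> q' = p' * s' + r' \<and> (r = 0 \<or> degree r < degree p)"
  using q
proof (induction "degree q" arbitrary: q q' rule: less_induct)
  case less
  have zero: "(0, 0) \<in> graph_polys G"
    by (simp add: graph_polys_def graph_0)
  show ?case
  proof (cases "q = 0 \<or> degree q < degree p")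
    case True
    show ?thesis
      using True less.prems zero by (intro exI[of _ 0] exI[of _ q] exI[of _ q']) auto
  next
    case False
    let ?k = "degree q - degree p"
    define c c' where "c = lead_coeff q * inverse (lead_coeff p)"
      and "c' = lead_coeff q' * inverse (lead_coeff p')"
    have cc: "(c, c') \<in> G"
      unfolding c_def c'_def graph_polys_degree[OF p(1), symmetric]
        graph_polys_degree[OF less.prems, symmetric]
      using p(1) less.prems by (intro graph_mult graph_inverse) (auto simp: graph_polys_def)
    define t t' where "t = monom c ?k" and "t' = monom c' ?k"
    have tt: "(t, t') \<in> graph_polys G"
      unfolding t_def t'_def by (intro graph_polys_monom cc)
    define d d' where "d = q - p * t" and "d' = q' - p' * t'"
    have dd: "(d, d') \<in> graph_polys G"
      unfolding d_def d'_def by (intro graph_polys_diff graph_polys_mult p tt less.prems)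
    have "c \<noteq> 0" using False p by (auto simp: c_def)
    hence t: "degree t = ?k" "lead_coeff t = c" "t \<noteq> 0"
      by (auto simp: t_def degree_monom_eq)
    have dpt: "degree (p * t) = degree q"
      using False p t by (simp add: degree_mult_eq)
    have "lead_coeff (p * t) = lead_coeff p * c"
      unfolding lead_coeff_mult t(2) ..
    hence "coeff (p * t) (degree q) = lead_coeff q"
      using dpt p by (simp add: c_def)
    hence "coeff d (degree q) = 0" "degree d \<le> degree q"
      unfolding d_def using dpt by (simp_all add: degree_diff_le)
    hence "d = 0 \<or> degree d < degree q"
      by (metis le_neq_implies_less leading_coeff_0_iff)
    hence "\<exists>s s' r r'. (s, s') \<in> graph_polys G \<and> (r, r') \<in> graph_polys G \<and>
      d = p * s + r \<and> d' = p' * s' + r' \<and> (r = 0 \<or> degree r < degree p)"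
    proof
      assume "d = 0"
      hence "d' = 0" using graph_polys_zero_iff[OF dd] by simp
      thus ?thesis using zero \<open>d = 0\<close> by (intro exI[of _ 0]) auto
    next
      assume "degree d < degree q"
      thus ?thesis using less.hyps dd by blast
    qed
    then obtain s s' r r' where *: "(s, s') \<in> graph_polys G" "(r, r') \<in> graph_polys G"
      "d = p * s + r" "d' = p' * s' + r'" "r = 0 \<or> degree r < degree p"
      by blast
    have "q = p * (t + s) + r" "q' = p' * (t' + s') + r'"
      using *(3,4) unfolding d_def d'_def by (simp_all add: algebra_simps)
    thus ?thesis
      using * graph_polys_add[OF tt *(1)] by blast
  qed
qed

text \<open>The new graph consists of the pairs (q(x), q'(y)). The point is that q(x) and q'(y)
  vanish together, which needs minimality on the side of x and a separate argument on the side of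
  y.\<close>

lemma graph_extend:
  assumes p: "(p, p') \<in> graph_polys G" "p \<noteq> 0" "poly p x = 0"
    and min: "\<And>q q'. (q, q') \<in> graph_polys G \<Longrightarrow> q \<noteq> 0 \<Longrightarrow> poly q x = 0 \<Longrightarrow> degree p \<le> degree q"
    and y: "poly p' y = 0"
  shows "\<exists>G'. field_graph G' \<and> G \<subseteq> G' \<and> (x, y) \<in> G'"
proof -
  have fwd: "poly q' y = 0" if q: "(q, q') \<in> graph_polys G" and "poly q x = 0" for q q'
  proof -
    obtain s s' r r' where *: "(s, s') \<in> graph_polys G" "(r, r') \<in> graph_polys G"
      "q = p * s + r" "q' = p' * s' + r'" "r = 0 \<or> degree r < degree p"
      using graph_polys_division[OF p(1,2) q] by blast
    have "poly r x = 0" using * p that by simp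
    hence "r = 0" using min[OF *(2)] *(5) by force
    hence "r' = 0" using graph_polys_zero_iff[OF *(2)] by simp
    thus ?thesis using * y by simp
  qed
  \<comment> \<open>On the side of y a minimal t' is taken, with partner t. Then p = t s, and
    minimality of p forces t(x) = 0; every q with q'(y) = 0 is a multiple of t.\<close>
  have bwd: "poly q x = 0" if q: "(q, q') \<in> graph_polys G" and qy: "poly q' y = 0" for q q'
  proof -
    define T where "T = (\<lambda>t. (fst t, snd t) \<in> graph_polys G \<and> fst t \<noteq> 0 \<and> poly (snd t) y = 0)"
    have "T (p, p')" using p y by (auto simp: T_def)
    then obtain t0 where t0: "T t0" and tmin0: "\<And>q. T q \<Longrightarrow> degree (fst t0) \<le> degree (fst q)"
      using ex_has_least_nat[of T "(p, p')" "\<lambda>t. degree (fst t)"] by blast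
    obtain t t' where "t0 = (t, t')" by (cases t0)
    hence t: "(t, t') \<in> graph_polys G" "t \<noteq> 0" "poly t' y = 0"
      using t0 by (auto simp: T_def)
    have tmin: "r = 0 \<or> degree t \<le> degree r" if "(r, r') \<in> graph_polys G" "poly r' y = 0" for r r'
      using tmin0[of "(r, r')"] that \<open>t0 = (t, t')\<close> by (auto simp: T_def)
    have div: "\<exists>s s'. (s, s') \<in> graph_polys G \<and> h = t * s"
      if h: "(h, h') \<in> graph_polys G" and hy: "poly h' y = 0" for h h'
    proof -
      obtain s s' r r' where *: "(s, s') \<in> graph_polys G" "(r, r') \<in> graph_polys G"
        "h = t * s + r" "h' = t' * s' + r'" "r = 0 \<or> degree r < degree t"
        using graph_polys_division[OF t(1,2) h] by blast
      have "poly r' y = 0" using * t hy by simp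
      hence "r = 0" using tmin[OF *(2)] *(5) by force
      thus ?thesis using * by auto
    qed
    obtain s s' where s: "(s, s') \<in> graph_polys G" "p = t * s"
      using div[OF p(1) y] by blast
    have "poly t x = 0"
    proof (rule ccontr)
      assume "poly t x \<noteq> 0"
      hence "poly s x = 0" "s \<noteq> 0" using p s by auto
      hence "degree t = 0"
        using min[OF s(1)] p(2) s(2) by (simp add: degree_mult_eq)
      hence "degree t' = 0" "t' \<noteq> 0"
        using graph_polys_degree[OF t(1)] graph_polys_zero_iff[OF t(1)] t by auto
      thus False using t(3) by (auto elim!: degree_eq_zeroE)
    qed
    thus ?thesis using div[OF q qy] by auto
  qed
  define G' where "G' = {(poly q x, poly q' y) | q q'. (q, q') \<in> graph_polys G}"
  have G'I: "(poly q x, poly q' y) \<in> G'" if "(q, q') \<in> graph_polys G" for q q'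
    using that by (auto simp: G'_def)
  have "field_graph G'"
    unfolding field_graph_def
  proof (intro conjI allI impI)
    fix a :: 'k
    show "(to_ac a, to_ac a) \<in> G'"
      using G'I[OF graph_polys_monom[OF graph_const[of a], of 0]] by (simp add: poly_monom)
  next
    fix u u' v v' assume "(u, u') \<in> G'" "(v, v') \<in> G'"
    then obtain q q' r r' where *: "(q, q') \<in> graph_polys G" "(r, r') \<in> graph_polys G"
      "u = poly q x" "u' = poly q' y" "v = poly r x" "v' = poly r' y"
      by (auto simp: G'_def)
    show "(u + v, u' + v') \<in> G'"
      using G'I[OF graph_polys_add[OF *(1,2)]] by (simp add: *(3-))
    show "(u * v, u' * v') \<in> G'"
      using G'I[OF graph_polys_mult[OF *(1,2)]] by (simp add: *(3-))
  next
    fix u u' assume "(u, u') \<in> G'"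
    thus "u = 0 \<longleftrightarrow> u' = 0"
      using fwd bwd by (auto simp: G'_def)
  qed
  moreover have "G \<subseteq> G'"
  proof safe
    fix u u' assume "(u, u') \<in> G"
    thus "(u, u') \<in> G'"
      using G'I[OF graph_polys_monom[of u u' 0]] by (simp add: poly_monom)
  qed
  moreover have "(x, y) \<in> G'"
    using G'I[OF graph_polys_monom[OF graph_1, of 1]] by (simp add: poly_monom)
  ultimately show ?thesis by blast
qed

lemma graph_minimal_poly:
  obtains p p' where "(p, p') \<in> graph_polys G" "p \<noteq> 0" "poly p x = 0"
    "\<And>q q'. (q, q') \<in> graph_polys G \<Longrightarrow> q \<noteq> 0 \<Longrightarrow> poly q x = 0 \<Longrightarrow> degree p \<le> degree q"
proof -
  define T where "T = (\<lambda>t. (fst t, snd t) \<in> graph_polys G \<and> fst t \<noteq> 0 \<and> poly (fst t) x = 0)"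
  obtain p0 :: "'k poly" where p0: "p0 \<noteq> 0" "poly (map_poly to_ac p0) x = 0"
    using alg_closure_algebraic[of x] by blast
  have "T (map_poly to_ac p0, map_poly to_ac p0)"
    using p0 graph_polys_base[of p0] by (auto simp: T_def map_poly_eq_0_iff)
  then obtain t0 where t0: "T t0" and tmin0: "\<And>q. T q \<Longrightarrow> degree (fst t0) \<le> degree (fst q)"
    using ex_has_least_nat[of T _ "\<lambda>t. degree (fst t)"] by blast
  show ?thesis
    by (rule that[of "fst t0" "snd t0"]) (use t0 tmin0 in \<open>fastforce simp: T_def\<close>)+
qed

lemma graph_extend_domain: "\<exists>G' y. field_graph G' \<and> G \<subseteq> G' \<and> (x, y) \<in> G'"
proof -
  obtain p p' where p: "(p, p') \<in> graph_polys G" "p \<noteq> 0" "poly p x = 0"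
    "\<And>q q'. (q, q') \<in> graph_polys G \<Longrightarrow> q \<noteq> 0 \<Longrightarrow> poly q x = 0 \<Longrightarrow> degree p \<le> degree q"
    using graph_minimal_poly[of x] by blast
  have "degree p' > 0"
    using degree_pos_of_root[OF p(2,3)] graph_polys_degree[OF p(1)] by simp
  then obtain y where "poly p' y = 0"
    using alg_closed_imp_poly_has_root by blast
  hence "\<exists>G'. field_graph G' \<and> G \<subseteq> G' \<and> (x, y) \<in> G'"
    by (intro graph_extend[of p p']) (use p in auto)
  thus ?thesis by blast
qed

end

lemma field_graph_converse: "field_graph G \<Longrightarrow> field_graph (G\<inverse>)"
  by (auto simp: field_graph_def)

text \<open>Zorn's lemma gives a maximal graph. Its domain is everything by
  \<open>graph_extend_domain\<close>, and its range by the same extension applied to the converse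
  graph.\<close>

lemma field_graph_imp_galois_aut:
  fixes G :: "('k :: field alg_closure \<times> 'k alg_closure) set"
  assumes G: "field_graph G"
  shows "\<exists>\<sigma> \<in> galois_aut. \<forall>(x, y) \<in> G. \<sigma> x = y"
proof -
  define FF where "FF = {H. field_graph H \<and> G \<subseteq> H}"
  have "\<exists>M\<in>FF. \<forall>H\<in>FF. M \<subseteq> H \<longrightarrow> H = M"
  proof (rule subset_Zorn_nonempty)
    show "FF \<noteq> {}" using G by (auto simp: FF_def)
    fix CC assume ne: "CC \<noteq> {}" and ch: "subset.chain FF CC"
    have C: "field_graph H" "G \<subseteq> H" if "H \<in> CC" for H
      using ch that by (auto simp: subset.chain_def FF_def)
    obtain H0 where H0: "H0 \<in> CC" using ne by blast
    have "field_graph (\<Union>CC)"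
      unfolding field_graph_def
    proof (intro conjI allI impI)
      show "(to_ac a, to_ac a) \<in> \<Union>CC" for a
        using graph_const[OF C(1)[OF H0], of a] H0 by blast
    next
      fix x x' y y' assume "(x, x') \<in> \<Union>CC" "(y, y') \<in> \<Union>CC"
      then obtain H1 H2 where H12: "H1 \<in> CC" "(x, x') \<in> H1" "H2 \<in> CC" "(y, y') \<in> H2" by blast
      have "H1 \<subseteq> H2 \<or> H2 \<subseteq> H1"
        using ch H12 by (meson subset.chain_def subset_chain_def)
      then obtain H where H: "H \<in> CC" "(x, x') \<in> H" "(y, y') \<in> H"
        using H12 by blast
      show "(x + y, x' + y') \<in> \<Union>CC" "(x * y, x' * y') \<in> \<Union>CC"
        using graph_add[OF C(1)[OF H(1)] H(2,3)] graph_mult[OF C(1)[OF H(1)] H(2,3)] H(1) by blast+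
    next
      fix x x' assume "(x, x') \<in> \<Union>CC"
      thus "x = 0 \<longleftrightarrow> x' = 0" using graph_zero_iff[OF C(1)] by blast
    qed
    moreover have "G \<subseteq> \<Union>CC" using C(2)[OF H0] H0 by blast
    ultimately show "\<Union>CC \<in> FF" by (auto simp: FF_def)
  qed
  then obtain M where M': "M \<in> FF" "\<And>H. H \<in> FF \<Longrightarrow> M \<subseteq> H \<Longrightarrow> H = M"
    by metis
  hence M: "field_graph M" "G \<subseteq> M"
    by (simp_all add: FF_def)
  have max: "H = M" if "field_graph H" "M \<subseteq> H" for H
    by (rule M'(2)) (use that M(2) in \<open>simp_all add: FF_def\<close>)
  have dom: "\<exists>y. (x, y) \<in> M" for x
    using graph_extend_domain[OF M(1), of x] max by metis
  have ran: "\<exists>x. (x, y) \<in> M" for y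
  proof -
    obtain H z where H: "field_graph H" "M\<inverse> \<subseteq> H" "(y, z) \<in> H"
      using graph_extend_domain[OF field_graph_converse[OF M(1)], of y] by blast
    have "M \<subseteq> H\<inverse>" using H(2) by auto
    hence "H\<inverse> = M" by (rule max[OF field_graph_converse[OF H(1)]])
    thus ?thesis using H(3) by blast
  qed
  have fn: "y = y'" if "(x, y) \<in> M" "(x, y') \<in> M" for x y y'
    using graph_zero_iff[OF M(1) graph_diff[OF M(1) that]] by simp
  have inj: "x = x'" if "(x, y) \<in> M" "(x', y) \<in> M" for x x' y
    using graph_zero_iff[OF M(1) graph_diff[OF M(1) that]] by simp
  define \<sigma> where "\<sigma> = (\<lambda>x. THE y. (x, y) \<in> M)"
  have \<sigma>: "(x, \<sigma> x) \<in> M" for x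
    unfolding \<sigma>_def using dom[of x] fn by (metis theI)
  have \<sigma>_eq: "\<sigma> x = y" if "(x, y) \<in> M" for x y
    using fn[OF \<sigma> that] .
  have "bij \<sigma>"
  proof (rule bijI)
    show "inj \<sigma>" by (rule injI) (metis \<sigma> inj)
    show "surj \<sigma>" using ran \<sigma>_eq by (metis surjI)
  qed
  hence "\<sigma> \<in> galois_aut"
    unfolding galois_aut_def
    by (auto intro!: \<sigma>_eq graph_add[OF M(1)] graph_mult[OF M(1)] graph_const[OF M(1)] \<sigma>)
  thus ?thesis using \<sigma>_eq M(2) by blast
qed

text \<open>In characteristic 0 the minimal polynomial of x is separable: its derivative is nonzero
  of lower degree. If x is not in K the degree exceeds 1, so there is a root y different from x, and
  sending x to y extends to an automorphism.\<close>

theorem galois_fixed_imp_base: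
  fixes x :: "'k :: field_char_0 alg_closure"
  assumes "\<And>\<sigma>. \<sigma> \<in> galois_aut \<Longrightarrow> \<sigma> x = x"
  shows "x \<in> range to_ac"
proof (rule ccontr)
  assume x: "x \<notin> range to_ac"
  define G where "G = (range (\<lambda>a :: 'k. (to_ac a, to_ac a)))"
  have G: "field_graph G"
    unfolding field_graph_def G_def
  proof (intro conjI allI impI; (elim rangeE)?)
    fix x x' y y' and a b :: 'k
    assume "(x, x') = (to_ac a, to_ac a)" "(y, y') = (to_ac b, to_ac b)"
    thus "(x + y, x' + y') \<in> range (\<lambda>a :: 'k. (to_ac a, to_ac a))"
      "(x * y, x' * y') \<in> range (\<lambda>a :: 'k. (to_ac a, to_ac a))"
      by (auto simp: image_iff simp flip: to_ac_add to_ac_mult)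
  qed auto
  obtain p p' where p: "(p, p') \<in> graph_polys G" "p \<noteq> 0" "poly p x = 0"
    and min: "\<And>q q'. (q, q') \<in> graph_polys G \<Longrightarrow> q \<noteq> 0 \<Longrightarrow> poly q x = 0 \<Longrightarrow> degree p \<le> degree q"
    using graph_minimal_poly[OF G, of x] by blast
  have pp: "p' = p"
  proof (rule poly_eqI)
    show "coeff p' i = coeff p i" for i
      using p(1) by (auto simp: graph_polys_def G_def image_iff dest!: spec[of _ i])
  qed
  have deg: "degree p \<noteq> 0"
    using degree_pos_of_root[OF p(2,3)] by simp
  have "poly (pderiv p) x \<noteq> 0"
  proof
    assume "poly (pderiv p) x = 0"
    moreover have "(pderiv p, pderiv p) \<in> graph_polys G"
      unfolding graph_polys_def
    proof safe
      fix i
      obtain a where "coeff p (Suc i) = to_ac a"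
        using p(1) by (auto simp: graph_polys_def G_def image_iff)
      hence c: "coeff (pderiv p) i = to_ac (of_nat (Suc i) * a)"
        by (simp add: coeff_pderiv)
      show "(coeff (pderiv p) i, coeff (pderiv p) i) \<in> G"
        unfolding G_def c by (rule rangeI)
    qed
    moreover have "pderiv p \<noteq> 0" using deg by (simp add: pderiv_eq_0_iff)
    ultimately have "degree p \<le> degree (pderiv p)" using min by blast
    thus False using deg by (simp add: degree_pderiv)
  qed
  obtain q where q: "p = [:- x, 1:] * q"
    using p(3) by (auto simp: poly_eq_0_iff_dvd)
  have "degree q \<noteq> 0"
  proof
    assume "degree q = 0"
    then obtain c where "q = [:c:]" by (auto elim: degree_eq_zeroE)
    hence p1: "p = [:- (x * c), c:]" and "c \<noteq> 0" using p q by auto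
    have "coeff p 0 \<in> range to_ac" "coeff p 1 \<in> range to_ac"
      using p(1) by (auto simp: graph_polys_def G_def image_iff)
    then obtain a b where h: "- (x * c) = to_ac a" "c = to_ac b"
      by (auto simp: p1)
    have "x * to_ac b = - to_ac a"
      using h by (metis minus_minus)
    moreover have "to_ac b \<noteq> 0"
      using h \<open>c \<noteq> 0\<close> by simp
    ultimately have "x = to_ac (- a / b)" by (simp add: field_simps)
    thus False using x by blast
  qed
  then obtain y where y: "poly q y = 0"
    using alg_closed_imp_poly_has_root[of q] by blast
  have "y \<noteq> x"
  proof
    assume "y = x"
    hence "poly (pderiv p) x = 0"
      using y unfolding q by (simp add: pderiv_mult pderiv_pCons del: mult_pCons_left)
    thus False using \<open>poly (pderiv p) x \<noteq> 0\<close> by simp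
  qed
  have "poly p' y = 0" using y by (simp add: pp q del: mult_pCons_left)
  hence "\<exists>H. field_graph H \<and> G \<subseteq> H \<and> (x, y) \<in> H"
    by (intro graph_extend[OF G, of p p']) (use p min in auto)
  then obtain H where H: "field_graph H" "(x, y) \<in> H"
    by blast
  obtain \<sigma> where \<sigma>: "\<sigma> \<in> galois_aut" "\<forall>(x, y) \<in> H. \<sigma> x = y"
    using field_graph_imp_galois_aut[OF H(1)] by blast
  hence "\<sigma> x = y" using H(2) by (auto dest: bspec)
  thus False using assms[OF \<sigma>(1)] \<open>y \<noteq> x\<close> by simp
qed

lemma poly_galois_fixed_imp_base:
  fixes p :: "'k :: field_char_0 alg_closure poly"
  assumes "\<And>\<sigma>. \<sigma> \<in> galois_aut \<Longrightarrow> map_poly \<sigma> p = p"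
  obtains q where "p = map_poly to_ac q"
proof
  have "coeff p i \<in> range to_ac" for i
  proof (rule galois_fixed_imp_base)
    fix \<sigma> :: "'k alg_closure \<Rightarrow> 'k alg_closure"
    assume \<sigma>: "\<sigma> \<in> galois_aut"
    have "\<sigma> (to_ac 0) = to_ac 0" using \<sigma> unfolding galois_aut_def by blast
    hence "\<sigma> 0 = 0" by simp
    thus "\<sigma> (coeff p i) = coeff p i"
      using assms[OF \<sigma>] by (metis coeff_map_poly)
  qed
  thus "p = map_poly to_ac (map_poly of_ac p)"
    by (intro poly_eqI) (simp add: coeff_map_poly to_ac_of_ac)
qed

section \<open>Galois descent for the points of the divisor\<close>

lemma degree_prod_linear: "finite T \<Longrightarrow> degree (\<Prod>x\<in>T. [:- x, 1 :: 'a :: idom:]) = card T"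
  by (subst degree_prod_eq_sum_degree) auto

lemma poly_interpolation:
  fixes s :: "'a :: field \<Rightarrow> 'a"
  assumes "finite T"
  shows "\<exists>V. (\<forall>i\<ge>card T. coeff V i = 0) \<and> (\<forall>x\<in>T. poly V x = s x)"
  using assms
proof induction
  case empty
  show ?case by (intro exI[of _ 0]) auto
next
  case (insert x T)
  then obtain V where V: "\<forall>i\<ge>card T. coeff V i = 0" "\<forall>x\<in>T. poly V x = s x" by blast
  define p where "p = (\<Prod>t\<in>T. [:- t, 1:])"
  have px: "poly p x \<noteq> 0" using insert by (auto simp: p_def poly_prod)
  have pT: "poly p t = 0" if "t \<in> T" for t using insert that by (auto simp: p_def poly_prod)
  have dp: "degree p = card T" unfolding p_def by (rule degree_prod_linear) fact
  define W where "W = V + smult ((s x - poly V x) / poly p x) p"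
  have "coeff W i = 0" if "i \<ge> card (insert x T)" for i
    using that insert V(1) dp by (simp add: W_def coeff_eq_0)
  moreover have "poly W t = s t" if "t \<in> insert x T" for t
    using that V(2) px pT by (auto simp: W_def)
  ultimately show ?case by blast
qed

lemma poly_eq_0_of_card_roots:
  fixes p :: "'a :: idom poly"
  assumes "finite T" "\<And>i. i \<ge> card T \<Longrightarrow> coeff p i = 0" "\<And>x. x \<in> T \<Longrightarrow> poly p x = 0"
  shows "p = 0"
proof (rule ccontr)
  assume p: "p \<noteq> 0"
  have "card T \<le> card {x. poly p x = 0}"
    using assms(3) by (intro card_mono poly_roots_finite p) auto
  also have "\<dots> \<le> degree p" by (rule card_poly_roots_bound) fact
  finally have "coeff p (degree p) = 0" by (rule assms(2))
  thus False using p by simp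
qed

lemma galois_aut_hom:
  assumes "\<sigma> \<in> galois_aut"
  shows "comm_ring_hom \<sigma>"
proof
  have "\<sigma> (to_ac 0) = to_ac 0" "\<sigma> (to_ac 1) = to_ac 1" using assms unfolding galois_aut_def by blast+
  thus "\<sigma> 0 = 0" "\<sigma> 1 = 1" by simp_all
qed (use assms in \<open>auto simp: galois_aut_def\<close>)

lemma count_image_inj:
  assumes "inj \<phi>"
  shows "count (image_mset \<phi> M) (\<phi> x) = count M x"
proof (cases "x \<in># M")
  case True
  have "\<phi> -` {\<phi> x} \<inter> set_mset M = {x}" using assms(1) True by (auto simp: inj_def)
  thus ?thesis by (simp add: count_image_mset)
next
  case False
  hence "\<phi> x \<notin># image_mset \<phi> M" using assms(1) by (auto simp: inj_def)
  hence "count (image_mset \<phi> M) (\<phi> x) = 0" by (rule not_in_iff[THEN iffD1])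
  thus ?thesis using False by (simp only: not_in_iff)
qed

lemma count_image_mset_stable:
  assumes "inj \<phi>" "image_mset \<phi> M = M"
  shows "count M (\<phi> x) = count M x"
  using count_image_inj[OF assms(1), of M x] assms(2) by simp

lemma prod_mset_even_odd:
  fixes p :: "'b \<Rightarrow> 'a :: comm_semiring_1"
  shows "(\<Prod>x\<in>#M. p x) =
    (\<Prod>x | odd (count M x). p x) * (\<Prod>x\<in>set_mset M. p x ^ (count M x div 2)) ^ 2"
proof -
  have "(\<Prod>x\<in>#M. p x) = (\<Prod>x\<in>set_mset M. p x ^ count M x)"
    by (rule image_prod_mset_multiplicity)
  also have "\<dots> = (\<Prod>x\<in>set_mset M. (if odd (count M x) then p x else 1) * (p x ^ (count M x div 2)) ^ 2)"
  proof (intro prod.cong refl)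
    fix x
    have "count M x = (if odd (count M x) then 1 else 0) + count M x div 2 * 2" by presburger
    hence "p x ^ count M x = p x ^ ((if odd (count M x) then 1 else 0) + count M x div 2 * 2)" by simp
    thus "p x ^ count M x = (if odd (count M x) then p x else 1) * (p x ^ (count M x div 2)) ^ 2"
      unfolding power_add power_mult by simp
  qed
  also have "\<dots> = (\<Prod>x\<in>set_mset M. if odd (count M x) then p x else 1) *
      (\<Prod>x\<in>set_mset M. p x ^ (count M x div 2)) ^ 2"
    by (simp only: prod.distrib prod_power_distrib)
  also have "(\<Prod>x\<in>set_mset M. if odd (count M x) then p x else 1) = (\<Prod>x\<in>{x \<in> set_mset M. odd (count M x)}. p x)"
    by (rule prod.inter_filter[symmetric]) simp
  also have "{x \<in> set_mset M. odd (count M x)} = {x. odd (count M x)}"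
    by (auto simp flip: count_greater_zero_iff intro!: Nat.gr0I)
  finally show ?thesis .
qed

lemma galois_prod_mset:
  assumes "\<sigma> \<in> galois_aut"
  shows "\<sigma> (prod_mset M) = prod_mset (image_mset \<sigma> M)"
proof -
  interpret comm_ring_hom \<sigma> by (rule galois_aut_hom) fact
  show ?thesis by (induction M) (auto simp: hom_mult)
qed

lemma galois_prod_linear_power:
  assumes \<sigma>: "\<sigma> \<in> galois_aut" and T: "\<sigma> ` T = T" and e: "\<And>x. e (\<sigma> x) = e x"
  shows "map_poly \<sigma> (\<Prod>x\<in>T. [:- x, 1:] ^ e x) = (\<Prod>x\<in>T. [:- x, 1:] ^ (e x :: nat))"
proof -
  interpret comm_ring_hom \<sigma> by (rule galois_aut_hom) fact
  interpret mp: map_poly_comm_ring_hom \<sigma> ..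
  have inj: "inj \<sigma>" using \<sigma> by (auto simp: galois_aut_def bij_def)
  have "map_poly \<sigma> (\<Prod>x\<in>T. [:- x, 1:] ^ e x) = (\<Prod>x\<in>T. [:- \<sigma> x, 1:] ^ e (\<sigma> x))"
    by (simp add: mp.hom_prod mp.hom_power e map_poly_pCons_hom hom_uminus)
  also have "\<dots> = (\<Prod>x\<in>\<sigma> ` T. [:- x, 1:] ^ e x)"
    by (subst prod.reindex) (auto intro: inj_on_subset[OF inj])
  finally show ?thesis unfolding T .
qed

text \<open>U collects the x of odd multiplicity, S half of the remaining multiplicities. The
  z-coordinates over the zeros of U are selected by a rule that commutes with the Galois action, so
  the interpolating V, unique below its degree bound, descends to K together with U, S and the
  product of the z.\<close>

lemma galois_stable_points:
  fixes F :: "'k :: field_char_0 poly" and D :: "('k alg_closure \<times> 'k alg_closure) multiset"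
  assumes stable: "\<And>\<sigma>. \<sigma> \<in> galois_aut \<Longrightarrow> image_mset (map_prod \<sigma> \<sigma>) D = D"
    and curve: "\<And>x z. (x, z) \<in># D \<Longrightarrow> z ^ 2 = poly (map_poly to_ac F) x"
    and nz: "\<And>x z. (x, z) \<in># D \<Longrightarrow> z \<noteq> 0"
  obtains U S V w where "(\<Prod>p\<in>#D. [:- fst p, 1:]) = map_poly to_ac (U * S ^ 2)"
    "(V * V) mod U = F mod U" "to_ac w = (\<Prod>p\<in>#D. snd p)"
proof -
  define R where "R = image_mset fst D"
  define T where "T = {x. odd (count R x)}"
  have TR: "T \<subseteq> set_mset R"
    by (auto simp: T_def simp flip: count_greater_zero_iff intro!: Nat.gr0I)
  hence T: "finite T" using finite_subset by blast
  have inj: "inj \<sigma>" "surj \<sigma>" if "\<sigma> \<in> galois_aut" for \<sigma> :: "'k alg_closure \<Rightarrow> 'k alg_closure"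
    using that by (auto simp: galois_aut_def bij_def)
  have cD: "count D (\<sigma> x, \<sigma> z) = count D (x, z)" if "\<sigma> \<in> galois_aut" for \<sigma> x z
    using count_image_mset_stable[OF _ stable[OF that], of "(x, z)"] inj(1)[OF that]
    by (simp add: prod.inj_map)
  have cR: "count R (\<sigma> x) = count R x" if "\<sigma> \<in> galois_aut" for \<sigma> x
  proof (rule count_image_mset_stable)
    show "inj \<sigma>" by (rule inj) fact
    have "image_mset \<sigma> R = image_mset fst (image_mset (map_prod \<sigma> \<sigma>) D)"
      by (simp add: R_def image_mset.compositionality o_def)
    thus "image_mset \<sigma> R = R" by (simp add: stable[OF that] R_def)
  qed
  have im: "\<sigma> ` {x. P (count R x)} = {x. P (count R x)}" if "\<sigma> \<in> galois_aut" for \<sigma> P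
  proof (intro equalityI subsetI)
    fix y assume y: "y \<in> {x. P (count R x)}"
    have "\<exists>x. y = \<sigma> x" using surjD[OF inj(2)[OF that], of y] .
    then obtain x where "y = \<sigma> x" ..
    thus "y \<in> \<sigma> ` {x. P (count R x)}" using y cR[OF that, of x] by auto
  qed (auto simp: cR[OF that])
  have setR: "set_mset R = {x. count R x > 0}" by (auto simp: count_greater_zero_iff)
  \<comment> \<open>Above x lie at most z and -z, which differ as z is nonzero in characteristic 0.
    Their multiplicities have an odd sum, so exactly one of the two prevails; this selects a square
    root without a choice of sign.\<close>
  have sx: "\<exists>!z. count D (x, z) > count D (x, - z)" if x: "x \<in> T" for x
  proof -
    have "x \<in># R" using TR x by blast
    then obtain z where z: "(x, z) \<in># D" by (auto simp: R_def)
    have cases: "y = z \<or> y = - z" if "(x, y) \<in># D" for y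
      using curve[OF that] curve[OF z] by (metis power2_eq_iff)
    have ne: "z \<noteq> - z"
    proof
      assume "z = - z"
      hence "2 * z = 0" by (metis mult_2 add.right_inverse)
      thus False using nz[OF z] by simp
    qed
    have "count R x = sum (count D) (fst -` {x} \<inter> set_mset D)"
      by (simp add: R_def count_image_mset)
    also have "\<dots> = sum (count D) {(x, z), (x, - z)}"
      by (intro sum.mono_neutral_left) (auto simp: not_in_iff dest: cases)
    also have "\<dots> = count D (x, z) + count D (x, - z)" using ne by simp
    finally have "count D (x, z) \<noteq> count D (x, - z)" using x by (auto simp: T_def)
    moreover have mem: "y = z \<or> y = - z" if "count D (x, y) > count D (x, - y)" for y
      using that by (intro cases) (metis gr_zeroI not_in_iff not_less_zero)
    ultimately consider "count D (x, z) > count D (x, - z)" | "count D (x, - z) > count D (x, z)"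
      by linarith
    thus ?thesis
    proof cases
      case 1
      show ?thesis using 1 mem by (intro ex1I[of _ z]) fastforce+
    next
      case 2
      show ?thesis using 2 mem by (intro ex1I[of _ "- z"]) fastforce+
    qed
  qed
  define s where "s = (\<lambda>x. THE z. count D (x, z) > count D (x, - z))"
  have s: "count D (x, s x) > count D (x, - s x)" if "x \<in> T" for x
    unfolding s_def by (rule theI'[OF sx[OF that]])
  have s_eq: "s x = z" if "x \<in> T" "count D (x, z) > count D (x, - z)" for x z
    unfolding s_def by (rule the1_equality[OF sx[OF that(1)] that(2)])
  have s_mem: "(x, s x) \<in># D" if "x \<in> T" for x
    using s[OF that] by (metis gr_zeroI not_in_iff not_less_zero)
  have s_\<sigma>: "s (\<sigma> x) = \<sigma> (s x)" if \<sigma>: "\<sigma> \<in> galois_aut" and x: "x \<in> T" for \<sigma> x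
  proof (rule s_eq)
    interpret comm_ring_hom \<sigma> by (rule galois_aut_hom) fact
    show "\<sigma> x \<in> T" using x cR[OF \<sigma>, of x] by (simp add: T_def)
    show "count D (\<sigma> x, \<sigma> (s x)) > count D (\<sigma> x, - \<sigma> (s x))"
      using s[OF x] cD[OF \<sigma>, of x "s x"] cD[OF \<sigma>, of x "- s x"] by (simp add: hom_uminus)
  qed
  obtain V' where V': "\<forall>i\<ge>card T. coeff V' i = 0" "\<forall>x\<in>T. poly V' x = s x"
    using poly_interpolation[OF T] by blast
  have V'_fixed: "map_poly \<sigma> V' = V'" if \<sigma>: "\<sigma> \<in> galois_aut" for \<sigma>
  proof -
    interpret comm_ring_hom \<sigma> by (rule galois_aut_hom) fact
    have "map_poly \<sigma> V' - V' = 0"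
    proof (rule poly_eq_0_of_card_roots[OF T])
      fix i assume "i \<ge> card T"
      thus "coeff (map_poly \<sigma> V' - V') i = 0" using V'(1) by (simp add: coeff_map_poly)
    next
      fix y assume y: "y \<in> T"
      then obtain x where x: "x \<in> T" "y = \<sigma> x" using im[OF \<sigma>, of odd] by (auto simp: T_def)
      show "poly (map_poly \<sigma> V' - V') y = 0"
        using V'(2) x y s_\<sigma>[OF \<sigma> x(1)] by (simp add: poly_map_poly)
    qed
    thus ?thesis by simp
  qed
  obtain V where V: "V' = map_poly to_ac V"
    using poly_galois_fixed_imp_base[OF V'_fixed] by blast
  define U' S' where "U' = (\<Prod>x\<in>T. [:- x, 1:])" and "S' = (\<Prod>x\<in>set_mset R. [:- x, 1:] ^ (count R x div 2))"
  have "map_poly \<sigma> U' = U'" if "\<sigma> \<in> galois_aut" for \<sigma>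
    using galois_prod_linear_power[OF that im[OF that, of odd], of "\<lambda>_. 1"] by (simp add: U'_def T_def)
  then obtain U where U: "U' = map_poly to_ac U" by (rule poly_galois_fixed_imp_base)
  have "map_poly \<sigma> S' = S'" if "\<sigma> \<in> galois_aut" for \<sigma>
    unfolding S'_def setR
    by (rule galois_prod_linear_power[OF that im[OF that, of "\<lambda>n. n > 0"]]) (simp add: cR[OF that])
  then obtain S where S: "S' = map_poly to_ac S" by (rule poly_galois_fixed_imp_base)
  have "(\<Prod>p\<in>#D. [:- fst p, 1:]) = (\<Prod>x\<in>#R. [:- x, 1:])"
    by (simp add: R_def image_mset.compositionality o_def)
  also have "\<dots> = U' * S' ^ 2"
    by (subst prod_mset_even_odd) (simp add: U'_def S'_def T_def)
  finally have 1: "(\<Prod>p\<in>#D. [:- fst p, 1:]) = map_poly to_ac (U * S ^ 2)"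
    by (simp add: U S map_poly_to_ac_mult map_poly_to_ac_power)
  define r where "r = (V * V - F) mod U"
  define q where "q = (V * V - F) div U"
  have qr: "V * V = U * q + r + F" by (simp add: q_def r_def)
  have dU: "degree U = card T"
  proof -
    have "degree U' = card T" unfolding U'_def by (rule degree_prod_linear) fact
    thus ?thesis using U by simp
  qed
  have "U' \<noteq> 0" using T by (simp add: U'_def)
  hence U0: "U \<noteq> 0" using U by auto
  \<comment> \<open>The remainder has degree below the number of zeros of U' and vanishes at all of
    them, because V(x)^2 = s(x)^2 = F(x) there; the zeros of U' are simple.\<close>
  have "map_poly to_ac r = 0"
  proof (rule poly_eq_0_of_card_roots[OF T])
    fix i assume i: "i \<ge> card T"
    have "r = 0 \<or> degree r < degree U" unfolding r_def using U0 by (rule degree_mod_less)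
    hence "coeff r i = 0" using i dU by (auto simp: coeff_eq_0)
    thus "coeff (map_poly to_ac r) i = 0" by (simp add: coeff_map_poly)
  next
    fix x assume x: "x \<in> T"
    have "poly (map_poly to_ac (V * V)) x = poly (map_poly to_ac (U * q + r + F)) x"
      using qr by simp
    hence "s x ^ 2 = poly U' x * poly (map_poly to_ac q) x + poly (map_poly to_ac r) x + poly (map_poly to_ac F) x"
      using V'(2) x by (simp add: map_poly_to_ac_mult map_poly_to_ac_add power2_eq_square flip: U V)
    moreover have "poly U' x = 0" using x T by (auto simp: U'_def poly_prod)
    ultimately show "poly (map_poly to_ac r) x = 0"
      using curve[OF s_mem[OF x]] by simp
  qed
  hence "r = 0" by simp
  hence "V * V - F = U * q" using qr by simp
  hence "U dvd V * V - F" by (rule dvdI)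
  hence 2: "(V * V) mod U = F mod U" by (simp add: mod_eq_dvd_iff)
  have "(\<Prod>p\<in>#D. snd p) \<in> range to_ac"
  proof (rule galois_fixed_imp_base)
    fix \<sigma> :: "'k alg_closure \<Rightarrow> 'k alg_closure" assume \<sigma>: "\<sigma> \<in> galois_aut"
    have "\<sigma> (\<Prod>p\<in>#D. snd p) = prod_mset (image_mset snd (image_mset (map_prod \<sigma> \<sigma>) D))"
      unfolding galois_prod_mset[OF \<sigma>] by (simp add: image_mset.compositionality o_def)
    thus "\<sigma> (\<Prod>p\<in>#D. snd p) = (\<Prod>p\<in>#D. snd p)" by (simp add: stable[OF \<sigma>])
  qed
  then obtain w where 3: "to_ac w = (\<Prod>p\<in>#D. snd p)" by auto
  show ?thesis by (rule that[OF 1 2 3])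
qed

text \<open>The inverse of a is the preimage of 1 under multiplication by a, so its coordinates are
  the first column of the adjugate divided by the norm.\<close>

lemma nrm_nonzero_imp_inverse:
  fixes f a :: "'k :: field poly"
  assumes f: "degree f > 0" and a: "nrm f a \<noteq> 0"
  obtains b where "\<And>i. i \<ge> degree f \<Longrightarrow> coeff b i = 0" "(a * b) mod f = 1"
proof -
  let ?n = "degree f"
  define M where "M = mul_mat f a"
  define v where "v = inverse (nrm f a) \<cdot>\<^sub>v col (adj_mat M) 0"
  have M: "M \<in> carrier_mat ?n ?n" by (simp add: M_def)
  have adj: "adj_mat M \<in> carrier_mat ?n ?n" using adj_mat[OF M] by simp
  have "M * adj_mat M = det M \<cdot>\<^sub>m 1\<^sub>m ?n" using adj_mat[OF M] by simp
  hence "col (M * adj_mat M) 0 = col (nrm f a \<cdot>\<^sub>m 1\<^sub>m ?n) 0" by (simp add: nrm_def M_def)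
  moreover have "col (M * adj_mat M) 0 = M *\<^sub>v col (adj_mat M) 0"
    using M adj f by (intro col_mult2) auto
  ultimately have Mv: "M *\<^sub>v col (adj_mat M) 0 = nrm f a \<cdot>\<^sub>v unit_vec ?n 0"
    using f by (simp add: col_smult)
  define b where "b = (\<Sum>k<?n. monom (v $ k) k)"
  have b: "coeff b i = (if i < ?n then v $ i else 0)" for i
    by (simp add: b_def coeff_sum)
  have v: "v \<in> carrier_vec ?n" using adj f by (auto simp: v_def)
  have "(a * b) mod f = 1"
  proof (rule poly_eqI)
    fix i
    show "coeff ((a * b) mod f) i = coeff 1 i"
    proof (cases "i < ?n")
      case True
      have "(a * b) mod f = (\<Sum>k<?n. smult (coeff b k) ((a * monom 1 k) mod f))"
        by (rule mult_mod_poly_expand) (simp add: b)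
      hence "coeff ((a * b) mod f) i = (\<Sum>k<?n. v $ k * coeff ((a * monom 1 k) mod f) i)"
        by (simp add: coeff_sum b)
      also have "\<dots> = (M *\<^sub>v v) $ i"
        using True v by (simp add: M_def mul_mat_def coef_mat_def scalar_prod_def mult.commute lessThan_atLeast0)
      also have "M *\<^sub>v v = inverse (nrm f a) \<cdot>\<^sub>v (nrm f a \<cdot>\<^sub>v unit_vec ?n 0)"
        unfolding v_def using Mv mult_mat_vec[OF M, of "col (adj_mat M) 0"] adj f by simp
      also have "\<dots> $ i = coeff 1 i" using a True f by (auto simp: coeff_1)
      finally show ?thesis .
    next
      case False
      thus ?thesis using f by (simp add: coeff_mod_eq_0 coeff_1)
    qed
  qed
  thus ?thesis using that[of b] b by simp
qed

lemma nrm_nonzero_imp_bezout: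
  fixes f a :: "'k :: field poly"
  assumes "degree f > 0" "nrm f a \<noteq> 0"
  obtains x y where "x * f + y * a = 1"
proof -
  obtain b where "(a * b) mod f = 1" using nrm_nonzero_imp_inverse[OF assms] by blast
  hence "a * b = f * ((a * b) div f) + 1" by (metis mult_div_mod_eq)
  hence "(- ((a * b) div f)) * f + b * a = 1" by (simp add: algebra_simps)
  thus ?thesis by (rule that)
qed

section \<open>The orbit attached to a pair\<close>

lemma coeff_dehom_x: "coeff (dehom_x n c) i = (if i \<le> n then c (n - i) else 0)"
proof -
  have "coeff (dehom_x n c) i = (\<Sum>j\<le>n. if j = n - i \<and> i \<le> n then c (n - i) else 0)"
    unfolding dehom_x_def coeff_sum by (intro sum.cong refl) auto
  also have "\<dots> = (if i \<le> n then c (n - i) else 0)"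
    by (cases "i \<le> n") auto
  finally show ?thesis .
qed

lemma dehom_x_lead:
  assumes "c 0 \<noteq> 0"
  shows "degree (dehom_x n c) = n" "lead_coeff (dehom_x n c) = c 0"
proof -
  show *: "degree (dehom_x n c) = n"
    by (rule antisym) (use assms in \<open>auto intro!: degree_le le_degree simp: coeff_dehom_x\<close>)
  show "lead_coeff (dehom_x n c) = c 0" unfolding * by (simp add: coeff_dehom_x)
qed

lemma bivariate_poly_eqI:
  fixes p q :: "'k :: field_char_0 poly poly"
  assumes "\<And>x y. poly (poly p [:x:]) y = poly (poly q [:x:]) y"
  shows "p = q"
proof (rule ccontr)
  assume "p \<noteq> q"
  hence "finite {u. poly (p - q) u = 0}" by (intro poly_roots_finite) auto
  moreover have "range (\<lambda>x. [:x:]) \<subseteq> {u. poly (p - q) u = 0}"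
    using poly_eqI_cofinite[of "{}"] assms by fastforce
  ultimately have "finite (range (\<lambda>x :: 'k. [:x:]))" by (rule finite_subset[rotated])
  hence "finite (UNIV :: 'k set)" by (rule finite_imageD) (auto simp: inj_def)
  thus False using infinite_UNIV_char_0 by blast
qed

lemma bivariate_eval_hom: "comm_ring_hom (\<lambda>p. poly (poly p [:x:]) (y :: 'k :: comm_ring_1))"
  by unfold_locales auto

section \<open>The congruence action and its orbits\<close>

lemma conj_mat_mult:
  fixes P :: "'a :: comm_ring_1 mat"
  assumes "P \<in> carrier_mat n n" "k \<in> carrier_mat n n" "l \<in> carrier_mat n n"
  shows "transpose_mat l * (transpose_mat k * P * k) * l = transpose_mat (k * l) * P * (k * l)"
proof -
  have "transpose_mat (k * l) * P * (k * l) = transpose_mat l * transpose_mat k * P * (k * l)"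
    using assms by (simp add: transpose_mult)
  also have "\<dots> = transpose_mat l * (transpose_mat k * P) * (k * l)"
    using assms by (simp add: assoc_mult_mat[of _ n n _ n _ n])
  also have "\<dots> = transpose_mat l * (transpose_mat k * P * k) * l"
    using assms by (simp add: assoc_mult_mat[of _ n n _ n _ n])
  finally show ?thesis by simp
qed

lemma SL_mat_inverse:
  fixes k :: "'k :: field mat"
  assumes "k \<in> SL_mat n"
  obtains h where "h \<in> SL_mat n" "h * k = 1\<^sub>m n" "k * h = 1\<^sub>m n"
proof
  have k: "k \<in> carrier_mat n n" "det k = 1" using assms by (auto simp: SL_mat_def)
  note adj = adj_mat[OF k(1)]
  have "(1 :: 'k) \<cdot>\<^sub>m 1\<^sub>m n = 1\<^sub>m n" by (rule eq_matI) auto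
  thus 1: "adj_mat k * k = 1\<^sub>m n" "k * adj_mat k = 1\<^sub>m n"
    using adj k by simp_all
  have "det (adj_mat k * k) = det (adj_mat k) * det k" by (rule det_mult) (use adj k in auto)
  hence "det (adj_mat k) = 1" unfolding 1 using k by simp
  thus "adj_mat k \<in> SL_mat n" using adj by (auto simp: SL_mat_def)
qed

lemma SL_act_eq:
  fixes h k :: "'k :: field mat"
  assumes "h \<in> carrier_mat n n" "k \<in> carrier_mat n n" "h * k = 1\<^sub>m n" "k * h = 1\<^sub>m n"
  shows "SL_act h (P, Q) = (transpose_mat k * P * k, transpose_mat k * Q * k)"
proof -
  have "mat_inverse h \<noteq> None"
  proof
    assume "mat_inverse h = None"
    hence "h \<notin> Units (ring_mat TYPE('k) n ())" by (rule mat_inverse(1)[OF assms(1)])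
    thus False using assms by (auto simp: Units_def ring_mat_def)
  qed
  then obtain l where l: "mat_inverse h = Some l" by blast
  have l': "h * l = 1\<^sub>m n" "l \<in> carrier_mat n n" using mat_inverse(2)[OF assms(1) l] by auto
  have "l = (k * h) * l" using assms l' by simp
  also have "\<dots> = k * (h * l)" using assms l' by (intro assoc_mult_mat)
  also have "\<dots> = k" using assms l' by simp
  finally have "l = k" .
  thus ?thesis by (simp add: SL_act_def l)
qed

text \<open>Inversion permutes the matrices of determinant 1, so the inverse in
  \<open>SL_act\<close> may be dropped when the whole orbit is described.\<close>

lemma SL_orbit_eq:
  "SL_orbit n (P, Q) = (\<lambda>k. (transpose_mat k * P * k, transpose_mat k * Q * k)) ` SL_mat n"
proof (intro equalityI subsetI)
  fix v assume "v \<in> SL_orbit n (P, Q)"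
  then obtain h where h: "h \<in> SL_mat n" "v = SL_act h (P, Q)" by (auto simp: SL_orbit_def)
  obtain k where k: "k \<in> SL_mat n" "k * h = 1\<^sub>m n" "h * k = 1\<^sub>m n" using SL_mat_inverse[OF h(1)] by blast
  have "v = (transpose_mat k * P * k, transpose_mat k * Q * k)"
    unfolding h(2) by (rule SL_act_eq) (use h k in \<open>auto simp: SL_mat_def\<close>)
  thus "v \<in> (\<lambda>k. (transpose_mat k * P * k, transpose_mat k * Q * k)) ` SL_mat n" using k(1) by blast
next
  fix v assume "v \<in> (\<lambda>k. (transpose_mat k * P * k, transpose_mat k * Q * k)) ` SL_mat n"
  then obtain k where k: "k \<in> SL_mat n" "v = (transpose_mat k * P * k, transpose_mat k * Q * k)" by blast
  obtain h where h: "h \<in> SL_mat n" "h * k = 1\<^sub>m n" "k * h = 1\<^sub>m n" using SL_mat_inverse[OF k(1)] by blast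
  have "SL_act h (P, Q) = v"
    unfolding k(2) by (rule SL_act_eq) (use h k in \<open>auto simp: SL_mat_def\<close>)
  thus "v \<in> SL_orbit n (P, Q)" using h(1) by (auto simp: SL_orbit_def)
qed

lemma SL_orbit_subset:
  fixes P Q :: "'k :: field mat"
  assumes "P \<in> carrier_mat n n" "Q \<in> carrier_mat n n" "k \<in> SL_mat n"
  shows "SL_orbit n (transpose_mat k * P * k, transpose_mat k * Q * k) \<subseteq> SL_orbit n (P, Q)"
proof
  fix v assume "v \<in> SL_orbit n (transpose_mat k * P * k, transpose_mat k * Q * k)"
  then obtain l where l: "l \<in> SL_mat n"
    and v: "v = (transpose_mat l * (transpose_mat k * P * k) * l, transpose_mat l * (transpose_mat k * Q * k) * l)"
    unfolding SL_orbit_eq by blast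
  have "k * l \<in> SL_mat n"
    using l assms(3) by (auto simp: SL_mat_def det_mult)
  moreover have "v = (transpose_mat (k * l) * P * (k * l), transpose_mat (k * l) * Q * (k * l))"
    unfolding v using assms l by (simp add: conj_mat_mult SL_mat_def)
  ultimately show "v \<in> SL_orbit n (P, Q)" unfolding SL_orbit_eq by blast
qed

lemma SL_orbit_self:
  fixes P Q :: "'k :: field mat"
  assumes "P \<in> carrier_mat n n" "Q \<in> carrier_mat n n"
  shows "(P, Q) \<in> SL_orbit n (P, Q)"
proof -
  have "1\<^sub>m n \<in> SL_mat n" by (simp add: SL_mat_def)
  moreover have "(P, Q) = (transpose_mat (1\<^sub>m n) * P * 1\<^sub>m n, transpose_mat (1\<^sub>m n) * Q * 1\<^sub>m n)"
    using assms by simp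
  ultimately show ?thesis unfolding SL_orbit_eq by blast
qed

section \<open>Gram pairs in adapted bases\<close>

context
  fixes n :: nat and c :: "nat \<Rightarrow> 'k :: field_char_0" and f :: "'k poly"
  assumes n: "n > 0" and c0: "c 0 \<noteq> 0"
  defines "f \<equiv> dehom_x n c"
begin

lemma degree_f: "degree f = n" and lead_f: "coeff f n = c 0"
  using dehom_x_lead[of c n] c0 by (simp_all add: f_def)

lemma Lf_norm_eq: "Lf_norm n c (Lf_class n c a) = nrm f a"
proof -
  have "Lf_norm n c (Lf_class n c a) = nrm f (a mod f)"
    unfolding Lf_norm_def nrm_def mul_mat_def coef_mat_def degree_f
    by (simp add: Lf_def Lf_class_def mod_mult_right_eq flip: f_def)
  thus ?thesis by simp
qed

lemma adapted_bases_iff: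
  "b \<in> adapted_bases n c z \<longleftrightarrow> (\<forall>j<n. \<forall>i\<ge>n. coeff (b j) i = 0) \<and> det (coef_mat n b) = z"
proof -
  have "b j \<in> carrier (Lf n c) \<longleftrightarrow> (\<forall>i\<ge>n. coeff (b j) i = 0)" for j
  proof
    assume "b j \<in> carrier (Lf n c)"
    hence "b j = b j mod f" by (simp add: Lf_def f_def)
    thus "\<forall>i\<ge>n. coeff (b j) i = 0"
      using coeff_mod_eq_0[of f _ "b j"] degree_f n by metis
  next
    assume *: "\<forall>i\<ge>n. coeff (b j) i = 0"
    have "degree (b j) < n"
      using * n by (metis leading_coeff_0_iff degree_0 not_le)
    thus "b j \<in> carrier (Lf n c)" by (simp add: Lf_def mod_poly_less degree_f flip: f_def)
  qed
  thus ?thesis unfolding adapted_bases_def coef_mat_def by auto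
qed

lemma gram_pair_eq:
  "gram_pair n c (Lf_class n c a) b = (gram f a b, gram f (monom 1 1 * a) b)"
proof -
  have r: "inverse (c 0) * Lf_tau n (p mod f) = rho f p" for p
    by (simp add: rho_def Lf_tau_def degree_f lead_f field_simps)
  have mult: "p \<otimes>\<^bsub>Lf n c\<^esub> q = (p * q) mod f" for p q by (simp add: Lf_def f_def)
  have 1: "Lf_class n c a \<otimes>\<^bsub>Lf n c\<^esub> b i \<otimes>\<^bsub>Lf n c\<^esub> b j = (a * b i * b j) mod f" for i j
    unfolding mult Lf_class_def f_def[symmetric] by (simp only: mod_mult_left_eq mod_mult_right_eq)
  have 2: "Lf_class n c [:0, 1:] \<otimes>\<^bsub>Lf n c\<^esub> Lf_class n c a \<otimes>\<^bsub>Lf n c\<^esub> b i \<otimes>\<^bsub>Lf n c\<^esub> b j =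
      (monom 1 1 * a * b i * b j) mod f" for i j
  proof -
    have m: "monom (1 :: 'k) 1 = [:0, 1:]" by (simp add: monom_altdef)
    show ?thesis unfolding m mult Lf_class_def f_def[symmetric]
      by (simp only: mod_mult_left_eq mod_mult_right_eq)
  qed
  show ?thesis unfolding gram_pair_def 1 2 r gram_def degree_f by simp
qed

lemma norm_pairsI:
  assumes "z \<noteq> 0" "z ^ 2 * nrm f a = c 0 ^ (n + 1)"
  shows "(Lf_class n c a, z) \<in> norm_pairs n c"
proof -
  have "nrm f a \<noteq> 0" using assms c0 by auto
  then obtain b where b: "\<And>i. i \<ge> n \<Longrightarrow> coeff b i = 0" "(a * b) mod f = 1"
    using nrm_nonzero_imp_inverse[of f a] degree_f n by metis
  have "b mod f mod f = b mod f" "a mod f mod f = a mod f" by simp_all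
  moreover have "(a mod f * (b mod f)) mod f = 1 mod f" "(b mod f * (a mod f)) mod f = 1 mod f"
    using b(2) n degree_f by (simp_all add: mod_mult_eq mult.commute mod_poly_less)
  ultimately have "Lf_class n c a \<in> Units (Lf n c)"
    unfolding Units_def Lf_def Lf_class_def f_def[symmetric] by force
  thus ?thesis using assms Lf_norm_eq[of a] by (simp add: norm_pairs_def)
qed

text \<open>At scalars x, y the matrix P x - Q y is the Gram matrix of weight a (x - y X). Its
  determinant contains the norm of a times c(x,y) / c_0, and the condition on z is exactly what
  makes the constants cancel.\<close>

lemma gram_pair_in_V_form:
  assumes b: "b \<in> adapted_bases n c z" and z: "z ^ 2 * nrm f a = c 0 ^ (n + 1)"
  shows "(gram f a b, gram f (monom 1 1 * a) b) \<in> V_form n c"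
proof -
  have b': "\<And>i j. j < degree f \<Longrightarrow> i \<ge> degree f \<Longrightarrow> coeff (b j) i = 0" "det (coef_mat n b) = z"
    using b by (auto simp: adapted_bases_iff degree_f)
  let ?P = "gram f a b" and ?Q = "gram f (monom 1 1 * a) b"
  have sym: "transpose_mat (gram f w b) = gram f w b" for w
    by (rule eq_matI) (auto simp: gram_def mult_ac)
  have "invariant_form n ?P ?Q = binform n c"
  proof (rule bivariate_poly_eqI)
    fix x y :: 'k
    interpret e: comm_ring_hom "\<lambda>p. poly (poly p [:x:]) y" by (rule bivariate_eval_hom)
    let ?M = "[:0, 1:] \<cdot>\<^sub>m map_mat (\<lambda>r. [:[:r:]:]) ?P - [:[:0, 1:]:] \<cdot>\<^sub>m map_mat (\<lambda>r. [:[:r:]:]) ?Q"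
    let ?s = "(-1) ^ (n * (n - 1) div 2) :: 'k"
    have "map_mat (\<lambda>p. poly (poly p [:x:]) y) ?M = gram f (a * [:x, - y:]) b"
    proof (rule eq_matI)
      fix i j assume "i < dim_row (gram f (a * [:x, - y:]) b)" "j < dim_col (gram f (a * [:x, - y:]) b)"
      hence ij: "i < degree f" "j < degree f" by auto
      have e: "[:x, - y:] = smult x 1 - smult y (monom 1 1)" by (simp add: monom_altdef)
      have "a * [:x, - y:] * b i * b j = smult x (a * b i * b j) - smult y (monom 1 1 * a * b i * b j)"
        unfolding e by (simp only: algebra_simps mult_smult_left mult_smult_right mult_1_left mult_1_right)
      hence "rho f (a * [:x, - y:] * b i * b j) = x * rho f (a * b i * b j) - y * rho f (monom 1 1 * a * b i * b j)"
        by (simp only: rho_diff rho_smult)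
      thus "map_mat (\<lambda>p. poly (poly p [:x:]) y) ?M $$ (i, j) = gram f (a * [:x, - y:]) b $$ (i, j)"
        using ij by (simp add: gram_def)
    qed auto
    hence "poly (poly (det ?M) [:x:]) y = det (gram f (a * [:x, - y:]) b)"
      using e.hom_det[of ?M] by simp
    also have "\<dots> = z ^ 2 * (?s * inverse (c 0) ^ n * nrm f (a * [:x, - y:]))"
      using det_gram[of f b "a * [:x, - y:]"] b' n by (simp add: degree_f lead_f)
    also have "nrm f (a * [:x, - y:]) = nrm f a * nrm f [:x, - y:]"
      by (rule nrm_mult) (simp add: degree_f n)
    also have "nrm f [:x, - y:] = (\<Sum>i\<le>n. coeff f i * x ^ i * y ^ (n - i)) / c 0"
      using nrm_linear_form[of f x y] n by (simp add: degree_f lead_f)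
    also have "(\<Sum>i\<le>n. coeff f i * x ^ i * y ^ (n - i)) = (\<Sum>i\<le>n. c i * x ^ (n - i) * y ^ i)"
      by (rule sum.reindex_bij_witness[of _ "\<lambda>i. n - i" "\<lambda>i. n - i"]) (auto simp: f_def coeff_dehom_x)
    also have "z ^ 2 * (?s * inverse (c 0) ^ n * (nrm f a * ((\<Sum>i\<le>n. c i * x ^ (n - i) * y ^ i) / c 0))) =
        (z ^ 2 * nrm f a) * inverse (c 0) ^ (n + 1) * (?s * (\<Sum>i\<le>n. c i * x ^ (n - i) * y ^ i))"
      by (simp add: divide_inverse mult_ac)
    also have "\<dots> = ?s * (\<Sum>i\<le>n. c i * x ^ (n - i) * y ^ i)"
    proof -
      have "c 0 ^ (n + 1) * inverse (c 0) ^ (n + 1) = 1"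
        by (simp only: power_mult_distrib[symmetric] right_inverse[OF c0] power_one)
      thus ?thesis unfolding z by (simp only: mult_1_left)
    qed
    finally have "poly (poly (invariant_form n ?P ?Q) [:x:]) y =
        (?s * ?s) * (\<Sum>i\<le>n. c i * x ^ (n - i) * y ^ i)"
      by (simp add: invariant_form_def e.hom_mult e.hom_power mult.assoc)
    also have "?s * ?s = 1" by (simp flip: power_mult_distrib)
    finally show "poly (poly (invariant_form n ?P ?Q) [:x:]) y = poly (poly (binform n c) [:x:]) y"
      by (simp add: binform_def poly_sum poly_monom mult_ac)
  qed
  moreover have "gram f w b \<in> carrier_mat n n" for w
    using gram_carrier[of f w b] by (simp only: degree_f)
  ultimately show ?thesis unfolding V_form_def sym_pairs_def using sym by blast
qed

text \<open>Two bases with the same nonzero determinant z differ by a matrix of determinant 1. Hence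
  all orbits in the union lie in the orbit for b, which is one of them.\<close>

lemma orbit_of_pair_eq:
  assumes z: "z \<noteq> 0" and b: "b \<in> adapted_bases n c z"
  shows "orbit_of_pair n c (Lf_class n c a, z) = SL_orbit n (gram f a b, gram f (monom 1 1 * a) b)"
proof -
  have "SL_orbit n (gram f a b2, gram f (monom 1 1 * a) b2) \<subseteq> SL_orbit n (gram f a b, gram f (monom 1 1 * a) b)"
    if b2: "b2 \<in> adapted_bases n c z" for b2
  proof -
    let ?B = "coef_mat n b" and ?B2 = "coef_mat n b2"
    have B: "det ?B = z" "det ?B2 = z" using b b2 by (auto simp: adapted_bases_iff)
    define k where "k = inverse z \<cdot>\<^sub>m (adj_mat ?B * ?B2)"
    have adj: "adj_mat ?B \<in> carrier_mat n n" "?B * adj_mat ?B = z \<cdot>\<^sub>m 1\<^sub>m n"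
      using adj_mat[of ?B n] B by auto
    have k: "k \<in> carrier_mat n n" using adj by (simp add: k_def)
    have "?B * k = inverse z \<cdot>\<^sub>m (?B * adj_mat ?B * ?B2)"
      unfolding k_def using adj(1) by (subst mult_smult_distrib) (auto simp: assoc_mult_mat[of _ n n _ n _ n])
    also have "\<dots> = inverse z \<cdot>\<^sub>m (z \<cdot>\<^sub>m ?B2)"
      unfolding adj(2) by (subst mult_smult_assoc_mat) auto
    also have "\<dots> = ?B2" using z by (intro eq_matI) auto
    finally have Bk: "?B * k = ?B2" .
    have "det (?B * k) = det ?B * det k" by (rule det_mult) (use k in auto)
    hence "det k = 1" using z unfolding Bk B by simp
    hence kS: "k \<in> SL_mat n" using k by (simp add: SL_mat_def)
    have "gram f w b2 = transpose_mat k * gram f w b * k" for w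
    proof -
      define G where "G = mat n n (\<lambda>(i, j). rho f (monom 1 (i + j))) * mul_mat f w"
      have m: "mul_mat f w \<in> carrier_mat n n" using mul_mat_carrier[of f w] by (simp add: degree_f)
      hence G: "G \<in> carrier_mat n n" unfolding G_def by (intro mult_carrier_mat[of _ n n _ n]) auto
      have g: "gram f w b' = transpose_mat (coef_mat n b') * G * coef_mat n b'"
        if "b' \<in> adapted_bases n c z" for b'
      proof -
        have "gram f w b' = transpose_mat (coef_mat n b') *
            (mat n n (\<lambda>(i, j). rho f (monom 1 (i + j))) * (mul_mat f w * coef_mat n b'))"
          using that gram_eq[of f b' w] n by (simp add: adapted_bases_iff degree_f)
        also have "mat n n (\<lambda>(i, j). rho f (monom 1 (i + j))) * (mul_mat f w * coef_mat n b') = G * coef_mat n b'"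
          unfolding G_def by (rule assoc_mult_mat[symmetric, of _ n n _ n _ n]) (use m in auto)
        also have "transpose_mat (coef_mat n b') * (G * coef_mat n b') = transpose_mat (coef_mat n b') * G * coef_mat n b'"
          by (rule assoc_mult_mat[symmetric, of _ n n _ n _ n]) (use G in auto)
        finally show ?thesis .
      qed
      show ?thesis
        unfolding g[OF b] g[OF b2] using conj_mat_mult[OF G, of ?B k] k by (simp add: Bk)
    qed
    thus ?thesis
      using SL_orbit_subset[of "gram f a b" n "gram f (monom 1 1 * a) b" k] kS
        gram_carrier[of f _ b] by (simp add: degree_f)
  qed
  thus ?thesis using b by (auto simp: orbit_of_pair_def gram_pair_eq)
qed

end

section \<open>An integral adapted basis\<close>

lemma det_coef_mat_scale:
  assumes "n > 0"
  shows "det (coef_mat n (b(0 := smult q (b 0)))) = q * det (coef_mat n b)"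
proof -
  let ?b = "b(0 := smult q (b 0))"
  have "transpose_mat (coef_mat n ?b) = multrow 0 q (transpose_mat (coef_mat n b))"
    by (rule eq_matI) (auto simp: coef_mat_def)
  moreover have "det (multrow 0 q (transpose_mat (coef_mat n b))) = q * det (transpose_mat (coef_mat n b))"
    by (rule det_multrow[OF assms]) simp
  ultimately have "det (transpose_mat (coef_mat n ?b)) = q * det (transpose_mat (coef_mat n b))" by simp
  thus ?thesis by (simp add: det_transpose[of _ n])
qed

context pid_subring
begin

text \<open>Denominators are cleared, then the result is divided by its content, a generator of the
  ideal of integral combinations of the coefficients; the generator itself supplies the Bezout
  relation.\<close>

lemma primp_multiple:
  assumes "p \<noteq> 0"
  obtains t where "t \<noteq> 0" "primp (smult t p)"
proof -
  have "\<exists>N\<in>A. N \<noteq> 0 \<and> (\<forall>i\<in>{()}. intp (smult N p))"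
    by (rule common_denominator_polys) simp
  then obtain N where N: "N \<noteq> 0" "intp (smult N p)" by blast
  define q where "q = smult N p"
  have q: "intp q" "q \<noteq> 0" using N assms by (auto simp: q_def)
  hence qA: "coeff q i \<in> A" for i by (simp add: intp_def)
  define I where "I = {x. \<exists>c. (\<forall>i. c i \<in> A) \<and> x = (\<Sum>i\<le>degree q. c i * coeff q i)}"
  have I: "x \<in> I \<longleftrightarrow> (\<exists>c. (\<forall>i. c i \<in> A) \<and> x = (\<Sum>i\<le>degree q. c i * coeff q i))" for x
    by (simp add: I_def)
  have "\<exists>g\<in>I. \<forall>x\<in>I. \<exists>a\<in>A. x = a * g"
  proof (rule principal)
    show "I \<subseteq> A" unfolding I_def using qA by (auto intro!: sum_in mult_in)
    show "0 \<in> I" unfolding I by (rule exI[of _ "\<lambda>_. 0"]) simp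
  next
    fix x y assume "x \<in> I" "y \<in> I"
    then obtain c e where c: "\<And>i. c i \<in> A" "x = (\<Sum>i\<le>degree q. c i * coeff q i)"
      and e: "\<And>i. e i \<in> A" "y = (\<Sum>i\<le>degree q. e i * coeff q i)" unfolding I by blast
    have "x + y = (\<Sum>i\<le>degree q. (c i + e i) * coeff q i)"
      by (simp add: c e sum.distrib algebra_simps)
    moreover have "\<forall>i. c i + e i \<in> A" using c(1) e(1) add_in by blast
    ultimately show "x + y \<in> I" unfolding I by (intro exI[of _ "\<lambda>i. c i + e i"] conjI)
  next
    fix a x assume a: "a \<in> A" and "x \<in> I"
    then obtain c where c: "\<And>i. c i \<in> A" "x = (\<Sum>i\<le>degree q. c i * coeff q i)" unfolding I by blast
    have "a * x = (\<Sum>i\<le>degree q. (a * c i) * coeff q i)"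
      by (simp add: c sum_distrib_left mult.assoc)
    moreover have "\<forall>i. a * c i \<in> A" using c(1) a mult_in by blast
    ultimately show "a * x \<in> I" unfolding I by (intro exI[of _ "\<lambda>i. a * c i"] conjI)
  qed
  then obtain g where g: "g \<in> I" "\<And>x. x \<in> I \<Longrightarrow> \<exists>a\<in>A. x = a * g" by blast
  have coeff_I: "coeff q j \<in> I" if "j \<le> degree q" for j
  proof -
    have "coeff q j = (\<Sum>i\<le>degree q. (if i = j then 1 else 0) * coeff q i)"
      using that by (simp add: if_distrib[of "\<lambda>x. x * _"] cong: if_cong)
    moreover have "\<forall>i. (if i = j then 1 else 0) \<in> A" by simp
    ultimately show ?thesis unfolding I by (intro exI[of _ "\<lambda>i. if i = j then 1 else 0"] conjI)
  qed
  have g0: "g \<noteq> 0"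
    using g(2)[OF coeff_I[OF order_refl]] q(2) by auto
  have eq: "smult (N / g) p = smult (1 / g) q" by (simp add: q_def)
  have "coeff (smult (1 / g) q) i \<in> A" for i
  proof (cases "i \<le> degree q")
    case True
    then obtain a where "a \<in> A" "coeff q i = a * g" using g(2)[OF coeff_I] by blast
    thus ?thesis using g0 by simp
  qed (simp add: coeff_eq_0)
  moreover obtain c where c: "\<And>i. c i \<in> A" "g = (\<Sum>i\<le>degree q. c i * coeff q i)"
    using g(1) unfolding I by blast
  have "(\<Sum>i\<le>degree (smult (1 / g) q). c i * coeff (smult (1 / g) q) i) = g / g"
    using g0 by (subst (2) c(2)) (simp add: sum_divide_distrib)
  hence "(\<Sum>i\<le>degree (smult (1 / g) q). c i * coeff (smult (1 / g) q) i) = 1" using g0 by simp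
  ultimately have "primp (smult (1 / g) q)"
    unfolding primp_def intp_def using c(1) by blast
  thus ?thesis using that[of "N / g"] N(1) g0 eq by simp
qed

lemma primp_smult_unit:
  assumes "primp p" "\<mu> \<in> A" "1 / \<mu> \<in> A" "\<mu> \<noteq> 0"
  shows "primp (smult \<mu> p)"
proof -
  obtain c where c: "\<And>i. c i \<in> A" "(\<Sum>i\<le>degree p. c i * coeff p i) = 1"
    using assms(1) unfolding primp_def by blast
  have "(\<Sum>i\<le>degree (smult \<mu> p). (1 / \<mu> * c i) * coeff (smult \<mu> p) i) = (\<Sum>i\<le>degree p. c i * coeff p i)"
    using assms(4) by (intro sum.cong) auto
  moreover have "\<forall>i. 1 / \<mu> * c i \<in> A" using c(1) assms(3) mult_in by blast
  moreover have "intp (smult \<mu> p)" using assms by (intro intp_smult) (auto simp: primp_def)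
  ultimately show ?thesis unfolding primp_def c(2) by (intro conjI exI[of _ "\<lambda>i. 1 / \<mu> * c i"]) auto
qed

text \<open>Gauss's lemma turns the factorization over K into T S'^2 with T and S' primitive. In the
  chart of f this reads W = X1 X2^2, and with inverses Y1, Y2 modulo f one has W (Y1 Y2)^2 = Y1.
  Multiplying a basis for the weight Y1 by Y1 Y2 therefore gives a basis for the weight W with the
  same Gram matrices.\<close>

lemma integral_adapted_basis:
  fixes f W U S V :: "'k poly"
  assumes f: "intp f" "degree f = 2 * s"
    and W: "primp W" "degree W \<le> d" "d + 1 = 2 * g" and gs: "g < s"
    and c: "c \<in> A" "c \<noteq> 0"
    and fac: "shear c d W = smult l (U * S ^ 2)" and deg: "degree (shear c d W) = d"
    and V: "(V * V) mod U = shear c (degree f) f mod U"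
    and z: "z ^ 2 * nrm f W = lead_coeff f ^ (degree f + 1)"
  obtains b where "\<And>j i. j < degree f \<Longrightarrow> i \<ge> degree f \<Longrightarrow> coeff (b j) i = 0"
    "det (coef_mat (degree f) b) = z"
    "\<And>i j. i < degree f \<Longrightarrow> j < degree f \<Longrightarrow> rho f (W * b i * b j) \<in> A"
    "\<And>i j. i < degree f \<Longrightarrow> j < degree f \<Longrightarrow> rho f (monom 1 1 * W * b i * b j) \<in> A"
proof -
  have n: "degree f > 0" using f(2) gs by simp
  hence f0: "f \<noteq> 0" by auto
  have nW: "nrm f W \<noteq> 0" using z f0 by auto
  have d: "d > 0" using W(3) by presburger
  have sW: "primp (shear c d W)" by (rule primp_shear[OF W(1,2) c(1)])
  have sW0: "shear c d W \<noteq> 0" using deg d by auto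
  hence US0: "U \<noteq> 0" "S \<noteq> 0" "l \<noteq> 0" using fac by auto
  obtain t where t: "t \<noteq> 0" "primp (smult t U)" using primp_multiple[OF US0(1)] .
  obtain r where r: "r \<noteq> 0" "primp (smult r S)" using primp_multiple[OF US0(2)] .
  define U' S' where "U' = smult t U" and "S' = smult r S"
  \<comment> \<open>\<mu> is a unit of A: it is integral because U' and S' are primitive, and its
    inverse because the sheared W is primitive itself.\<close>
  define \<mu> where "\<mu> = l / (t * r ^ 2)"
  have \<mu>: "\<mu> \<noteq> 0" using US0 t r by (simp add: \<mu>_def)
  have fac': "shear c d W = U' * (S' * (S' * [:\<mu>:]))"
    unfolding fac U'_def S'_def using t r by (simp add: \<mu>_def power2_eq_square mult_ac)
  have int: "intp (shear c d W)" "intp U'" "intp S'"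
    using sW t r by (auto simp: primp_def U'_def S'_def)
  have "intp [:\<mu>:]"
    using gauss[OF r(2)] gauss[OF r(2)] gauss[OF t(2)] int(1) unfolding fac' U'_def[symmetric] S'_def[symmetric]
    by blast
  hence \<mu>A: "\<mu> \<in> A" unfolding intp_def by (metis coeff_pCons_0)
  have "shear c d W * [:1 / \<mu>:] = U' * (S' * S')"
    unfolding fac' using \<mu> by simp
  hence "intp [:1 / \<mu>:]"
    using gauss[OF sW, of "[:1 / \<mu>:]"] int(2,3) by (simp add: intp_mult)
  hence \<mu>A': "1 / \<mu> \<in> A" unfolding intp_def by (metis coeff_pCons_0)
  define T where "T = smult \<mu> U'"
  have T: "primp T"
    unfolding T_def by (rule primp_smult_unit) (use t \<mu>A \<mu>A' \<mu> in \<open>auto simp: U'_def\<close>)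
  have fac2: "shear c d W = T * (S' * S')" unfolding fac' T_def by simp
  have T0: "T \<noteq> 0" "S' \<noteq> 0" using US0 t r \<mu> by (auto simp: T_def U'_def S'_def)
  define \<delta> \<epsilon> where "\<delta> = degree T" and "\<epsilon> = degree S'"
  have deg2: "d = \<delta> + (\<epsilon> + \<epsilon>)"
    using deg T0 unfolding fac2 by (simp add: degree_mult_eq \<delta>_def \<epsilon>_def)
  \<comment> \<open>\<delta> is odd, since d is odd and d - \<delta> = 2 \<epsilon>.\<close>
  define h where "h = (\<delta> + 1) div 2"
  have h: "\<delta> + 1 = 2 * h" "h < s" using deg2 W(3) gs unfolding h_def by presburger+
  hence \<delta>: "\<delta> > 0" by presburger
  define X1 X2 where "X1 = shear (- c) \<delta> T" and "X2 = shear (- c) \<epsilon> S'"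
  have "W = shear (- c) d (shear (- (- c)) d W)" by (rule shear_shear[symmetric]) (rule W(2))
  also have "\<dots> = shear (- c) (\<delta> + (\<epsilon> + \<epsilon>)) (T * (S' * S'))" using fac2 deg2 by simp
  also have "\<dots> = X1 * shear (- c) (\<epsilon> + \<epsilon>) (S' * S')"
    unfolding X1_def by (rule shear_mult) (auto simp: \<delta>_def \<epsilon>_def intro: degree_mult_le)
  also have "shear (- c) (\<epsilon> + \<epsilon>) (S' * S') = X2 * X2"
    unfolding X2_def by (rule shear_mult) (auto simp: \<epsilon>_def)
  finally have WX: "W = X1 * (X2 * X2)" .
  have nWX: "nrm f W = nrm f X1 * nrm f X2 ^ 2"
    unfolding WX using n by (simp add: nrm_mult power2_eq_square)
  hence nX: "nrm f X1 \<noteq> 0" "nrm f X2 \<noteq> 0" using nW by auto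
  obtain Y1 where Y1: "(X1 * Y1) mod f = 1" using nrm_nonzero_imp_inverse[OF n nX(1)] by blast
  obtain Y2 where Y2: "(X2 * Y2) mod f = 1" using nrm_nonzero_imp_inverse[OF n nX(2)] by blast
  have nXY: "nrm f X1 * nrm f Y1 = 1" "nrm f X2 * nrm f Y2 = 1"
    using n Y1 Y2 by (metis nrm_1 nrm_mod nrm_mult)+
  have "lead_coeff T ^ degree f * nrm T (shear c (degree f) f) = lead_coeff f ^ degree T * nrm f X1"
    unfolding X1_def \<delta>_def using n f(2) \<delta> by (intro nrm_reciprocity) (auto simp: \<delta>_def)
  moreover have "lead_coeff f ^ degree T * nrm f X1 \<noteq> 0" using nX f0 by simp
  ultimately have "nrm T (shear c (degree f) f) \<noteq> 0" by (metis mult_zero_right)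
  then obtain e1 e2 where bez: "e1 * T + e2 * shear c (degree f) f = 1"
    using nrm_nonzero_imp_bezout[of T "shear c (degree f) f"] \<delta> unfolding \<delta>_def by blast
  have "T dvd V * V - shear c (degree f) f"
    using V t \<mu> by (simp add: mod_eq_dvd_iff T_def U'_def smult_dvd_iff)
  hence VT: "(V * V) mod T = shear c (degree f) f mod T" by (simp add: mod_eq_dvd_iff)
  obtain q where q: "\<And>j i. j < degree f \<Longrightarrow> i \<ge> degree f \<Longrightarrow> coeff (q j) i = 0"
    "\<And>i j. i < degree f \<Longrightarrow> j < degree f \<Longrightarrow> rho f (Y1 * (q i * q j)) \<in> A"
    "\<And>i j. i < degree f \<Longrightarrow> j < degree f \<Longrightarrow> rho f (monom 1 1 * (Y1 * (q i * q j))) \<in> A"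
    "det (coef_mat (degree f) q) \<noteq> 0"
    "nrm f X1 * lead_coeff f ^ (degree f + 1) / det (coef_mat (degree f) q) ^ 2 \<in> A"
  proof (rule integral_basis[OF f T _ h(2) c VT bez, of Y1])
    show "degree T + 1 = 2 * h" using h(1) by (simp add: \<delta>_def)
    show "(shear (- c) (degree T) T * Y1) mod f = 1" using Y1 by (simp add: X1_def \<delta>_def)
  qed (auto simp: X1_def \<delta>_def)
  define b0 where "b0 = (\<lambda>j. (Y1 * Y2 * q j) mod f)"
  have det0: "det (coef_mat (degree f) b0) = nrm f Y1 * nrm f Y2 * det (coef_mat (degree f) q)"
  proof -
    have "coef_mat (degree f) b0 = mul_mat f (Y1 * Y2) * coef_mat (degree f) q"
      unfolding b0_def by (rule coef_mat_mult_mod) (rule q(1))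
    hence "det (coef_mat (degree f) b0) = nrm f (Y1 * Y2) * det (coef_mat (degree f) q)"
      unfolding nrm_def by (simp add: det_mult[of _ "degree f"])
    thus ?thesis using n by (simp add: nrm_mult)
  qed
  define k where "k = z / det (coef_mat (degree f) b0)"
  have det0': "det (coef_mat (degree f) b0) \<noteq> 0" using det0 q(4) nXY by auto
  \<comment> \<open>The normalisation of z makes the square of the determinant ratio equal to the
    quotient that \<open>integral_basis\<close> has shown to be integral; a square root in K of an
    element of A lies in A.\<close>
  have "k ^ 2 = nrm f X1 * lead_coeff f ^ (degree f + 1) / det (coef_mat (degree f) q) ^ 2"
  proof -
    have y: "nrm f Y1 = 1 / nrm f X1" "nrm f Y2 = 1 / nrm f X2"
      using nXY nX by (simp_all add: field_simps)
    have "k ^ 2 = (z * nrm f X1 * nrm f X2 / det (coef_mat (degree f) q)) ^ 2"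
      unfolding k_def det0 y using nX q(4) by (simp add: field_simps)
    also have "\<dots> = nrm f X1 * (z ^ 2 * nrm f W) / det (coef_mat (degree f) q) ^ 2"
      unfolding nWX by (simp add: power_divide power2_eq_square mult_ac)
    finally show ?thesis unfolding z .
  qed
  hence k: "k \<in> A" using q(5) integrally_closed_sqrt by simp
  define b where "b = b0(0 := smult k (b0 0))"
  define k' where "k' = (\<lambda>j :: nat. if j = 0 then k else 1)"
  have k': "k' j \<in> A" for j using k by (simp add: k'_def)
  have b: "b j = smult (k' j) (b0 j)" for j by (simp add: b_def k'_def)
  have red: "rho f (w * (W * b i * b j)) = k' i * k' j * rho f (w * (Y1 * (q i * q j)))" for w i j
  proof -
    have "(w * (W * b0 i * b0 j)) mod f = (w * W * (Y1 * Y2 * q i) * (Y1 * Y2 * q j)) mod f"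
      unfolding b0_def
      by (metis (no_types, lifting) mod_mult_left_eq mod_mult_right_eq mult.assoc mult.commute)
    also have "w * W * (Y1 * Y2 * q i) * (Y1 * Y2 * q j) =
        (X1 * Y1) * ((X2 * Y2) * ((X2 * Y2) * (w * (Y1 * (q i * q j)))))"
      unfolding WX by (simp only: mult_ac)
    also have "\<dots> mod f = (w * (Y1 * (q i * q j))) mod f"
    proof -
      have *: "(x * y) mod f = y mod f" if "x mod f = 1" for x y
        using mod_mult_left_eq[of x f y] that by simp
      show ?thesis by (simp only: *[OF Y1] *[OF Y2])
    qed
    finally have "rho f (w * (W * b0 i * b0 j)) = rho f (w * (Y1 * (q i * q j)))" by (rule rho_cong)
    moreover have "w * (W * b i * b j) = smult (k' i * k' j) (w * (W * b0 i * b0 j))"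
      unfolding b by (simp add: mult_ac)
    ultimately show ?thesis by (simp add: rho_smult)
  qed
  show ?thesis
  proof (rule that[of b])
    show "coeff (b j) i = 0" if "j < degree f" "i \<ge> degree f" for j i
      unfolding b b0_def using coeff_mod_eq_0[OF n that(2)] by simp
    show "det (coef_mat (degree f) b) = z"
      unfolding b_def det_coef_mat_scale[OF n] k_def using det0' by simp
    show "rho f (W * b i * b j) \<in> A" if "i < degree f" "j < degree f" for i j
    proof -
      have "rho f (W * b i * b j) = k' i * k' j * rho f (Y1 * (q i * q j))"
        using red[of 1 i j] by simp
      thus ?thesis using k' q(2)[OF that] by (simp add: mult_in)
    qed
    show "rho f (monom 1 1 * W * b i * b j) \<in> A" if "i < degree f" "j < degree f" for i j
    proof -
      have "rho f (monom 1 1 * W * b i * b j) = k' i * k' j * rho f (monom 1 1 * (Y1 * (q i * q j)))"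
        using red[of "monom 1 1" i j] by (simp only: mult.assoc)
      thus ?thesis using k' q(3)[OF that] by (simp only: mult_in)
    qed
  qed
qed

end

section \<open>Descending the divisor to the ground field\<close>

lemma map_poly_dehom_x: "map_poly to_ac (dehom_x n c) = dehom_x n (\<lambda>i. to_ac (c i))"
  by (rule poly_eqI) (simp add: coeff_map_poly coeff_dehom_x)

lemma poly_dehom_x: "poly (dehom_x n c) x = form_eval n c x 1"
  by (simp add: dehom_x_def form_eval_def poly_sum poly_monom)

lemma form_eval_1_0: "form_eval n c 1 0 = c 0"
proof -
  have "form_eval n c 1 0 = (\<Sum>i\<le>n. if i = 0 then c i else 0)"
    unfolding form_eval_def by (intro sum.cong) (auto simp: power_0_left)
  thus ?thesis by simp
qed

lemma form_eval_scale: "form_eval n c (t * x) (t * y) = t ^ n * form_eval n c x y"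
  unfolding form_eval_def sum_distrib_left
proof (intro sum.cong refl)
  fix i assume "i \<in> {..n}"
  hence "t ^ n = t ^ (n - i) * t ^ i" by (simp flip: power_add)
  thus "c i * (t * x) ^ (n - i) * (t * y) ^ i = t ^ n * (c i * x ^ (n - i) * y ^ i)"
    by (simp add: power_mult_distrib)
qed

lemma poly_shear_dehom_x:
  assumes "y - c * x \<noteq> 0"
  shows "poly (shear c n (dehom_x n e)) (x / (y - c * x)) = form_eval n e x y / (y - c * x) ^ n"
proof -
  define l where "l = y - c * x"
  have "1 + c * (x / l) = y / l" using assms by (simp add: l_def field_simps)
  hence "poly (shear c n (dehom_x n e)) (x / l) = (\<Sum>i\<le>n. e (n - i) * (x / l) ^ i * (y / l) ^ (n - i))"
    unfolding poly_shear by (intro sum.cong) (auto simp: coeff_dehom_x)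
  also have "\<dots> = (\<Sum>i\<le>n. e i * (x / l) ^ (n - i) * (y / l) ^ i)"
    by (rule sum.reindex_bij_witness[of _ "\<lambda>i. n - i" "\<lambda>i. n - i"]) auto
  also have "\<dots> = form_eval n e (inverse l * x) (inverse l * y)"
    by (simp add: form_eval_def field_simps)
  also have "\<dots> = form_eval n e x y / l ^ n"
    unfolding form_eval_scale by (simp add: power_inverse field_simps)
  finally show ?thesis by (simp add: l_def)
qed

lemma hyp_curve_wptD:
  assumes "wpt (g + 1) x y z \<in> hyp_curve g c"
  shows "z ^ 2 = form_eval (2 * g + 2) c x y"
proof -
  obtain x' y' z' where 1: "wpt (g + 1) x y z = wpt (g + 1) x' y' z'"
    and 2: "z' ^ 2 = form_eval (2 * g + 2) c x' y'"
    using assms unfolding hyp_curve_def by blast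
  have "(x, y, z) \<in> wpt (g + 1) x y z" unfolding wpt_def by (auto intro!: exI[of _ 1])
  then obtain t where t: "x = t * x'" "y = t * y'" "z = t ^ (g + 1) * z'"
    unfolding 1 by (auto simp: wpt_def)
  have "z ^ 2 = t ^ ((g + 1) * 2) * z' ^ 2" unfolding t by (simp only: power_mult_distrib power_mult)
  also have "(g + 1) * 2 = 2 * g + 2" by simp
  finally show ?thesis unfolding 2 t by (simp only: form_eval_scale)
qed

text \<open>
  The affine coordinates of a point of \<open>\<P>(1,1,m)\<close> in the chart \<open>y - c x \<noteq> 0\<close>, read off from any
  of its representatives.
\<close>

definition chart :: "'l :: field \<Rightarrow> nat \<Rightarrow> ('l \<times> 'l \<times> 'l) set \<Rightarrow> 'l \<times> 'l" where
  "chart c m p = (case SOME t. t \<in> p of (x, y, z) \<Rightarrow> (x / (y - c * x), z / (y - c * x) ^ m))"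

lemma chart_wpt: "chart c m (wpt m x y z) = (x / (y - c * x), z / (y - c * x) ^ m)"
proof -
  have "(x, y, z) \<in> wpt m x y z" unfolding wpt_def by (auto intro!: exI[of _ 1])
  hence "(SOME t. t \<in> wpt m x y z) \<in> wpt m x y z" by (rule someI[of "\<lambda>t. t \<in> wpt m x y z"])
  then obtain t where t: "t \<noteq> 0" "(SOME t. t \<in> wpt m x y z) = (t * x, t * y, t ^ m * z)"
    unfolding wpt_def by blast
  have e: "t * y - c * (t * x) = t * (y - c * x)" by (simp add: algebra_simps)
  show ?thesis unfolding chart_def t(2) prod.case e power_mult_distrib using t(1) by simp
qed

lemma galois_pt_wpt:
  assumes \<sigma>: "\<sigma> \<in> galois_aut"
  shows "galois_pt \<sigma> (wpt m x y z) = wpt m (\<sigma> x) (\<sigma> y) (\<sigma> z)"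
proof -
  interpret comm_ring_hom \<sigma> by (rule galois_aut_hom) fact
  have inj: "inj \<sigma>" "surj \<sigma>" using \<sigma> by (auto simp: galois_aut_def bij_def)
  have 0: "\<sigma> t = 0 \<longleftrightarrow> t = 0" for t using injD[OF inj(1), of t 0] by auto
  show ?thesis
  proof (intro equalityI subsetI)
    fix p assume "p \<in> galois_pt \<sigma> (wpt m x y z)"
    then obtain t where t: "t \<noteq> 0" "p = (\<sigma> (t * x), \<sigma> (t * y), \<sigma> (t ^ m * z))"
      unfolding galois_pt_def wpt_def by auto
    hence "p = (\<sigma> t * \<sigma> x, \<sigma> t * \<sigma> y, \<sigma> t ^ m * \<sigma> z)" by (simp add: hom_mult hom_power)
    moreover have "\<sigma> t \<noteq> 0" using 0 t by simp
    ultimately show "p \<in> wpt m (\<sigma> x) (\<sigma> y) (\<sigma> z)" unfolding wpt_def by blast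
  next
    fix p assume "p \<in> wpt m (\<sigma> x) (\<sigma> y) (\<sigma> z)"
    then obtain s where s: "s \<noteq> 0" "p = (s * \<sigma> x, s * \<sigma> y, s ^ m * \<sigma> z)"
      unfolding wpt_def by blast
    have "\<exists>t. s = \<sigma> t" using surjD[OF inj(2), of s] .
    then obtain t where t: "s = \<sigma> t" ..
    have "p = (\<lambda>(x, y, z). (\<sigma> x, \<sigma> y, \<sigma> z)) (t * x, t * y, t ^ m * z)"
      unfolding s(2) t by (simp add: hom_mult hom_power)
    moreover have "(t * x, t * y, t ^ m * z) \<in> wpt m x y z" using s(1) t 0 unfolding wpt_def by blast
    ultimately show "p \<in> galois_pt \<sigma> (wpt m x y z)" unfolding galois_pt_def by blast
  qed
qed

lemma chart_galois_pt:
  assumes \<sigma>: "\<sigma> \<in> galois_aut" and c: "\<sigma> c = c"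
  shows "chart c m (galois_pt \<sigma> (wpt m x y z)) = map_prod \<sigma> \<sigma> (chart c m (wpt m x y z))"
proof -
  interpret comm_ring_hom \<sigma> by (rule galois_aut_hom) fact
  have inj: "inj \<sigma>" using \<sigma> by (auto simp: galois_aut_def bij_def)
  have 0: "\<sigma> t = 0 \<longleftrightarrow> t = 0" for t using injD[OF inj(1), of t 0] by auto
  have div: "\<sigma> (s / t) = \<sigma> s / \<sigma> t" for s t
  proof (cases "t = 0")
    case False
    have "\<sigma> s = \<sigma> (s / t) * \<sigma> t" using False by (simp flip: hom_mult)
    thus ?thesis using False 0 by (simp add: field_simps)
  qed simp
  show ?thesis
    unfolding galois_pt_wpt[OF \<sigma>] chart_wpt by (simp add: div hom_minus hom_mult hom_power c)
qed

section \<open>From multiplicities of points to the factorization of U, and the descent\<close>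

lemma sum_single_mset: "finite I \<Longrightarrow> (\<Sum>i\<in>I. {#h i#}) = image_mset h (mset_set I)"
  by (induction rule: finite_induct) auto

lemma proots_prod_linear: "proots (\<Prod>x\<in>#B. [:- x, 1 :: 'a :: idom:]) = B"
proof (induction B)
  case (add x B)
  have "(\<Prod>x\<in>#B. [:- x, 1 :: 'a:]) \<noteq> 0" by auto
  hence "proots ([:- x, 1:] * (\<Prod>x\<in>#B. [:- x, 1 :: 'a:])) = proots [:- x, 1:] + B"
    using add by (subst proots_mult) auto
  thus ?case by simp
qed simp

lemma ppt_self: "(x, y) \<in> ppt x y"
  unfolding ppt_def by (rule CollectI, rule exI[of _ 1]) simp

lemma hyp_proj_wpt: "hyp_proj (wpt m x y z) = ppt x y"
proof -
  have "wpt m x y z = (\<lambda>t. (t * x, t * y, t ^ m * z)) ` {t. t \<noteq> 0}" unfolding wpt_def by blast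
  moreover have "ppt x y = (\<lambda>t. (t * x, t * y)) ` {t. t \<noteq> 0}" unfolding ppt_def by blast
  ultimately show ?thesis by (simp only: hyp_proj_def image_image prod.case)
qed

lemma ppt_1_eq_iff: "ppt s 1 = ppt t y \<longleftrightarrow> y \<noteq> 0 \<and> s = t / (y :: 'l :: field)"
proof
  assume "ppt s 1 = ppt t y"
  hence "(s, 1) \<in> ppt t y" using ppt_self[of s 1] by (simp only:)
  then obtain r where r: "s = r * t" "1 = r * y" unfolding ppt_def by blast
  hence "y \<noteq> 0" by auto
  moreover from this have "r = 1 / y" using r(2) by (simp add: field_simps)
  ultimately show "y \<noteq> 0 \<and> s = t / y" using r(1) by simp
next
  assume y: "y \<noteq> 0 \<and> s = t / y"
  have "ppt t y = {(r * (t / y), r * 1) | r. r \<noteq> 0}"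
    unfolding ppt_def
  proof (intro Collect_cong iffI; elim exE conjE)
    fix p r assume "p = (r * t, r * y)" "r \<noteq> 0"
    thus "\<exists>r. p = (r * (t / y), r * 1) \<and> r \<noteq> 0" using y by (intro exI[of _ "r * y"]) simp
  next
    fix p r assume "p = (r * (t / y), r * 1)" "r \<noteq> 0"
    thus "\<exists>r. p = (r * t, r * y) \<and> r \<noteq> 0" using y by (intro exI[of _ "r / y"]) simp
  qed
  thus "ppt s 1 = ppt t y" using y by (simp add: ppt_def)
qed

lemma inj_ppt_1: "inj (\<lambda>t. ppt t (1 :: 'l :: field))"
  by (rule injI) (simp add: ppt_1_eq_iff)

lemma ppt_neq_infinity: "ppt t 1 \<noteq> ppt 1 (0 :: 'l :: field)"
  by (simp add: ppt_1_eq_iff)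

text \<open>Roots with multiplicity are vanishing orders at the points (t : 1), and the points of D
  over (1 : 0) do not project there. So the multiset of roots consists of the a_i with i \<le>
  k.\<close>

lemma dehom_x_eq_prod:
  fixes U a b :: "nat \<Rightarrow> 'l :: alg_closed_field"
  assumes D: "D = (\<Sum>i = 1..k. {#wpt m (a i) 1 (b i)#}) + (\<Sum>i = k + 1..d. {#wpt m 1 0 (b i)#})"
    and van: "\<forall>x y. (x, y) \<noteq> (0, 0) \<longrightarrow> vanishing_order d U x y = count (image_mset hyp_proj D) (ppt x y)"
    and nz: "dehom_x d U \<noteq> 0"
  shows "dehom_x d U = smult (lead_coeff (dehom_x d U)) (\<Prod>i = 1..k. [:- a i, 1:])"
proof -
  let ?p = "dehom_x d U"
  obtain B where B: "?p = smult (lead_coeff ?p) (\<Prod>x\<in>#B. [:- x, 1:])"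
    using alg_closed_imp_factorization[OF nz] by blast
  have "proots ?p = B"
    by (subst B, subst proots_smult) (use nz in \<open>simp_all add: proots_prod_linear\<close>)
  have "B = image_mset a (mset_set {1..k})"
  proof (rule multiset_eqI)
    fix t :: 'l
    have "image_mset hyp_proj D = image_mset (\<lambda>t. ppt t 1) (image_mset a (mset_set {1..k})) +
        image_mset (\<lambda>i. ppt 1 0) (mset_set {k + 1..d})"
      unfolding D by (simp add: sum_single_mset image_mset.compositionality o_def hyp_proj_wpt)
    moreover have "count (image_mset (\<lambda>i. ppt 1 0) (mset_set {k + 1..d})) (ppt t 1) = 0"
      using ppt_neq_infinity[of t] by (auto simp: count_eq_zero_iff)
    moreover have "count B t = vanishing_order d U t 1"
      using \<open>proots ?p = B\<close> nz by (auto simp: vanishing_order_def)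
    ultimately show "count B t = count (image_mset a (mset_set {1..k})) t"
      using van count_image_inj[OF inj_ppt_1, of "image_mset a (mset_set {1..k})" t] by simp
  qed
  thus ?thesis using B by (simp add: prod_unfold_prod_mset image_mset.compositionality o_def)
qed

lemma prod_smult_distrib: "(\<Prod>i\<in>I. smult (s i) (p i)) = smult (\<Prod>i\<in>I. s i) (\<Prod>i\<in>I. p i)"
  by (induction I rule: infinite_finite_induct) (auto simp: mult_ac)

text \<open>The parameter of the substitution must move all points away from infinity, lie in A and
  be fixed by Galois. A natural number meets the last two demands, and characteristic 0 provides
  infinitely many.\<close>

lemma ex_nat_avoiding:
  fixes a :: "nat \<Rightarrow> 'l :: field_char_0"
  obtains N :: nat where "N > 0" "\<And>i. i \<in> {1..k} \<Longrightarrow> of_nat N * a i \<noteq> 1"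
proof -
  have "finite ((of_nat :: nat \<Rightarrow> 'l) -` ((\<lambda>i. 1 / a i) ` {1..k}) \<union> {0})"
    by (intro finite_UnI finite_vimageI) (auto simp: inj_on_def)
  then obtain N where N: "N \<notin> (of_nat :: nat \<Rightarrow> 'l) -` ((\<lambda>i. 1 / a i) ` {1..k}) \<union> {0}"
    using ex_new_if_finite[OF infinite_UNIV_nat] by blast
  have "of_nat N * a i \<noteq> 1" if "i \<in> {1..k}" for i
  proof
    assume "of_nat N * a i = 1"
    hence "of_nat N = 1 / a i" by (metis mult_zero_right nonzero_eq_divide_eq zero_neq_one)
    thus False using N that by blast
  qed
  thus ?thesis using that[of N] N by simp
qed

text \<open>The points are moved to the chart y - N x nonzero, where they are all affine, and passed
  to \<open>galois_stable_points\<close>. The rest traces constants: the sheared W is a multiple of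
  the descended product, and its norm is read off from the equation of the curve.\<close>

lemma divisor_descent:
  fixes c U :: "nat \<Rightarrow> 'k :: field_char_0" and a b :: "nat \<Rightarrow> 'k alg_closure"
  assumes n: "n = 2 * g + 2" and c0: "c 0 \<noteq> 0"
    and D: "D \<in> effective_divisors g c d"
    and D_z: "\<forall>p \<in># D. \<forall>(x, y, z) \<in> p. z \<noteq> 0"
    and k: "k \<le> d"
    and D_eq: "D = (\<Sum>i = 1..k. {#wpt (g + 1) (a i) 1 (b i)#}) + (\<Sum>i = k + 1..d. {#wpt (g + 1) 1 0 (b i)#})"
    and van: "\<forall>x y. (x, y) \<noteq> (0, 0) \<longrightarrow>
      vanishing_order d (\<lambda>i. to_ac (U i)) x y = count (image_mset hyp_proj D) (ppt x y)"
    and U0: "dehom_x d U \<noteq> 0"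
  obtains w N Q S V l where "w \<noteq> 0" "to_ac w = (\<Prod>i = 1..d. b i)"
    "nrm (dehom_x n c) (dehom_x d U) = lead_coeff (dehom_x d U) ^ n * w ^ 2 / c 0 ^ d"
    "N > 0" "shear (of_nat N) d (dehom_x d U) = smult l (Q * S ^ 2)"
    "degree (shear (of_nat N) d (dehom_x d U)) = d"
    "(V * V) mod Q = shear (of_nat N) n (dehom_x n c) mod Q"
proof -
  define m where "m = g + 1"
  \<comment> \<open>Homogeneous coordinates for all indices at once; the points with i > k lie over
    (1 : 0).\<close>
  define x y where "x = (\<lambda>i. if i \<le> k then a i else 1)" and "y = (\<lambda>i. if i \<le> k then 1 else 0 :: 'k alg_closure)"
  let ?I = "{1..d}" and ?c = "\<lambda>i. to_ac (c i)"
  define f W where "f = dehom_x n c" and "W = dehom_x d U"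
  define u where "u = lead_coeff W"
  have u0: "u \<noteq> 0" using U0 by (simp add: u_def W_def)
  have f: "degree f = n" "lead_coeff f = c 0" using dehom_x_lead[of c n] c0 by (simp_all add: f_def)
  have I: "?I = {1..k} \<union> {k + 1..d}" using k by auto
  have D1: "D = image_mset (\<lambda>i. wpt m (x i) (y i) (b i)) (mset_set ?I)"
  proof -
    have "mset_set ?I = mset_set {1..k} + mset_set {k + 1..d}"
      unfolding I by (rule mset_set_Union) auto
    moreover have "image_mset (\<lambda>i. wpt m (x i) (y i) (b i)) (mset_set {1..k}) =
        image_mset (\<lambda>i. wpt m (a i) 1 (b i)) (mset_set {1..k})"
      by (intro image_mset_cong) (auto simp: x_def y_def)
    moreover have "image_mset (\<lambda>i. wpt m (x i) (y i) (b i)) (mset_set {k + 1..d}) =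
        image_mset (\<lambda>i. wpt m 1 0 (b i)) (mset_set {k + 1..d})"
      by (intro image_mset_cong) (auto simp: x_def y_def)
    ultimately show ?thesis unfolding D_eq by (simp add: sum_single_mset m_def)
  qed
  have mem: "wpt m (x i) (y i) (b i) \<in># D" if "i \<in> ?I" for i
    unfolding D1 using that by auto
  have curve: "b i ^ 2 = form_eval n ?c (x i) (y i)" if "i \<in> ?I" for i
  proof -
    have "wpt (g + 1) (x i) (y i) (b i) \<in> hyp_curve g ?c"
      using D mem[OF that] unfolding effective_divisors_def m_def by blast
    thus ?thesis unfolding n by (rule hyp_curve_wptD)
  qed
  have b0: "b i \<noteq> 0" if "i \<in> ?I" for i
  proof -
    have "(x i, y i, b i) \<in> wpt m (x i) (y i) (b i)" unfolding wpt_def by (auto intro!: exI[of _ 1])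
    moreover have "\<forall>(x, y, z) \<in> wpt m (x i) (y i) (b i). z \<noteq> 0" using D_z mem[OF that] by (rule bspec)
    ultimately show ?thesis by auto
  qed
  obtain N :: nat where N: "N > 0" "\<And>i. i \<in> {1..k} \<Longrightarrow> of_nat N * a i \<noteq> 1"
    using ex_nat_avoiding[of k a] by blast
  let ?N = "of_nat N :: 'k alg_closure"
  define l where "l = (\<lambda>i. y i - ?N * x i)"
  have l0: "l i \<noteq> 0" if "i \<in> ?I" for i
    using N that by (auto simp: l_def x_def y_def)
  define E where "E = image_mset (\<lambda>i. (x i / l i, b i / l i ^ m)) (mset_set ?I)"
  have E: "E = image_mset (chart ?N m) D"
    unfolding E_def D1 by (simp add: image_mset.compositionality o_def chart_wpt l_def)
  define F where "F = shear (of_nat N) n f"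
  have mapF: "map_poly to_ac F = shear ?N n (dehom_x n ?c)"
    by (simp add: F_def f_def map_poly_shear map_poly_dehom_x)
  obtain Q S V w' where des: "(\<Prod>p\<in>#E. [:- fst p, 1:]) = map_poly to_ac (Q * S ^ 2)"
    "(V * V) mod Q = F mod Q" "to_ac w' = (\<Prod>p\<in>#E. snd p)"
  proof (rule galois_stable_points[of E F])
    fix \<sigma> :: "'k alg_closure \<Rightarrow> 'k alg_closure" assume \<sigma>: "\<sigma> \<in> galois_aut"
    have "\<sigma> (to_ac (of_nat N)) = to_ac (of_nat N)" using \<sigma> unfolding galois_aut_def by blast
    hence \<sigma>N: "\<sigma> ?N = ?N" by simp
    have "image_mset (map_prod \<sigma> \<sigma>) E = image_mset (\<lambda>p. chart ?N m (galois_pt \<sigma> p)) D"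
      unfolding E D1
      by (simp add: image_mset.compositionality o_def chart_galois_pt[OF \<sigma> \<sigma>N])
    also have "\<dots> = image_mset (chart ?N m) (image_mset (galois_pt \<sigma>) D)"
      by (simp add: image_mset.compositionality o_def)
    also have "image_mset (galois_pt \<sigma>) D = D" using D \<sigma> unfolding effective_divisors_def by blast
    finally show "image_mset (map_prod \<sigma> \<sigma>) E = E" using E by simp
  next
    fix s z assume "(s, z) \<in># E"
    then obtain i where i: "i \<in> ?I" "s = x i / l i" "z = b i / l i ^ m" by (auto simp: E_def)
    have li: "y i - ?N * x i \<noteq> 0" using l0[OF i(1)] by (simp add: l_def)
    have "n = m * 2" by (simp add: n m_def)
    hence "z ^ 2 = b i ^ 2 / l i ^ n" unfolding i(3) by (simp only: power_divide power_mult)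
    also have "\<dots> = poly (map_poly to_ac F) s"
      unfolding mapF i(2) l_def using poly_shear_dehom_x[OF li, of n ?c] curve[OF i(1)] by simp
    finally show "z ^ 2 = poly (map_poly to_ac F) s" .
    show "z \<noteq> 0" unfolding i(3) using b0 l0 i(1) by simp
  qed blast
  define R where "R = Q * S ^ 2"
  have mapR: "map_poly to_ac R = (\<Prod>i\<in>?I. [:- (x i / l i), 1:])"
    unfolding R_def des(1)[symmetric] E_def
    by (simp add: prod_unfold_prod_mset image_mset.compositionality o_def)
  have R0: "R \<noteq> 0"
  proof
    assume "R = 0"
    hence "(\<Prod>i\<in>?I. [:- (x i / l i), 1:]) = 0" using mapR by simp
    thus False by simp
  qed
  have degR: "degree R = d"
  proof -
    have "degree (map_poly to_ac R) = (\<Sum>i\<in>?I. degree [:- (x i / l i), 1:])"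
      unfolding mapR by (rule degree_prod_eq_sum_degree) auto
    thus ?thesis by simp
  qed
  have mapW: "map_poly to_ac W = smult (to_ac u) (\<Prod>i = 1..k. [:- a i, 1:])"
  proof -
    have eq: "dehom_x d (\<lambda>i. to_ac (U i)) = map_poly to_ac W" by (simp add: W_def map_poly_dehom_x)
    have "map_poly to_ac W \<noteq> 0" using U0 by (simp add: W_def)
    thus ?thesis
      using dehom_x_eq_prod[OF D_eq van] unfolding eq by (simp add: u_def coeff_map_poly)
  qed
  \<comment> \<open>For the point (1 : 0) the linear form y_i x - x_i y is -y, while the factor 1 in
    W stands for y; e records this sign.\<close>
  define e where "e = (\<lambda>i. if i \<le> k then 1 else - 1 :: 'k)"
  define p where "p = (\<lambda>i. if i \<le> k then [:- a i, 1:] else 1)"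
  have pp: "(\<Prod>i = 1..k. [:- a i, 1:]) = (\<Prod>i\<in>?I. p i)"
    using k by (intro prod.mono_neutral_cong_left) (auto simp: p_def)
  have sh: "shear ?N d (\<Prod>i\<in>?I. p i) = (\<Prod>i\<in>?I. shear ?N 1 (p i))"
    using shear_prod_mset[of "mset_set ?I" p ?N] by (simp add: prod_unfold_prod_mset p_def)
  have sh1: "shear ?N 1 (p i) = smult (to_ac (e i) * l i) [:- (x i / l i), 1:]" if "i \<in> ?I" for i
  proof -
    have "shear ?N 1 (p i) = smult (to_ac (e i)) [:- x i, l i:]"
      by (simp add: shear_def monom_altdef p_def e_def l_def x_def y_def)
    also have "[:- x i, l i:] = smult (l i) [:- (x i / l i), 1:]" using l0[OF that] by simp
    finally show ?thesis by simp
  qed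
  have "(\<Prod>i\<in>?I. shear ?N 1 (p i)) = (\<Prod>i\<in>?I. smult (to_ac (e i) * l i) [:- (x i / l i), 1:])"
    by (intro prod.cong refl sh1)
  hence shearW: "shear ?N d (map_poly to_ac W) =
      smult (to_ac u * (\<Prod>i\<in>?I. to_ac (e i) * l i)) (map_poly to_ac R)"
    unfolding mapW shear_smult mapR pp sh by (simp only: prod_smult_distrib smult_smult)
  define L where "L = to_ac u * (\<Prod>i\<in>?I. to_ac (e i) * l i)"
  define W0 where "W0 = shear (of_nat N) d W"
  have W0: "map_poly to_ac W0 = smult L (map_poly to_ac R)"
    using shearW by (simp add: W0_def L_def map_poly_shear)
  define \<kappa> where "\<kappa> = coeff W0 d / coeff R d"
  have "coeff R d \<noteq> 0" using R0 degR by auto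
  moreover have "to_ac (coeff W0 d) = L * to_ac (coeff R d)"
    using arg_cong[OF W0, of "\<lambda>p. coeff p d"] by (simp add: coeff_map_poly)
  ultimately have L: "L = to_ac \<kappa>" by (simp add: \<kappa>_def)
  have W0R: "W0 = smult \<kappa> R"
  proof (rule poly_eqI)
    fix i
    have "to_ac (coeff W0 i) = to_ac (coeff (smult \<kappa> R) i)"
      using arg_cong[OF W0, of "\<lambda>p. coeff p i"] by (simp add: coeff_map_poly L)
    thus "coeff W0 i = coeff (smult \<kappa> R) i" by (simp only: to_ac_eq_iff)
  qed
  define \<epsilon> where "\<epsilon> = (\<Prod>i\<in>?I. e i)"
  have \<epsilon>: "\<epsilon> \<noteq> 0" unfolding \<epsilon>_def by (auto simp: e_def)
  have Leq: "to_ac \<kappa> = to_ac (u * \<epsilon>) * (\<Prod>i\<in>?I. l i)"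
    unfolding L[symmetric] L_def \<epsilon>_def by (simp add: prod.distrib to_ac_prod)
  have pl0: "(\<Prod>i\<in>?I. l i) \<noteq> 0" using l0 by simp
  have "to_ac \<kappa> \<noteq> 0" unfolding Leq using pl0 u0 \<epsilon> by simp
  hence \<kappa>0: "\<kappa> \<noteq> 0" by simp
  \<comment> \<open>The product of the l_i lies in K as a ratio of constants. Its m-th power
    converts the product of the chart coordinates b_i / l_i^m into the product of the b_i, so that w
    descends too.\<close>
  define \<theta> where "\<theta> = \<kappa> / (u * \<epsilon>)"
  have \<theta>: "to_ac \<theta> = (\<Prod>i\<in>?I. l i)"
    using Leq u0 \<epsilon> by (simp add: \<theta>_def)
  define w where "w = w' * \<theta> ^ m"
  have "to_ac w' = (\<Prod>i\<in>?I. b i) / (\<Prod>i\<in>?I. l i) ^ m"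
    unfolding des(3) E_def
    by (simp add: image_mset.compositionality o_def prod_dividef flip: prod_unfold_prod_mset prod_power_distrib)
  hence w: "to_ac w = (\<Prod>i\<in>?I. b i)"
    using pl0 by (simp add: w_def \<theta>)
  have "to_ac w \<noteq> 0" unfolding w using b0 by simp
  hence w0: "w \<noteq> 0" by simp
  have "to_ac (nrm f W) = to_ac (u ^ n * w ^ 2 / c 0 ^ d)"
  proof -
    let ?f = "map_poly to_ac f"
    have df: "degree ?f = n" "lead_coeff ?f = to_ac (c 0)" "even n" "n > 0"
      using f n by (simp_all add: coeff_map_poly)
    have "to_ac (nrm f W) = nrm ?f (map_poly to_ac W)" by (simp add: map_nrm)
    also have "\<dots> = nrm ?f ([:to_ac u:] * (\<Prod>i = 1..k. [:- a i, 1:]))" unfolding mapW by simp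
    also have "\<dots> = to_ac u ^ n * (\<Prod>i = 1..k. poly ?f (a i) / to_ac (c 0))"
      using df by (simp add: nrm_mult nrm_const nrm_prod nrm_linear del: mult_pCons_left)
    also have "(\<Prod>i = 1..k. poly ?f (a i) / to_ac (c 0)) = (\<Prod>i\<in>?I. b i ^ 2 / to_ac (c 0))"
    proof (rule prod.mono_neutral_cong_left)
      \<comment> \<open>Over (1 : 0) the curve gives b_i^2 = c_0, so the points at infinity
        contribute factors 1 and the product extends to all of D.\<close>
      show "\<forall>i\<in>?I - {1..k}. b i ^ 2 / to_ac (c 0) = 1"
      proof
        fix i assume i: "i \<in> ?I - {1..k}"
        have "b i ^ 2 = to_ac (c 0)"
          using curve[of i] i by (simp add: x_def y_def form_eval_1_0)
        thus "b i ^ 2 / to_ac (c 0) = 1" using c0 by simp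
      qed
      show "poly ?f (a i) / to_ac (c 0) = b i ^ 2 / to_ac (c 0)" if "i \<in> {1..k}" for i
        using curve[of i] that k by (simp add: x_def y_def f_def map_poly_dehom_x poly_dehom_x)
    qed (use k in auto)
    also have "\<dots> = to_ac w ^ 2 / to_ac (c 0) ^ d"
      unfolding w by (simp add: prod_dividef prod_power_distrib)
    finally show ?thesis by simp
  qed
  hence nrmW: "nrm f W = u ^ n * w ^ 2 / c 0 ^ d" by (simp only: to_ac_eq_iff)
  show ?thesis
    by (rule that[OF w0 w _ N(1), of \<kappa> Q S V])
      (use nrmW W0R des(2) degR \<kappa>0 in \<open>simp_all add: f_def W_def u_def W0_def R_def F_def\<close>)
qed

section \<open>Fraction fields and integral representatives\<close>

instance fract :: ("{idom, ring_char_0}") ring_char_0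
proof
  show "inj (of_nat :: nat \<Rightarrow> 'a fract)"
  proof (rule injI)
    fix m n :: nat assume "of_nat m = (of_nat n :: 'a fract)"
    thus "m = n" by (simp add: of_nat_fract eq_fract)
  qed
qed

instance fract :: ("{idom, ring_char_0}") field_char_0 ..

lemma to_fract_hom: "inj_comm_ring_hom (to_fract :: 'a :: idom \<Rightarrow> 'a fract)"
  by unfold_locales auto

lemma ideal_of_type_algebra:
  fixes I :: "'a :: comm_ring_1 set"
  assumes "0 \<in> I" "\<And>x y. x \<in> I \<Longrightarrow> y \<in> I \<Longrightarrow> x + y \<in> I" "\<And>a x. x \<in> I \<Longrightarrow> a * x \<in> I"
  shows "ideal I (ring_of_type_algebra :: 'a ring)"
proof (rule idealI)
  interpret R: ring "ring_of_type_algebra :: 'a ring" by (rule ring_from_type_algebra)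
  show "ring (ring_of_type_algebra :: 'a ring)" by (rule ring_from_type_algebra)
  show "subgroup I (add_monoid (ring_of_type_algebra :: 'a ring))"
  proof (rule R.add.subgroupI)
    fix x assume x: "x \<in> I"
    have "- x \<oplus>\<^bsub>ring_of_type_algebra\<^esub> x = \<zero>\<^bsub>ring_of_type_algebra\<^esub>"
      by (simp add: ring_of_type_algebra_def)
    hence "\<ominus>\<^bsub>ring_of_type_algebra\<^esub> x = - x"
      by (rule R.minus_equality) (auto simp: ring_of_type_algebra_def)
    moreover have "- x \<in> I" using assms(3)[OF x, of "- 1"] by simp
    ultimately show "\<ominus>\<^bsub>ring_of_type_algebra\<^esub> x \<in> I" by simp
  qed (use assms in \<open>auto simp: ring_of_type_algebra_def\<close>)
qed (use assms in \<open>auto simp: ring_of_type_algebra_def mult.commute\<close>)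

lemma pid_subring_fract:
  assumes "principal_domain (ring_of_type_algebra :: 'a :: {idom, ring_char_0} ring)"
  shows "pid_subring (range (to_fract :: 'a \<Rightarrow> 'a fract))"
proof
  let ?A = "range (to_fract :: 'a \<Rightarrow> 'a fract)"
  show "0 \<in> ?A" by (metis to_fract_0 rangeI)
  show "1 \<in> ?A" by (metis to_fract_1 rangeI)
  show "x + y \<in> ?A" if "x \<in> ?A" "y \<in> ?A" for x y using that by (metis (mono_tags) imageE rangeI to_fract_add)
  show "x * y \<in> ?A" if "x \<in> ?A" "y \<in> ?A" for x y using that by (metis (mono_tags) imageE rangeI to_fract_mult)
  show "- x \<in> ?A" if "x \<in> ?A" for x using that by (metis (mono_tags) imageE rangeI to_fract_uminus)
  show "\<exists>a\<in>?A. \<exists>b\<in>?A. b \<noteq> 0 \<and> x = a / b" for x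
    by (cases x) (auto simp: Fract_conv_to_fract)
next
  let ?A = "range (to_fract :: 'a \<Rightarrow> 'a fract)"
  fix I :: "'a fract set"
  assume I: "I \<subseteq> ?A" "0 \<in> I" "\<And>x y. x \<in> I \<Longrightarrow> y \<in> I \<Longrightarrow> x + y \<in> I"
    "\<And>a x. a \<in> ?A \<Longrightarrow> x \<in> I \<Longrightarrow> a * x \<in> I"
  have "ideal (to_fract -` I) (ring_of_type_algebra :: 'a ring)"
    by (rule ideal_of_type_algebra) (use I in auto)
  then obtain g where g: "to_fract -` I = PIdl\<^bsub>ring_of_type_algebra\<^esub> g"
    using principal_domain.exists_gen[OF assms] by blast
  hence *: "to_fract x \<in> I \<longleftrightarrow> (\<exists>a. x = a * g)" for x
    by (auto simp: cgenideal_def ring_of_type_algebra_def set_eq_iff)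
  have "to_fract g \<in> I" using *[of g] by (metis mult_1)
  moreover have "\<exists>a\<in>?A. x = a * to_fract g" if x: "x \<in> I" for x
  proof -
    obtain x' where x': "x = to_fract x'" using I(1) x by blast
    hence "to_fract x' \<in> I" using x by simp
    then obtain a where "x' = a * g" unfolding * by blast
    thus ?thesis using x' by (intro bexI[of _ "to_fract a"]) auto
  qed
  ultimately show "\<exists>g\<in>I. \<forall>x\<in>I. \<exists>a\<in>?A. x = a * g" by blast
qed

text \<open>The combinations of the coefficients form an ideal containing the generators, hence the
  generated ideal, which contains 1.\<close>

lemma primitive_form_bezout:
  fixes U :: "nat \<Rightarrow> 'a :: comm_ring_1"
  assumes "primitive_form d U"
  obtains a where "(\<Sum>i\<le>d. a i * U i) = 1"
proof -
  define J where "J = {x. \<exists>a. x = (\<Sum>i\<le>d. a i * U i)}"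
  have J: "x \<in> J \<longleftrightarrow> (\<exists>a. x = (\<Sum>i\<le>d. a i * U i))" for x by (simp add: J_def)
  interpret R: ring "ring_of_type_algebra :: 'a ring" by (rule ring_from_type_algebra)
  have "ideal J (ring_of_type_algebra :: 'a ring)"
  proof (rule ideal_of_type_algebra)
    show "0 \<in> J" unfolding J by (rule exI[of _ "\<lambda>_. 0"]) simp
    fix x assume "x \<in> J"
    then obtain a where a: "x = (\<Sum>i\<le>d. a i * U i)" unfolding J by blast
    show "x + y \<in> J" if y: "y \<in> J" for y
    proof -
      obtain b where b: "y = (\<Sum>i\<le>d. b i * U i)" using y unfolding J by blast
      show ?thesis unfolding J a b
        by (rule exI[of _ "\<lambda>i. a i + b i"]) (simp add: sum.distrib distrib_right)
    qed
    show "r * x \<in> J" for r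
      unfolding J a by (rule exI[of _ "\<lambda>i. r * a i"]) (simp add: sum_distrib_left mult.assoc)
  qed
  moreover have "U ` {..d} \<subseteq> J"
  proof clarify
    fix j assume "j \<le> d"
    thus "U j \<in> J" unfolding J
      by (intro exI[of _ "\<lambda>i. if i = j then 1 else 0"]) (simp add: if_distrib[of "\<lambda>x. x * _"] cong: if_cong)
  qed
  ultimately have "Idl\<^bsub>ring_of_type_algebra\<^esub> (U ` {..d}) \<subseteq> J" by (rule R.genideal_minimal)
  hence "1 \<in> J" using assms by (auto simp: primitive_form_def ring_of_type_algebra_def)
  thus ?thesis using that unfolding J by metis
qed

text \<open>The embedding into the fraction field is injective and commutes with determinants, so
  symmetry and the identity for the invariant form descend along with the entries.\<close>

lemma V_form_lift:
  fixes f :: "nat \<Rightarrow> 'a :: {idom, ring_char_0}"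
  assumes V: "(P, Q) \<in> V_form n (\<lambda>i. to_fract (f i))"
    and P: "\<And>i j. i < n \<Longrightarrow> j < n \<Longrightarrow> P $$ (i, j) \<in> range to_fract"
    and Q: "\<And>i j. i < n \<Longrightarrow> j < n \<Longrightarrow> Q $$ (i, j) \<in> range to_fract"
  shows "(P, Q) \<in> (\<lambda>(P, Q). (map_mat to_fract P, map_mat to_fract Q)) ` V_form n f"
proof -
  have PQ: "P \<in> carrier_mat n n" "Q \<in> carrier_mat n n" "transpose_mat P = P" "transpose_mat Q = Q"
    "invariant_form n P Q = binform n (\<lambda>i. to_fract (f i))"
    using V by (auto simp: V_form_def sym_pairs_def)
  have inv: "to_fract (inv_into UNIV to_fract x) = x" if "x \<in> range (to_fract :: 'a \<Rightarrow> _)" for x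
    using that by (rule f_inv_into_f)
  have inj_mat: "M = M'" if "map_mat to_fract M = map_mat to_fract M'" for M M' :: "'a mat"
  proof (rule eq_matI)
    show dim: "dim_row M = dim_row M'" "dim_col M = dim_col M'"
      using arg_cong[OF that, of dim_row] arg_cong[OF that, of dim_col] by simp_all
    fix i j assume "i < dim_row M'" "j < dim_col M'"
    thus "M $$ (i, j) = M' $$ (i, j)"
      using arg_cong[OF that, of "\<lambda>M. M $$ (i, j)"] dim by simp
  qed
  define P' Q' where "P' = map_mat (inv_into UNIV (to_fract :: 'a \<Rightarrow> _)) P" and "Q' = map_mat (inv_into UNIV (to_fract :: 'a \<Rightarrow> _)) Q"
  have P': "map_mat to_fract P' = P" and Q': "map_mat to_fract Q' = Q"
    using P Q PQ by (auto intro!: eq_matI simp: P'_def Q'_def inv)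
  have c: "P' \<in> carrier_mat n n" "Q' \<in> carrier_mat n n" using PQ by (auto simp: P'_def Q'_def)
  have "map_mat to_fract (transpose_mat P') = transpose_mat (map_mat to_fract P')"
    "map_mat to_fract (transpose_mat Q') = transpose_mat (map_mat to_fract Q')"
    by (auto intro!: eq_matI)
  hence sym: "transpose_mat P' = P'" "transpose_mat Q' = Q'"
    using PQ by (auto intro!: inj_mat simp: P' Q')
  interpret h: inj_comm_ring_hom "to_fract :: 'a \<Rightarrow> _" by (rule to_fract_hom)
  interpret hp: map_poly_inj_comm_ring_hom "to_fract :: 'a \<Rightarrow> _" ..
  interpret hpp: map_poly_inj_comm_ring_hom "map_poly (to_fract :: 'a \<Rightarrow> _)" ..
  let ?h = "map_poly (map_poly (to_fract :: 'a \<Rightarrow> _))"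
  have "?h (invariant_form n P' Q') = invariant_form n P Q"
  proof -
    have "map_mat ?h ([:0, 1:] \<cdot>\<^sub>m map_mat (\<lambda>r. [:[:r:]:]) P' - [:[:0, 1:]:] \<cdot>\<^sub>m map_mat (\<lambda>r. [:[:r:]:]) Q') =
        [:0, 1:] \<cdot>\<^sub>m map_mat (\<lambda>r. [:[:r:]:]) P - [:[:0, 1:]:] \<cdot>\<^sub>m map_mat (\<lambda>r. [:[:r:]:]) Q"
      unfolding P'[symmetric] Q'[symmetric] using c
      by (intro eq_matI) (auto simp: hpp.hom_minus hp.map_poly_pCons_hom h.map_poly_pCons_hom)
    thus ?thesis
      unfolding invariant_form_def by (simp add: hpp.hom_mult hpp.hom_power hpp.hom_uminus flip: hpp.hom_det)
  qed
  also have "\<dots> = ?h (binform n f)"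
    unfolding PQ binform_def by (simp add: hpp.hom_sum)
  finally have "invariant_form n P' Q' = binform n f" by (simp add: hpp.eq_iff)
  hence "(P', Q') \<in> V_form n f" using c sym by (simp add: V_form_def sym_pairs_def)
  thus ?thesis using P' Q' by force
qed

text \<open>The product of the b_i is given in the algebraic closure, so the existence of w in K
  belongs to the conclusion. Membership in \<open>SL_orbits\<close> says that the union in
  \<open>orbit_of_pair\<close> is a single orbit.\<close>

theorem theorem4p1:
  fixes g n k :: nat
    and f U :: "nat \<Rightarrow> 'a :: {idom, ring_char_0}"
    and fK :: "nat \<Rightarrow> 'a fract"
    and D :: "('a fract alg_closure \<times> 'a fract alg_closure \<times> 'a fract alg_closure) set multiset"
    and a b :: "nat \<Rightarrow> 'a fract alg_closure"
    and u :: "'a fract"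
    and \<alpha> :: "'a fract poly"
  assumes pid: "principal_domain (ring_of_type_algebra :: 'a ring)"
    and g: "g \<ge> 1" and n: "n = 2 * g + 2"
    and fK: "fK = (\<lambda>i. to_fract (f i))"
    and f0: "f 0 \<noteq> 0" and disc: "form_disc n fK \<noteq> 0"
    and D: "D \<in> effective_divisors g fK (2 * g - 1)"
    and D_z: "\<forall>p \<in># D. \<forall>(x, y, z) \<in> p. z \<noteq> 0"
    and k: "k \<le> 2 * g - 1"
    and D_eq: "D = (\<Sum>i = 1..k. {#wpt (g + 1) (a i) 1 (b i)#}) +
                   (\<Sum>i = k + 1..2 * g - 1. {#wpt (g + 1) 1 0 (b i)#})"
    and U_prim: "primitive_form (2 * g - 1) U"
    and U_van: "\<forall>x y. (x, y) \<noteq> (0, 0) \<longrightarrow>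
                  vanishing_order (2 * g - 1) (\<lambda>i. to_ac (to_fract (U i))) x y
                    = count (image_mset hyp_proj D) (ppt x y)"
    and u: "u = to_fract (lead_coeff (dehom_x (2 * g - 1) U))"
    and \<alpha>: "\<alpha> = Lf_class n fK (dehom_x (2 * g - 1) (\<lambda>i. to_fract (U i)))"
  shows "\<exists>w :: 'a fract. w \<noteq> 0 \<and> to_ac w = (\<Prod>i = 1..2 * g - 1. b i) \<and>
    (let pr = (\<alpha>, inverse (u ^ (g + 1)) * fK 0 ^ (n - 1) * inverse w) in
       pr \<in> norm_pairs n fK \<and>
       orbit_of_pair n fK pr \<in> SL_orbits n fK \<and>
       orbit_of_pair n fK pr \<inter>
         (\<lambda>(P, Q). (map_mat to_fract P, map_mat to_fract Q)) ` V_form n f \<noteq> {})"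
proof -
  define d where "d = 2 * g - 1"
  define A where "A = range (to_fract :: 'a \<Rightarrow> 'a fract)"
  interpret pid_subring A unfolding A_def by (rule pid_subring_fract) fact
  define UK where "UK = (\<lambda>i. to_fract (U i))"
  define F W where "F = dehom_x n fK" and "W = dehom_x d UK"
  have c0: "fK 0 \<noteq> 0" using f0 by (simp add: fK)
  have n0: "n > 0" using n by simp
  have F: "degree F = n" "lead_coeff F = fK 0" using dehom_x_lead[of fK n] c0 by (simp_all add: F_def)
  have F_int: "intp F" unfolding intp_def F_def coeff_dehom_x fK by (auto simp: A_def)
  obtain r where r: "(\<Sum>i\<le>d. r i * U i) = 1"
    using primitive_form_bezout[OF U_prim] unfolding d_def by blast
  have degW: "degree W \<le> d" unfolding W_def by (rule degree_le) (simp add: coeff_dehom_x)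
  have to_fract_sum: "to_fract (\<Sum>i\<in>I. h i) = (\<Sum>i\<in>I. to_fract (h i))" for I :: "nat set" and h :: "nat \<Rightarrow> 'a"
    by (induction I rule: infinite_finite_induct) auto
  \<comment> \<open>The coefficient of X^i in the dehomogenised form is U (d - i), hence the
    reversed index.\<close>
  have rW: "(\<Sum>i\<le>d. to_fract (r (d - i)) * coeff W i) = 1"
  proof -
    have "(\<Sum>i\<le>d. to_fract (r (d - i)) * coeff W i) = (\<Sum>i\<le>d. to_fract (r i) * to_fract (U i))"
      by (rule sum.reindex_bij_witness[of _ "\<lambda>i. d - i" "\<lambda>i. d - i"]) (auto simp: W_def coeff_dehom_x UK_def)
    also have "\<dots> = to_fract (\<Sum>i\<le>d. r i * U i)"
      by (simp add: to_fract_sum)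
    finally show ?thesis unfolding r by simp
  qed
  have W_prim: "primp W"
  proof -
    have "intp W" unfolding intp_def W_def coeff_dehom_x UK_def by (auto simp: A_def)
    moreover have "(\<Sum>i\<le>degree W. to_fract (r (d - i)) * coeff W i) = 1"
      unfolding rW[symmetric] using degW by (intro sum.mono_neutral_left) (auto simp: coeff_eq_0)
    moreover have "\<forall>i. to_fract (r (d - i)) \<in> A" by (simp add: A_def)
    ultimately show ?thesis unfolding primp_def by (intro conjI exI[of _ "\<lambda>i. to_fract (r (d - i))"])
  qed
  have W0: "W \<noteq> 0" using rW by auto
  have uW: "u = lead_coeff W"
  proof -
    have WU: "W = map_poly to_fract (dehom_x d U)"
      by (rule poly_eqI) (simp add: W_def UK_def coeff_dehom_x coeff_map_poly)
    have "degree W = degree (dehom_x d U)" unfolding WU by (rule degree_map_poly) simp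
    hence "lead_coeff W = coeff (map_poly to_fract (dehom_x d U)) (degree (dehom_x d U))"
      unfolding WU by (simp only:)
    also have "\<dots> = u" unfolding u d_def by (rule coeff_map_poly) simp
    finally show ?thesis by (rule sym)
  qed
  have van: "\<forall>x y. (x, y) \<noteq> (0, 0) \<longrightarrow>
      vanishing_order d (\<lambda>i. to_ac (UK i)) x y = count (image_mset hyp_proj D) (ppt x y)"
    using U_van unfolding d_def UK_def .
  obtain w N Q S V l where dd: "w \<noteq> 0" "to_ac w = (\<Prod>i = 1..d. b i)"
    "nrm F W = lead_coeff W ^ n * w ^ 2 / fK 0 ^ d"
    "N > 0" "shear (of_nat N) d W = smult l (Q * S ^ 2)"
    "degree (shear (of_nat N) d W) = d"
    "(V * V) mod Q = shear (of_nat N) n F mod Q"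
    unfolding F_def W_def
    by (rule divisor_descent[OF n c0 D[folded d_def] D_z k[folded d_def] D_eq[folded d_def]
          van W0[unfolded W_def]])
  define z where "z = inverse (u ^ (g + 1)) * fK 0 ^ (n - 1) * inverse w"
  have u0: "u \<noteq> 0" using uW W0 by simp
  have z0: "z \<noteq> 0" using u0 c0 dd(1) by (simp add: z_def)
  \<comment> \<open>The exponents match because n = 2 (g + 1) for the powers of u and 2 (n - 1) = (n
    + 1) + d for those of f_0.\<close>
  have zN: "z ^ 2 * nrm F W = fK 0 ^ (n + 1)"
  proof -
    have e1: "u ^ n = (u ^ (g + 1)) ^ 2"
    proof -
      have "n = (g + 1) * 2" using n by simp
      thus ?thesis by (simp only: power_mult)
    qed
    have e2: "(fK 0 ^ (n - 1)) ^ 2 = fK 0 ^ (n + 1) * fK 0 ^ d"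
    proof -
      have "(n - 1) * 2 = (n + 1) + d" using n g by (simp add: d_def)
      thus ?thesis by (metis power_add power_mult)
    qed
    have "z ^ 2 * nrm F W = (inverse (u ^ (g + 1)) * u ^ (g + 1)) ^ 2 * (inverse w * w) ^ 2 *
        ((fK 0 ^ (n - 1)) ^ 2 / fK 0 ^ d)"
      unfolding dd(3) z_def uW[symmetric] e1 by (simp only: power_mult_distrib divide_inverse mult_ac)
    also have "\<dots> = 1 ^ 2 * 1 ^ 2 * (fK 0 ^ (n + 1) * fK 0 ^ d / fK 0 ^ d)"
    proof -
      have "u ^ (g + 1) \<noteq> 0" using u0 by simp
      thus ?thesis unfolding e2 by (simp only: left_inverse dd(1) not_False_eq_True)
    qed
    also have "\<dots> = fK 0 ^ (n + 1)" using c0 by simp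
    finally show ?thesis .
  qed
  obtain bb where bb: "\<And>j i. j < degree F \<Longrightarrow> i \<ge> degree F \<Longrightarrow> coeff (bb j) i = 0"
    "det (coef_mat (degree F) bb) = z"
    "\<And>i j. i < degree F \<Longrightarrow> j < degree F \<Longrightarrow> rho F (W * bb i * bb j) \<in> A"
    "\<And>i j. i < degree F \<Longrightarrow> j < degree F \<Longrightarrow> rho F (monom 1 1 * W * bb i * bb j) \<in> A"
  proof (rule integral_adapted_basis[of F "g + 1" W d g "of_nat N" l Q S V z])
    show "of_nat N \<in> A" by (induction N) (auto intro: add_in)
    show "(of_nat N :: 'a fract) \<noteq> 0" using dd(4) by simp
    show "z ^ 2 * nrm F W = lead_coeff F ^ (degree F + 1)" using zN F by simp
    show "(V * V) mod Q = shear (of_nat N) (degree F) F mod Q" using dd(7) F by simp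
    show "degree F = 2 * (g + 1)" using F n by simp
    show "d + 1 = 2 * g" using g by (simp add: d_def)
  qed (use F_int W_prim degW dd(5,6) in auto)
  have bb_adapted: "bb \<in> adapted_bases n fK z"
    using adapted_bases_iff[of n fK, OF n0 c0] bb(1,2) F(1) by simp
  define v where "v = (gram F W bb, gram F (monom 1 1 * W) bb)"
  have v: "v \<in> V_form n fK"
    unfolding v_def F_def by (rule gram_pair_in_V_form[of n fK, OF n0 c0 bb_adapted]) (use zN in \<open>simp add: F_def\<close>)
  have \<alpha>': "\<alpha> = Lf_class n fK W" unfolding \<alpha> W_def d_def UK_def by simp
  have pair: "(\<alpha>, z) \<in> norm_pairs n fK"
    unfolding \<alpha>' by (rule norm_pairsI[of n fK, OF n0 c0 z0]) (use zN in \<open>simp add: F_def\<close>)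
  have orbit: "orbit_of_pair n fK (\<alpha>, z) = SL_orbit n v"
    unfolding \<alpha>' v_def F_def by (rule orbit_of_pair_eq[of n fK, OF n0 c0 z0 bb_adapted])
  have "orbit_of_pair n fK (\<alpha>, z) \<in> SL_orbits n fK"
    unfolding orbit SL_orbits_def using v by blast
  moreover have "v \<in> SL_orbit n v"
    unfolding v_def using gram_carrier[of F _ bb] by (intro SL_orbit_self) (simp_all only: F(1))
  moreover have "v \<in> (\<lambda>(P, Q). (map_mat to_fract P, map_mat to_fract Q)) ` V_form n f"
    unfolding v_def
  proof (rule V_form_lift)
    show "(gram F W bb, gram F (monom 1 1 * W) bb) \<in> V_form n (\<lambda>i. to_fract (f i))"
      using v unfolding v_def fK .
  qed (use bb(3,4) in \<open>simp_all add: gram_def F(1) A_def\<close>)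
  ultimately have "orbit_of_pair n fK (\<alpha>, z) \<in> SL_orbits n fK"
    "orbit_of_pair n fK (\<alpha>, z) \<inter> (\<lambda>(P, Q). (map_mat to_fract P, map_mat to_fract Q)) ` V_form n f \<noteq> {}"
    unfolding orbit by blast+
  with pair dd(1,2) show ?thesis
    unfolding Let_def z_def d_def by blast
qed

end
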